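(* Let $(\mathcal M,\tau)$ be a finite von Neumann algebra with a normal faithful tracial state. Let $W=(x_i)_{i\in I}\subseteq\mathcal M$ be an orthonormal system whose constants $Z_2^c(W)$ and $Z_2^r(W)$ (defined in the context) are both finite, and put $Z_2(W)=\max\{Z_2^c(W),Z_2^r(W)\}$. Then for every $d,l\in\mathbb N$, every family of pairwise distinct elements $x_1,\ldots,x_l\in W$, and every $C_{x_1},\ldots,C_{x_l}\in M_d(\mathbb C)$, $$\left\|\sum_{i=1}^l C_{x_i}\otimes x_i\right\|_1\le \|(C_{x_i})_{i=1}^l\|_{S_1^d(\ell_2)}\le \sqrt{1+Z_2(W)}\,\left\|\sum_{i=1}^l C_{x_i}\otimes x_i\right\|_1 .$$ Here $\|\cdot\|_1$ is the $L_1$ norm on $M_d(\mathbb C)\otimes\mathcal M$ with respect to $\operatorname{tr}\otimes\tau$.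
   Context: $\operatorname{tr}$ is the usual unnormalized trace on $M_d(\mathbb C)$, and $\|f\|_1=(\operatorname{tr}\otimes\tau)(|f|)$ with $|f|=(f^*f)^{1/2}$. Orthonormal system: a family $W=(x_i)_{i\in I}$ with $\tau(x_i^*x_j)=\delta_{ij}$. Constants $Z_2^c,Z_2^r$: put $z^c_{ij}=x_i^*x_j-\delta_{ij}1$ and $z^r_{ij}=x_ix_j^*-\delta_{ij}1$. $Z_2^c(W)$ (resp. $Z_2^r(W)$) is the least constant $Z$ such that, for every finitely supported scalar array $(a_{ij})_{i,j\in I}$, $\left\|\sum_{i,j}a_{ij}z_{ij}\right\|_2^2\le Z\sum_{i,j}|a_{ij}|^2$ with $z_{ij}=z_{ij}^c$ (resp. $z_{ij}=z_{ij}^r$), where $\|y\|_2^2=\tau(y^*y)$; it is $\infty$ if there is no such constant. Coefficient norm: for a finite family $(C_k)$ in $M_d(\mathbb C)$, $$\|(C_k)\|_{S_1^d(\ell_2)}=\inf\left\{\operatorname{tr}\Big(\sum_kX_k^*X_k\Big)^{1/2}+\operatorname{tr}\Big(\sum_kY_kY_k^*\Big)^{1/2}: C_k=X_k+Y_k,\ X_k,Y_k\in M_d(\mathbb C)\right\}.$$ *)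

theory Defs
  imports "HOL-Analysis.Analysis"
begin

section \<open>Complex Hilbert spaces\<close>

text \<open>
  The complex inner product is conjugate-linear in its first argument. The real inner product, norm
  and topology are the ones inherited from the library classes, tied to it by \<open>inner_eq_Re_cinner\<close>.
\<close>

class complex_hilbert_space = real_inner + complete_space +
  fixes scaleC :: "complex \<Rightarrow> 'a \<Rightarrow> 'a" (infixr "*\<^sub>C" 75)
    and cinner :: "'a \<Rightarrow> 'a \<Rightarrow> complex"
  assumes scaleC_add_right: "c *\<^sub>C (x + y) = c *\<^sub>C x + c *\<^sub>C y"
    and scaleC_add_left: "(c + c') *\<^sub>C x = c *\<^sub>C x + c' *\<^sub>C x"
    and scaleC_scaleC: "c *\<^sub>C (c' *\<^sub>C x) = (c * c') *\<^sub>C x"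
    and scaleR_eq_scaleC: "r *\<^sub>R x = complex_of_real r *\<^sub>C x"
    and cinner_commute: "cinner x y = cnj (cinner y x)"
    and cinner_add_right: "cinner x (y + z) = cinner x y + cinner x z"
    and cinner_scaleC_right: "cinner x (c *\<^sub>C y) = c * cinner x y"
    and inner_eq_Re_cinner: "inner x y = Re (cinner x y)"

lemma cinner_scaleC_left: "cinner (c *\<^sub>C x) y = cnj c * cinner x y"
  by (subst (1 2) cinner_commute) (simp add: cinner_scaleC_right)

lemma norm_scaleC: "norm (c *\<^sub>C x) = cmod c * norm x"
proof -
  have "cinner (c *\<^sub>C x) (c *\<^sub>C x) = complex_of_real ((cmod c)\<^sup>2) * cinner x x"
    unfolding complex_norm_square
    by (simp only: cinner_scaleC_left cinner_scaleC_right mult.assoc)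
  then have "(norm (c *\<^sub>C x))\<^sup>2 = (cmod c * norm x)\<^sup>2"
    by (simp only: power2_norm_eq_inner inner_eq_Re_cinner power_mult_distrib Re_complex_of_real
        times_complex.sel Im_complex_of_real mult_zero_left diff_zero)
  then show ?thesis
    by (metis norm_ge_zero mult_nonneg_nonneg power2_eq_imp_eq)
qed

lemma bounded_linear_scaleC_right: "bounded_linear (\<lambda>x. c *\<^sub>C x)"
proof (rule bounded_linear_intro)
  show "c *\<^sub>C (r *\<^sub>R x) = r *\<^sub>R (c *\<^sub>C x)" for r and x :: 'a
    by (simp add: scaleR_eq_scaleC scaleC_scaleC mult.commute)
  show "norm (c *\<^sub>C x) \<le> norm x * cmod c" for x :: 'a
    by (simp add: norm_scaleC)
qed (rule scaleC_add_right)

instantiation complex :: complex_hilbert_space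
begin

definition "scaleC_complex (c :: complex) (x :: complex) = c * x"

definition "cinner_complex (x :: complex) (y :: complex) = cnj x * y"

instance
  by standard
    (auto simp: scaleC_complex_def cinner_complex_def algebra_simps scaleR_conv_of_real
      inner_complex_def)

end

instantiation vec :: (complex_hilbert_space, finite) complex_hilbert_space
begin

definition "scaleC_vec (c :: complex) (v :: 'a ^ 'b) = (\<chi> i. c *\<^sub>C (v $ i))"

definition "cinner_vec (v :: 'a ^ 'b) (w :: 'a ^ 'b) = (\<Sum>i\<in>UNIV. cinner (v $ i) (w $ i))"

instance
proof
  fix c c' :: complex and r :: real and x y z :: "'a ^ 'b"
  show "c *\<^sub>C (x + y) = c *\<^sub>C x + c *\<^sub>C y" "(c + c') *\<^sub>C x = c *\<^sub>C x + c' *\<^sub>C x"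
    "c *\<^sub>C (c' *\<^sub>C x) = (c * c') *\<^sub>C x" "r *\<^sub>R x = complex_of_real r *\<^sub>C x"
    by (simp_all add: scaleC_vec_def vec_eq_iff scaleC_add_right scaleC_add_left scaleC_scaleC
        scaleR_eq_scaleC)
  show "cinner x y = cnj (cinner y x)"
    unfolding cinner_vec_def by (subst cinner_commute) simp
  show "cinner x (y + z) = cinner x y + cinner x z" "cinner x (c *\<^sub>C y) = c * cinner x y"
    "inner x y = Re (cinner x y)"
    by (simp_all add: cinner_vec_def scaleC_vec_def inner_vec_def cinner_add_right
        cinner_scaleC_right inner_eq_Re_cinner sum.distrib sum_distrib_left)
qed

end


section \<open>Bounded operators\<close>

text \<open>
  \<open>'h \<Rightarrow>\<^sub>L 'h\<close> is the space of bounded real-linear operators; the bounded operators of the complex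
  Hilbert space are the members of \<open>bounded_ops\<close>.
\<close>

definition bounded_ops :: "('h::complex_hilbert_space \<Rightarrow>\<^sub>L 'h) set" where
  "bounded_ops = {T. \<forall>c v. blinfun_apply T (c *\<^sub>C v) = c *\<^sub>C blinfun_apply T v}"

lift_definition op_scale ::
  "complex \<Rightarrow> ('h::complex_hilbert_space \<Rightarrow>\<^sub>L 'h) \<Rightarrow> ('h \<Rightarrow>\<^sub>L 'h)" is "\<lambda>c T v. c *\<^sub>C T v"
  by (rule bounded_linear_compose[OF bounded_linear_scaleC_right])

text \<open>The adjoint of a member of \<open>bounded_ops\<close>; it is unspecified for other operators.\<close>

definition adj :: "('h::complex_hilbert_space \<Rightarrow>\<^sub>L 'h) \<Rightarrow> ('h \<Rightarrow>\<^sub>L 'h)" where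
  "adj T = (THE S. \<forall>v w. cinner (blinfun_apply S v) w = cinner v (blinfun_apply T w))"

definition op_pos :: "('h::complex_hilbert_space \<Rightarrow>\<^sub>L 'h) \<Rightarrow> bool" where
  "op_pos T \<longleftrightarrow> T \<in> bounded_ops \<and> (\<forall>v. cinner v (blinfun_apply T v) \<in> nonneg_Reals)"

definition op_le :: "('h::complex_hilbert_space \<Rightarrow>\<^sub>L 'h) \<Rightarrow> ('h \<Rightarrow>\<^sub>L 'h) \<Rightarrow> bool" where
  "op_le S T \<longleftrightarrow> op_pos (T - S)"

definition op_sqrt :: "('h::complex_hilbert_space \<Rightarrow>\<^sub>L 'h) \<Rightarrow> ('h \<Rightarrow>\<^sub>L 'h)" where
  "op_sqrt T = (THE S. op_pos S \<and> S o\<^sub>L S = T)"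

definition op_abs :: "('h::complex_hilbert_space \<Rightarrow>\<^sub>L 'h) \<Rightarrow> ('h \<Rightarrow>\<^sub>L 'h)" where
  "op_abs T = op_sqrt (adj T o\<^sub>L T)"


section \<open>Finite von Neumann algebras\<close>

definition commutant ::
  "('h::complex_hilbert_space \<Rightarrow>\<^sub>L 'h) set \<Rightarrow> ('h \<Rightarrow>\<^sub>L 'h) set" where
  "commutant S = {T \<in> bounded_ops. \<forall>s\<in>S. T o\<^sub>L s = s o\<^sub>L T}"

text \<open>A commutant is a unital subalgebra, so these properties need not be required separately.\<close>

definition von_neumann_algebra :: "('h::complex_hilbert_space \<Rightarrow>\<^sub>L 'h) set \<Rightarrow> bool" where
  "von_neumann_algebra M \<longleftrightarrow>
     M \<subseteq> bounded_ops \<and> (\<forall>a\<in>M. adj a \<in> M) \<and> commutant (commutant M) = M"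

definition finite_von_neumann_algebra :: "('h::complex_hilbert_space \<Rightarrow>\<^sub>L 'h) set \<Rightarrow> bool" where
  "finite_von_neumann_algebra M \<longleftrightarrow> von_neumann_algebra M \<and>
     (\<forall>v\<in>M. adj v o\<^sub>L v = id_blinfun \<longrightarrow> v o\<^sub>L adj v = id_blinfun)"

definition state_on ::
  "('h::complex_hilbert_space \<Rightarrow>\<^sub>L 'h) set \<Rightarrow> (('h \<Rightarrow>\<^sub>L 'h) \<Rightarrow> complex) \<Rightarrow> bool" where
  "state_on M \<tau> \<longleftrightarrow>
     (\<forall>a\<in>M. \<forall>b\<in>M. \<tau> (a + b) = \<tau> a + \<tau> b) \<and>
     (\<forall>c. \<forall>a\<in>M. \<tau> (op_scale c a) = c * \<tau> a) \<and>
     (\<forall>a\<in>M. \<tau> (adj a o\<^sub>L a) \<in> nonneg_Reals) \<and>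
     \<tau> id_blinfun = 1"

definition tracial_on ::
  "('h::complex_hilbert_space \<Rightarrow>\<^sub>L 'h) set \<Rightarrow> (('h \<Rightarrow>\<^sub>L 'h) \<Rightarrow> complex) \<Rightarrow> bool" where
  "tracial_on M \<tau> \<longleftrightarrow> (\<forall>a\<in>M. \<forall>b\<in>M. \<tau> (a o\<^sub>L b) = \<tau> (b o\<^sub>L a))"

definition faithful_on ::
  "('h::complex_hilbert_space \<Rightarrow>\<^sub>L 'h) set \<Rightarrow> (('h \<Rightarrow>\<^sub>L 'h) \<Rightarrow> complex) \<Rightarrow> bool" where
  "faithful_on M \<tau> \<longleftrightarrow> (\<forall>a\<in>M. \<tau> (adj a o\<^sub>L a) = 0 \<longrightarrow> a = 0)"

text \<open>
  Normality: the functional preserves suprema of bounded, upward directed sets of self-adjoint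
  elements. Here \<open>s\<close> is the least upper bound of \<open>D\<close> among the self-adjoint elements of \<open>M\<close>.
\<close>

definition normal_on ::
  "('h::complex_hilbert_space \<Rightarrow>\<^sub>L 'h) set \<Rightarrow> (('h \<Rightarrow>\<^sub>L 'h) \<Rightarrow> complex) \<Rightarrow> bool" where
  "normal_on M \<tau> \<longleftrightarrow> (let M\<^sub>s\<^sub>a = {a \<in> M. adj a = a} in
     \<forall>D s. D \<subseteq> M\<^sub>s\<^sub>a \<and> D \<noteq> {} \<and> (\<forall>a\<in>D. \<forall>b\<in>D. \<exists>c\<in>D. op_le a c \<and> op_le b c) \<and>
       s \<in> M\<^sub>s\<^sub>a \<and> (\<forall>a\<in>D. op_le a s) \<and> (\<forall>u\<in>M\<^sub>s\<^sub>a. (\<forall>a\<in>D. op_le a u) \<longrightarrow> op_le s u)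
       \<longrightarrow> Re (\<tau> s) = (SUP a\<in>D. Re (\<tau> a)))"

definition normal_faithful_tracial_state ::
  "('h::complex_hilbert_space \<Rightarrow>\<^sub>L 'h) set \<Rightarrow> (('h \<Rightarrow>\<^sub>L 'h) \<Rightarrow> complex) \<Rightarrow> bool" where
  "normal_faithful_tracial_state M \<tau> \<longleftrightarrow>
     state_on M \<tau> \<and> tracial_on M \<tau> \<and> faithful_on M \<tau> \<and> normal_on M \<tau>"


section \<open>Orthonormal systems and the constants of second order\<close>

definition orthonormal_system ::
  "('h::complex_hilbert_space \<Rightarrow>\<^sub>L 'h) set \<Rightarrow> (('h \<Rightarrow>\<^sub>L 'h) \<Rightarrow> complex) \<Rightarrow>
   'i set \<Rightarrow> ('i \<Rightarrow> ('h \<Rightarrow>\<^sub>L 'h)) \<Rightarrow> bool" where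
  "orthonormal_system M \<tau> I x \<longleftrightarrow> (\<forall>i\<in>I. x i \<in> M) \<and>
     (\<forall>i\<in>I. \<forall>j\<in>I. \<tau> (adj (x i) o\<^sub>L x j) = (if i = j then 1 else 0))"

definition zc ::
  "('i \<Rightarrow> ('h::complex_hilbert_space \<Rightarrow>\<^sub>L 'h)) \<Rightarrow> 'i \<times> 'i \<Rightarrow> ('h \<Rightarrow>\<^sub>L 'h)" where
  "zc x = (\<lambda>(i, j). (adj (x i) o\<^sub>L x j) - (if i = j then id_blinfun else 0))"

definition zr ::
  "('i \<Rightarrow> ('h::complex_hilbert_space \<Rightarrow>\<^sub>L 'h)) \<Rightarrow> 'i \<times> 'i \<Rightarrow> ('h \<Rightarrow>\<^sub>L 'h)" where
  "zr x = (\<lambda>(i, j). (x i o\<^sub>L adj (x j)) - (if i = j then id_blinfun else 0))"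

definition norm2_sq ::
  "(('h::complex_hilbert_space \<Rightarrow>\<^sub>L 'h) \<Rightarrow> complex) \<Rightarrow> ('h \<Rightarrow>\<^sub>L 'h) \<Rightarrow> real" where
  "norm2_sq \<tau> y = Re (\<tau> (adj y o\<^sub>L y))"

text \<open>
  The admissible constants form a closed subset of \<open>[0, \<infinity>]\<close> that contains \<open>\<infinity>\<close>, so the infimum is the
  least one, and it is \<open>\<infinity>\<close> when no finite constant is admissible.
\<close>

definition best_const ::
  "(('h::complex_hilbert_space \<Rightarrow>\<^sub>L 'h) \<Rightarrow> complex) \<Rightarrow> 'i set \<Rightarrow> ('i \<times> 'i \<Rightarrow> ('h \<Rightarrow>\<^sub>L 'h)) \<Rightarrow> ennreal"
  where
  "best_const \<tau> I z = Inf {Z. \<forall>a :: 'i \<times> 'i \<Rightarrow> complex.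
     finite {p. a p \<noteq> 0} \<and> {p. a p \<noteq> 0} \<subseteq> I \<times> I \<longrightarrow>
     ennreal (norm2_sq \<tau> (\<Sum>p | a p \<noteq> 0. op_scale (a p) (z p)))
       \<le> Z * ennreal (\<Sum>p | a p \<noteq> 0. (cmod (a p))\<^sup>2)}"

definition Z2c where "Z2c \<tau> I x = best_const \<tau> I (zc x)"

definition Z2r where "Z2r \<tau> I x = best_const \<tau> I (zr x)"

definition Z2 where "Z2 \<tau> I x = max (Z2c \<tau> I x) (Z2r \<tau> I x)"


section \<open>The \<open>L\<^sub>1\<close> norm on matrices over the algebra\<close>

text \<open>
  The tensor product of the \<open>d \<times> d\<close> matrices with an algebra of operators on \<open>'h\<close> acts on
  \<open>'h ^ 'd\<close>, with \<open>d\<close> the cardinality of \<open>'d\<close>; its elements are the operator matrices with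
  entries in the algebra.
\<close>

lemma bounded_linear_axis: "bounded_linear (axis i :: 'a::real_normed_vector \<Rightarrow> 'a ^ 'd)"
proof (rule bounded_linear_intro)
  show "axis i (x + y) = axis i x + (axis i y :: 'a ^ 'd)" for x y :: 'a
    by (simp add: vec_eq_iff axis_def)
  show "axis i (r *\<^sub>R x) = r *\<^sub>R (axis i x :: 'a ^ 'd)" for r and x :: 'a
    by (simp add: vec_eq_iff axis_def)
  show "norm (axis i x :: 'a ^ 'd) \<le> norm x * 1" for x :: 'a
  proof -
    have "norm (axis i x :: 'a ^ 'd) \<le> (\<Sum>k\<in>UNIV. norm ((axis i x :: 'a ^ 'd) $ k))"
      unfolding norm_vec_def by (rule L2_set_le_sum) simp
    also have "\<dots> = (\<Sum>k\<in>UNIV. if k = i then norm x else 0)"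
      by (rule sum.cong) (auto simp: axis_def)
    finally show ?thesis by simp
  qed
qed

lemma vec_eq_sum_axis: "(\<chi> i. f i) = (\<Sum>i\<in>UNIV. axis i (f i) :: 'a::real_normed_vector ^ 'd)"
  by (simp add: vec_eq_iff axis_def)

lift_definition mat_tensor ::
  "complex ^ 'd ^ 'd \<Rightarrow> ('h::complex_hilbert_space \<Rightarrow>\<^sub>L 'h) \<Rightarrow> (('h ^ 'd) \<Rightarrow>\<^sub>L ('h ^ 'd))"
  (infixr "\<otimes>" 75)
  is "\<lambda>C T v. \<chi> i. \<Sum>j\<in>UNIV. (C $ i $ j) *\<^sub>C T (v $ j)"
  unfolding vec_eq_sum_axis
  by (intro bounded_linear_sum bounded_linear_compose[OF bounded_linear_axis]
      bounded_linear_compose[OF bounded_linear_scaleC_right]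
      bounded_linear_compose[OF _ bounded_linear_vec_nth])

lift_definition op_entry ::
  "(('h::complex_hilbert_space ^ 'd) \<Rightarrow>\<^sub>L ('h ^ 'd)) \<Rightarrow> 'd \<Rightarrow> 'd \<Rightarrow> ('h \<Rightarrow>\<^sub>L 'h)"
  is "\<lambda>T i j v. T (axis j v) $ i"
  by (intro bounded_linear_compose[OF bounded_linear_vec_nth]
      bounded_linear_compose[OF _ bounded_linear_axis])

definition tr_tensor ::
  "(('h::complex_hilbert_space \<Rightarrow>\<^sub>L 'h) \<Rightarrow> complex) \<Rightarrow> (('h ^ 'd) \<Rightarrow>\<^sub>L ('h ^ 'd)) \<Rightarrow> complex" where
  "tr_tensor \<tau> f = (\<Sum>i\<in>UNIV. \<tau> (op_entry f i i))"

definition L1_norm ::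
  "(('h::complex_hilbert_space \<Rightarrow>\<^sub>L 'h) \<Rightarrow> complex) \<Rightarrow> (('h ^ 'd) \<Rightarrow>\<^sub>L ('h ^ 'd)) \<Rightarrow> real" where
  "L1_norm \<tau> f = Re (tr_tensor \<tau> (op_abs f))"


section \<open>The coefficient norm\<close>

definition mat_adj :: "complex ^ 'd ^ 'd \<Rightarrow> complex ^ 'd ^ 'd" where
  "mat_adj A = (\<chi> i j. cnj (A $ j $ i))"

definition mat_pos :: "complex ^ 'd ^ 'd \<Rightarrow> bool" where
  "mat_pos A \<longleftrightarrow> (\<forall>v. cinner v (A *v v) \<in> nonneg_Reals)"

definition mat_sqrt :: "complex ^ 'd ^ 'd \<Rightarrow> complex ^ 'd ^ 'd" where
  "mat_sqrt A = (THE B. mat_pos B \<and> B ** B = A)"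

definition S1_l2_norm :: "'k set \<Rightarrow> ('k \<Rightarrow> complex ^ 'd ^ 'd) \<Rightarrow> real" where
  "S1_l2_norm K C = Inf {Re (trace (mat_sqrt (\<Sum>k\<in>K. mat_adj (X k) ** X k))) +
                         Re (trace (mat_sqrt (\<Sum>k\<in>K. Y k ** mat_adj (Y k)))) | X Y.
                         \<forall>k\<in>K. C k = X k + Y k}"

end

theory Submission imports Defs begin

text \<open>
  Write \<open>c X = tr (\<Sum>k X\<^sub>k\<^sup>* X\<^sub>k)\<^sup>1\<^sup>/\<^sup>2\<close>. Both here and for the \<open>L\<^sub>1\<close> norm, the trace of a square root is the
  supremum of the pairings with contractions; this makes \<open>c\<close> a seminorm and, together with
  \<open>(id \<otimes> \<tau>) (g\<^sup>* g) = \<Sum>k X\<^sub>k\<^sup>* X\<^sub>k\<close> for \<open>g = \<Sum>k X\<^sub>k \<otimes> x\<^sub>k\<close>, gives the first inequality.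

  For the second one, a Hahn--Banach argument reduces to bounding \<open>\<Sum>k \<langle>B\<^sub>k, C\<^sub>k\<rangle>\<close> by
  \<open>(1 + Z)\<^sup>1\<^sup>/\<^sup>2\<close> times the \<open>L\<^sub>1\<close> norm whenever \<open>\<Sum>k B\<^sub>k\<^sup>* B\<^sub>k \<le> 1\<close> and \<open>\<Sum>k B\<^sub>k B\<^sub>k\<^sup>* \<le> 1\<close>. Put
  \<open>y = \<Sum>k B\<^sub>k \<otimes> x\<^sub>k\<close> and \<open>c = 1 + Z\<close>. The cut-off \<open>z = y (1 + y\<^sup>* y / c)\<^sup>-\<^sup>1\<close> has norm at most
  \<open>c\<^sup>1\<^sup>/\<^sup>2 / 2\<close>, and \<open>|y - z|\<^sup>2 \<le> (y\<^sup>* y)\<^sup>2 / (4 c)\<close>, likewise for the adjoints. The definition of \<open>Z\<close>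
  bounds \<open>(id \<otimes> \<tau>) ((y\<^sup>* y)\<^sup>2)\<close> by \<open>1 + Z\<close>, so by Bessel's inequality the coefficients of \<open>y - z\<close> are
  half an admissible family. Hence the supremum \<open>m\<close> of the pairings is at most
  \<open>c\<^sup>1\<^sup>/\<^sup>2 / 2\<close> times the \<open>L\<^sub>1\<close> norm plus \<open>m / 2\<close>.
\<close>

text \<open>The obstacle in the reverse inequality is that an admissible \<open>y\<close> has no
  usable operator norm bound: only its second and fourth moments are controlled, so it cannot be
  paired with an \<open>L1\<close> element directly. The constants of the cut-off come from the
  scalar inequality \<open>4 * c * s \<le> (s + c)^2\<close>: the discarded part gains a factor
  \<open>1 / (4 * c)\<close> against the fourth moment, and \<open>c = 1 + Z\<close> turns this into
  exactly \<open>1 / 4\<close>, so that the doubled coefficients are admissible again. Absorbing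
  \<open>m / 2\<close> gives the factor \<open>2 * (sqrt c / 2)\<close>; this requires
  \<open>m\<close> to be finite beforehand. Admissibility has a column half and a row half, and the
  same cut-off serves both because \<open>y (adj y y + c)^-1 = (y adj y + c)^-1 y\<close>. Polar
  parts and spectral cut-offs are avoided in favour of resolvents, which stay inside any norm closed
  unital algebra; square roots and inverses of \<open>p + e\<close> are all the functional calculus
  that occurs.\<close>

lemmas blinfun_compose_simps =
  bounded_bilinear.add_left[OF bounded_bilinear_blinfun_compose]
  bounded_bilinear.add_right[OF bounded_bilinear_blinfun_compose]
  bounded_bilinear.diff_left[OF bounded_bilinear_blinfun_compose]
  bounded_bilinear.diff_right[OF bounded_bilinear_blinfun_compose]
  bounded_bilinear.minus_left[OF bounded_bilinear_blinfun_compose]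
  bounded_bilinear.minus_right[OF bounded_bilinear_blinfun_compose]
  bounded_bilinear.scaleR_left[OF bounded_bilinear_blinfun_compose]
  bounded_bilinear.scaleR_right[OF bounded_bilinear_blinfun_compose]
  bounded_bilinear.sum_left[OF bounded_bilinear_blinfun_compose]
  bounded_bilinear.sum_right[OF bounded_bilinear_blinfun_compose]

lemma blinfun_compose_assoc: "(a o\<^sub>L b) o\<^sub>L c = a o\<^sub>L (b o\<^sub>L c)"
  by (rule blinfun_eqI) simp

lemma blinfun_compose_id [simp]: "id_blinfun o\<^sub>L a = a" "a o\<^sub>L id_blinfun = a"
  by (rule blinfun_eqI, simp)+

lemmas blinfun_compose_algebra = blinfun_compose_simps blinfun_compose_assoc

section \<open>Adjoints\<close>

text \<open>The representing vector minimises the energy \<open>J v\<close>. The real form suffices,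
  since a complex inner product is determined by its real part.\<close>

lemma Riesz_representation:
  fixes f :: "'a::{real_inner, complete_space} \<Rightarrow> real"
  assumes "bounded_linear f"
  shows "\<exists>v. \<forall>w. inner v w = f w"
proof -
  interpret f: bounded_linear f by fact
  obtain B where B: "\<And>w. \<bar>f w\<bar> \<le> B * norm w"
    using f.bounded by (metis mult.commute real_norm_def)
  define J where "J v = (norm v)\<^sup>2 - 2 * f v" for v
  have lower: "- (B\<^sup>2) \<le> J v" for v
  proof -
    have "0 \<le> (norm v - B)\<^sup>2" by simp
    moreover have "f v \<le> B * norm v" using B[of v] by linarith
    ultimately show ?thesis unfolding J_def power2_diff by (simp add: mult.commute)
  qed
  define m where "m = Inf (range J)"
  have bdd: "bdd_below (range J)" using lower by (intro bdd_belowI[of _ "- (B\<^sup>2)"]) auto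
  have m: "m \<le> J v" for v unfolding m_def by (rule cInf_lower[OF _ bdd]) simp
  have "\<exists>v. J v < m + 1 / real (Suc n)" for n
  proof -
    have "Inf (range J) < m + 1 / real (Suc n)" unfolding m_def by simp
    from cInf_lessD[OF _ this] show ?thesis by auto
  qed
  then obtain u where u: "\<And>n. J (u n) < m + 1 / real (Suc n)" by metis
  \<comment> \<open>Parallelogram law for the energy: the midpoint has energy at least
    \<open>m\<close>, so near-minimisers are close to each other.\<close>
  have par: "(norm (v - w))\<^sup>2 \<le> 2 * (J v - m) + 2 * (J w - m)" for v w
  proof -
    have "(norm (v - w))\<^sup>2 = 2 * J v + 2 * J w - 4 * J ((1/2) *\<^sub>R (v + w))"
      unfolding J_def power2_norm_eq_inner f.scaleR f.add
      by (simp add: inner_diff_left inner_diff_right inner_add_left inner_add_right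
          inner_commute algebra_simps)
    moreover have "4 * m \<le> 4 * J ((1/2) *\<^sub>R (v + w))" using m by simp
    ultimately show ?thesis by (simp only: right_diff_distrib)
  qed
  have "Cauchy u"
  proof (rule metric_CauchyI)
    fix e :: real assume e: "0 < e"
    obtain N where N: "inverse (real (Suc N)) < e\<^sup>2 / 4"
      using reals_Archimedean[of "e\<^sup>2 / 4"] e by auto
    show "\<exists>M. \<forall>i\<ge>M. \<forall>j\<ge>M. dist (u i) (u j) < e"
    proof (intro exI allI impI)
      fix i j assume ij: "N \<le> i" "N \<le> j"
      have "1 / real (Suc i) \<le> 1 / real (Suc N)" "1 / real (Suc j) \<le> 1 / real (Suc N)"
        using ij by (simp_all add: field_simps)
      then have "(norm (u i - u j))\<^sup>2 < e\<^sup>2"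
        using par[of "u i" "u j"] u[of i] u[of j] N by (simp add: inverse_eq_divide)
      then show "dist (u i) (u j) < e"
        unfolding dist_norm using e by (simp add: power2_less_imp_less)
    qed
  qed
  then obtain v where v: "u \<longlonglongrightarrow> v" using Cauchy_convergent convergent_def by blast
  have "(\<lambda>n. J (u n)) \<longlonglongrightarrow> J v"
    unfolding J_def by (intro tendsto_intros v f.tendsto)
  moreover have "(\<lambda>n. m + 1 / real (Suc n)) \<longlonglongrightarrow> m + 0"
    by (intro tendsto_intros LIMSEQ_inverse_real_of_nat[unfolded inverse_eq_divide])
  ultimately have "J v \<le> m + 0"
    by (rule LIMSEQ_le) (use u less_imp_le in blast)
  then have min: "J v \<le> J w" for w using m[of w] by simp
  have "inner v w = f w" for w
  proof (cases "w = 0")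
    case False
    define d where "d = inner v w - f w"
    have *: "0 \<le> 2 * t * d + t\<^sup>2 * inner w w" for t
      using min[of "v + t *\<^sub>R w"] unfolding J_def power2_norm_eq_inner f.add f.scaleR d_def
      by (simp add: inner_add_left inner_add_right inner_commute power2_eq_square algebra_simps)
    \<comment> \<open>The step length \<open>- d / inner w w\<close> minimises the quadratic in
      \<open>t\<close>, and the minimum is negative unless \<open>d = 0\<close>.\<close>
    have "0 \<le> - (d\<^sup>2 / inner w w)"
      using *[of "- d / inner w w"] False by (simp add: power2_eq_square field_simps)
    moreover have "0 < inner w w" using False by simp
    ultimately have "d = 0" by (simp add: divide_le_0_iff zero_le_divide_iff)
    then show ?thesis by (simp add: d_def)
  qed simp
  then show ?thesis by blast
qed

text \<open>The imaginary part is a real inner product with a rotated vector, so identities for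
  complex linear operators reduce to real ones.\<close>

lemma cinner_eq_inner: "cinner v w = Complex (inner v w) (- inner v (\<i> *\<^sub>C w))"
  by (simp add: inner_eq_Re_cinner cinner_scaleC_right complex_eq_iff)

lemma inner_scaleC_i: "inner (\<i> *\<^sub>C v) w = - inner v (\<i> *\<^sub>C w)"
  by (simp add: inner_eq_Re_cinner cinner_scaleC_right cinner_scaleC_left)

lemma inner_scaleC_left: "inner (c *\<^sub>C v) w = inner v (cnj c *\<^sub>C w)"
  by (simp add: inner_eq_Re_cinner cinner_scaleC_right cinner_scaleC_left)

lemma bounded_opsD: "T \<in> bounded_ops \<Longrightarrow> blinfun_apply T (c *\<^sub>C v) = c *\<^sub>C blinfun_apply T v"
  by (simp add: bounded_ops_def)

lemma op_ext_inner:
  assumes "\<And>v w. inner (blinfun_apply S v) w = inner (blinfun_apply S' v) w"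
  shows "S = (S' :: 'a::real_inner \<Rightarrow>\<^sub>L 'a)"
  by (rule blinfun_eqI) (metis assms vector_eq_rdot)

lemma ex_real_adjoint:
  fixes T :: "'a::{real_inner, complete_space} \<Rightarrow>\<^sub>L 'a"
  shows "\<exists>S::'a \<Rightarrow>\<^sub>L 'a. \<forall>v w. inner (blinfun_apply S v) w = inner v (blinfun_apply T w)"
proof -
  have "\<exists>u. \<forall>w. inner u w = inner v (blinfun_apply T w)" for v
    by (rule Riesz_representation)
      (intro bounded_linear_compose[OF bounded_linear_inner_right] blinfun.bounded_linear_right)
  then obtain s where s: "\<And>v w. inner (s v) w = inner v (blinfun_apply T w)" by metis
  have "bounded_linear s"
  proof (rule bounded_linear_intro)
    show "s (x + y) = s x + s y" for x y
      by (subst vector_eq_rdot[symmetric]) (simp add: s inner_add_left)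
    show "s (r *\<^sub>R x) = r *\<^sub>R s x" for r x
      by (subst vector_eq_rdot[symmetric]) (simp add: s)
    show "norm (s x) \<le> norm x * norm T" for x
    proof -
      have "(norm (s x))\<^sup>2 = inner x (blinfun_apply T (s x))"
        by (simp add: s power2_norm_eq_inner)
      also have "\<dots> \<le> norm x * (norm T * norm (s x))"
        by (rule order_trans[OF norm_cauchy_schwarz mult_left_mono[OF norm_blinfun]]) simp
      finally show ?thesis
        by (cases "norm (s x) = 0") (auto simp: power2_eq_square mult.assoc[symmetric])
    qed
  qed
  then show ?thesis
    by (intro exI[of _ "Blinfun s"]) (simp add: bounded_linear_Blinfun_apply s)
qed

text \<open>The definite description in \<open>adj\<close> needs existence and uniqueness. The real
  adjoint is already the complex one because \<open>T\<close> commutes with multiplication by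
  \<open>\<i>\<close>; uniqueness follows from the real parts alone.\<close>

lemma adj_works:
  assumes T: "T \<in> bounded_ops"
  shows "cinner (blinfun_apply (adj T) v) w = cinner v (blinfun_apply T w)"
proof -
  obtain S :: "'a \<Rightarrow>\<^sub>L 'a" where
    S: "\<And>v w. inner (blinfun_apply S v) w = inner v (blinfun_apply T w)"
    using ex_real_adjoint[of T] by blast
  have "\<exists>!S. \<forall>v w. cinner (blinfun_apply S v) w = cinner v (blinfun_apply T w)"
  proof (rule ex1I[of _ S])
    show "\<forall>v w. cinner (blinfun_apply S v) w = cinner v (blinfun_apply T w)"
      by (simp add: cinner_eq_inner S bounded_opsD[OF T])
    show "S' = S" if "\<forall>v w. cinner (blinfun_apply S' v) w = cinner v (blinfun_apply T w)" for S'
      by (rule op_ext_inner) (simp add: S inner_eq_Re_cinner[of "blinfun_apply S' _"] that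
          inner_eq_Re_cinner[symmetric])
  qed
  from theI'[OF this] show ?thesis unfolding adj_def by blast
qed

lemma adj_inner:
  "T \<in> bounded_ops \<Longrightarrow> inner (blinfun_apply (adj T) v) w = inner v (blinfun_apply T w)"
  by (simp add: inner_eq_Re_cinner adj_works)

lemma adj_inner_right:
  "T \<in> bounded_ops \<Longrightarrow> inner v (blinfun_apply (adj T) w) = inner (blinfun_apply T v) w"
  by (metis adj_inner inner_commute)

lemma adj_unique:
  assumes "T \<in> bounded_ops"
    and "\<And>v w. inner (blinfun_apply S v) w = inner v (blinfun_apply T w)"
  shows "adj T = S"
  by (rule op_ext_inner) (simp add: adj_inner assms)

lemmas scaleC_zero_right [simp] = linear_0[OF bounded_linear.linear[OF bounded_linear_scaleC_right]]
  and scaleC_diff_right = linear_diff[OF bounded_linear.linear[OF bounded_linear_scaleC_right]]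
  and scaleC_sum_right = linear_sum[OF bounded_linear.linear[OF bounded_linear_scaleC_right]]

section \<open>Closure properties of bounded operators and the algebra of adjoints\<close>

lemma bounded_ops_zero [simp]: "0 \<in> bounded_ops"
  and bounded_ops_id [simp]: "id_blinfun \<in> bounded_ops"
  by (auto simp: bounded_ops_def)

context
  fixes S T :: "'a::complex_hilbert_space \<Rightarrow>\<^sub>L 'a"
  assumes S: "S \<in> bounded_ops"
begin

lemma bounded_ops_op_scale [intro]: "op_scale c S \<in> bounded_ops"
  and bounded_ops_scaleR [intro]: "r *\<^sub>R S \<in> bounded_ops"
  using S by (auto simp: bounded_ops_def blinfun.bilinear_simps op_scale.rep_eq
      scaleR_eq_scaleC scaleC_scaleC mult.commute)

lemma bounded_ops_add [intro]: "T \<in> bounded_ops \<Longrightarrow> S + T \<in> bounded_ops"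
  and bounded_ops_diff [intro]: "T \<in> bounded_ops \<Longrightarrow> S - T \<in> bounded_ops"
  and bounded_ops_compose [intro]: "T \<in> bounded_ops \<Longrightarrow> S o\<^sub>L T \<in> bounded_ops"
  using S by (auto simp: bounded_ops_def blinfun.bilinear_simps scaleC_add_right scaleC_diff_right)

end

lemma bounded_ops_sum [intro]: "(\<And>k. k \<in> K \<Longrightarrow> f k \<in> bounded_ops) \<Longrightarrow> sum f K \<in> bounded_ops"
  by (induction K rule: infinite_finite_induct) auto

lemma closed_bounded_ops: "closed bounded_ops"
proof -
  have "closed {T. \<forall>c v. blinfun_apply T (c *\<^sub>C v) = c *\<^sub>C blinfun_apply T (v :: 'a)}"
  proof (intro closed_Collect_all closed_Collect_eq)
    show "continuous_on UNIV (\<lambda>T. blinfun_apply T (c *\<^sub>C v))" for c and v :: 'a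
      by (intro linear_continuous_on bounded_linear_apply_blinfun)
    show "continuous_on UNIV (\<lambda>T. c *\<^sub>C blinfun_apply T v)" for c and v :: 'a
      by (intro linear_continuous_on bounded_linear_compose[OF bounded_linear_scaleC_right]
          bounded_linear_apply_blinfun)
  qed
  then show ?thesis by (simp add: bounded_ops_def)
qed

lemma adj_bounded_ops [intro]:
  assumes "T \<in> bounded_ops" shows "adj T \<in> bounded_ops"
  unfolding bounded_ops_def
proof (intro CollectI allI)
  show "blinfun_apply (adj T) (c *\<^sub>C v) = c *\<^sub>C blinfun_apply (adj T) v" for c v
    by (subst vector_eq_rdot[symmetric])
      (simp add: adj_inner assms inner_scaleC_left bounded_opsD[OF assms])
qed

lemma adj_adj [simp]: "T \<in> bounded_ops \<Longrightarrow> adj (adj T) = T"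
  by (rule adj_unique) (auto simp: adj_inner_right)

lemma adj_id [simp]: "adj id_blinfun = id_blinfun"
  and adj_zero [simp]: "adj 0 = 0"
  by (rule adj_unique; simp)+

lemma adj_compose: "S \<in> bounded_ops \<Longrightarrow> T \<in> bounded_ops \<Longrightarrow> adj (S o\<^sub>L T) = adj T o\<^sub>L adj S"
  by (rule adj_unique) (auto simp: adj_inner)

lemma adj_add: "S \<in> bounded_ops \<Longrightarrow> T \<in> bounded_ops \<Longrightarrow> adj (S + T) = adj S + adj T"
  by (rule adj_unique) (auto simp: adj_inner blinfun.bilinear_simps inner_add_left inner_add_right)

lemma adj_diff: "S \<in> bounded_ops \<Longrightarrow> T \<in> bounded_ops \<Longrightarrow> adj (S - T) = adj S - adj T"
  by (rule adj_unique) (auto simp: adj_inner blinfun.bilinear_simps inner_diff_left inner_diff_right)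

lemma adj_scaleR: "T \<in> bounded_ops \<Longrightarrow> adj (r *\<^sub>R T) = r *\<^sub>R adj T"
  by (rule adj_unique) (auto simp: adj_inner blinfun.bilinear_simps)

lemma adj_op_scale: "T \<in> bounded_ops \<Longrightarrow> adj (op_scale c T) = op_scale (cnj c) (adj T)"
  by (rule adj_unique) (auto simp: adj_inner op_scale.rep_eq inner_scaleC_left bounded_opsD)

lemma adj_sum:
  "(\<And>k. k \<in> K \<Longrightarrow> f k \<in> bounded_ops) \<Longrightarrow> adj (sum f K) = (\<Sum>k\<in>K. adj (f k))"
  by (induction K rule: infinite_finite_induct) (auto simp: adj_add bounded_ops_sum)

lemma norm_adj_le:
  assumes T: "T \<in> bounded_ops" shows "norm (adj T) \<le> norm T"
proof (rule norm_blinfun_bound)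
  fix v
  have "(norm (blinfun_apply (adj T) v))\<^sup>2 = inner v (blinfun_apply T (blinfun_apply (adj T) v))"
    by (simp add: power2_norm_eq_inner adj_inner T)
  also have "\<dots> \<le> norm v * (norm T * norm (blinfun_apply (adj T) v))"
    by (rule order_trans[OF norm_cauchy_schwarz mult_left_mono[OF norm_blinfun]]) simp
  finally show "norm (blinfun_apply (adj T) v) \<le> norm T * norm v"
    by (cases "norm (blinfun_apply (adj T) v) = 0")
      (auto simp: power2_eq_square mult.assoc[symmetric] mult.commute)
qed simp

section \<open>Positive operators, square roots and resolvents\<close>

text \<open>Over the complex numbers a quadratic form with real values is automatically hermitian,
  by polarisation. With real inner products, self-adjointness has to be listed separately.\<close>

lemma op_pos_iff:
  "op_pos T \<longleftrightarrow> T \<in> bounded_ops \<and> adj T = T \<and> (\<forall>v. 0 \<le> inner v (blinfun_apply T v))"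
proof (intro iffI conjI)
  assume T: "op_pos T"
  show bT: "T \<in> bounded_ops" using T by (simp add: op_pos_def)
  have pos: "cinner v (blinfun_apply T v) \<in> nonneg_Reals" for v using T by (simp add: op_pos_def)
  then show "\<forall>v. 0 \<le> inner v (blinfun_apply T v)"
    by (simp add: inner_eq_Re_cinner complex_nonneg_Reals_iff)
  have skew: "inner v (\<i> *\<^sub>C blinfun_apply T v) = 0" for v
    using pos[of v] by (simp add: complex_nonneg_Reals_iff cinner_eq_inner)
  have *: "inner (\<i> *\<^sub>C blinfun_apply T v) w = - inner v (\<i> *\<^sub>C blinfun_apply T w)" for v w
    using skew[of "v + w"] skew[of v] skew[of w]
    by (simp add: blinfun.bilinear_simps scaleC_add_right inner_add_left inner_add_right inner_commute)
  have "inner (blinfun_apply T v) w = inner v (blinfun_apply T w)" for v w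
    using *[of v "\<i> *\<^sub>C w"]
    by (simp add: inner_scaleC_i scaleC_scaleC bounded_opsD[OF bT] flip: scaleR_eq_scaleC[of "-1", simplified])
  then show "adj T = T" by (intro adj_unique bT)
next
  assume T: "T \<in> bounded_ops \<and> adj T = T \<and> (\<forall>v. 0 \<le> inner v (blinfun_apply T v))"
  then have "inner v (blinfun_apply T (\<i> *\<^sub>C v)) = 0" for v
    by (metis adj_inner add.inverse_inverse bounded_opsD inner_commute inner_scaleC_i
        linorder_not_less neg_0_less_iff_less neg_less_0_iff_less not_less_iff_gr_or_eq
        neg_equal_zero)
  with T show "op_pos T"
    by (auto simp: op_pos_def cinner_eq_inner complex_nonneg_Reals_iff bounded_opsD)
qed

lemma op_posI:
  assumes "T \<in> bounded_ops"
    and "\<And>v w. inner (blinfun_apply T v) w = inner v (blinfun_apply T w)"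
    and "\<And>v. 0 \<le> inner v (blinfun_apply T v)"
  shows "op_pos T"
  unfolding op_pos_iff using assms adj_unique[OF assms(1,2)] by blast

lemma op_pos_sym: "op_pos T \<Longrightarrow> inner (blinfun_apply T v) w = inner v (blinfun_apply T w)"
  by (metis adj_inner op_pos_iff)

lemma op_pos_ge0: "op_pos T \<Longrightarrow> 0 \<le> inner v (blinfun_apply T v)"
  by (simp add: op_pos_iff)

lemma op_pos_bounded: "op_pos T \<Longrightarrow> T \<in> bounded_ops"
  by (simp add: op_pos_iff)

lemma op_pos_adj: "op_pos T \<Longrightarrow> adj T = T"
  by (simp add: op_pos_iff)

lemma op_pos_adj_compose: "T \<in> bounded_ops \<Longrightarrow> op_pos (adj T o\<^sub>L T)"
  by (rule op_posI) (auto simp: adj_inner adj_inner_right)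

instance complex_hilbert_space \<subseteq> banach ..

text \<open>This is \<open>T^2 \<le> c T\<close>. Expanding the positive form at
  \<open>(T - c) v\<close> gives \<open>2 c T^2 \<le> T^3 + c^2 T\<close>, and
  \<open>T^3 \<le> c T^2\<close> holds by the norm bound.\<close>

lemma op_pos_norm_sq_le:
  assumes T: "op_pos T" and c: "norm T \<le> c"
  shows "(norm (blinfun_apply T v))\<^sup>2 \<le> c * inner v (blinfun_apply T v)"
proof (cases "c = 0")
  case False
  then have c0: "0 < c" using c norm_ge_zero[of T] by linarith
  let ?w = "blinfun_apply T v"
  have "inner ?w (blinfun_apply T ?w) \<le> c * (norm ?w)\<^sup>2"
  proof -
    have "inner ?w (blinfun_apply T ?w) \<le> norm ?w * (c * norm ?w)"
      by (rule order_trans[OF norm_cauchy_schwarz mult_left_mono])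
        (auto intro: order_trans[OF norm_blinfun mult_right_mono[OF c]])
    then show ?thesis by (simp add: power2_eq_square mult_ac)
  qed
  moreover have "0 \<le> inner (?w - c *\<^sub>R v) (blinfun_apply T (?w - c *\<^sub>R v))"
    by (rule op_pos_ge0[OF T])
  moreover have "inner v (blinfun_apply T ?w) = (norm ?w)\<^sup>2"
    by (simp add: op_pos_sym[OF T, symmetric] power2_norm_eq_inner)
  ultimately have "0 \<le> c * (c * inner v ?w - (norm ?w)\<^sup>2)"
    by (simp add: blinfun.bilinear_simps inner_diff_left inner_diff_right power2_norm_eq_inner
        algebra_simps)
  with c0 show ?thesis by (simp add: zero_le_mult_iff)
qed (use c in simp)

text \<open>Roots and inverses are obtained as norm limits or fixed points of real polynomial
  expressions, so norm closed unital real algebras are the natural ambient sets. Closure under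
  adjoints is not demanded, since commutants of arbitrary sets must qualify.\<close>

definition closed_algebra :: "('a::complex_hilbert_space \<Rightarrow>\<^sub>L 'a) set \<Rightarrow> bool" where
  "closed_algebra B \<longleftrightarrow> closed B \<and> B \<subseteq> bounded_ops \<and> id_blinfun \<in> B \<and>
     (\<forall>a\<in>B. \<forall>b\<in>B. a + b \<in> B \<and> a o\<^sub>L b \<in> B) \<and> (\<forall>r. \<forall>a\<in>B. r *\<^sub>R a \<in> B)"

lemma closed_algebraD:
  assumes "closed_algebra B"
  shows "closed B" "a \<in> B \<Longrightarrow> a \<in> bounded_ops" "id_blinfun \<in> B"
    "a \<in> B \<Longrightarrow> b \<in> B \<Longrightarrow> a + b \<in> B" "a \<in> B \<Longrightarrow> b \<in> B \<Longrightarrow> a o\<^sub>L b \<in> B"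
    "a \<in> B \<Longrightarrow> r *\<^sub>R a \<in> B" "a \<in> B \<Longrightarrow> b \<in> B \<Longrightarrow> a - b \<in> B" "0 \<in> B"
proof -
  show *: "closed B" "a \<in> B \<Longrightarrow> a \<in> bounded_ops" "id_blinfun \<in> B"
    "a \<in> B \<Longrightarrow> b \<in> B \<Longrightarrow> a + b \<in> B" "a \<in> B \<Longrightarrow> b \<in> B \<Longrightarrow> a o\<^sub>L b \<in> B"
    "a \<in> B \<Longrightarrow> r *\<^sub>R a \<in> B" for a b r
    using assms by (auto simp: closed_algebra_def)
  show "a \<in> B \<Longrightarrow> b \<in> B \<Longrightarrow> a - b \<in> B" using *(4)[OF _ *(6), of a b "-1"] by simp
  show "0 \<in> B" using *(6)[OF *(3), of 0] by simp
qed

lemma closed_algebra_sum: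
  "closed_algebra B \<Longrightarrow> (\<And>k. k \<in> K \<Longrightarrow> f k \<in> B) \<Longrightarrow> sum f K \<in> B"
  by (induction K rule: infinite_finite_induct) (auto simp: closed_algebraD)

text \<open>Three instances occur: the commutant of everything commuting with a given
  \<open>T\<close> (uniqueness of roots), of the empty set (all bounded operators), and of
  \<open>commutant M\<close> (the von Neumann algebra itself).\<close>

lemma closed_algebra_commutant:
  "closed_algebra {X \<in> bounded_ops. \<forall>R\<in>\<R>s. R o\<^sub>L X = X o\<^sub>L R}"
proof -
  have "closed {X. \<forall>R\<in>\<R>s. R o\<^sub>L X = X o\<^sub>L R}"
  proof -
    have "closed {X. R \<in> \<R>s \<longrightarrow> R o\<^sub>L X = X o\<^sub>L R}" for R
    proof (cases "R \<in> \<R>s")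
      case True
      have "closed {X. R o\<^sub>L X = X o\<^sub>L R}"
        by (intro closed_Collect_eq linear_continuous_on
            bounded_bilinear.bounded_linear_right[OF bounded_bilinear_blinfun_compose]
            bounded_bilinear.bounded_linear_left[OF bounded_bilinear_blinfun_compose])
      with True show ?thesis by simp
    qed simp
    then have "closed {X. \<forall>R. R \<in> \<R>s \<longrightarrow> R o\<^sub>L X = X o\<^sub>L R}" by (intro closed_Collect_all)
    then show ?thesis by (simp add: Ball_def)
  qed
  with closed_bounded_ops have cl: "closed {X \<in> bounded_ops. \<forall>R\<in>\<R>s. R o\<^sub>L X = X o\<^sub>L R}"
    unfolding Collect_conj_eq by (intro closed_Int) simp_all
  have comp: "R o\<^sub>L (a o\<^sub>L b) = (a o\<^sub>L b) o\<^sub>L R"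
    if "R o\<^sub>L a = a o\<^sub>L R" "R o\<^sub>L b = b o\<^sub>L R" for R a b :: "'a \<Rightarrow>\<^sub>L 'a"
    by (metis blinfun_compose_assoc that)
  show ?thesis
    unfolding closed_algebra_def
  proof (intro conjI cl ballI allI)
    show "{X \<in> bounded_ops. \<forall>R\<in>\<R>s. R o\<^sub>L X = X o\<^sub>L R} \<subseteq> bounded_ops" by (rule Collect_restrict)
    show "id_blinfun \<in> {X \<in> bounded_ops. \<forall>R\<in>\<R>s. R o\<^sub>L X = X o\<^sub>L R}" by simp
  next
    fix a b and r :: real
    assume a: "a \<in> {X \<in> bounded_ops. \<forall>R\<in>\<R>s. R o\<^sub>L X = X o\<^sub>L R}"
    then have ra: "R o\<^sub>L a = a o\<^sub>L R" if "R \<in> \<R>s" for R using that by blast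
    have a': "a \<in> bounded_ops" using a by blast
    show "r *\<^sub>R a \<in> {X \<in> bounded_ops. \<forall>R\<in>\<R>s. R o\<^sub>L X = X o\<^sub>L R}"
    proof (intro CollectI conjI ballI bounded_ops_scaleR a')
      show "R o\<^sub>L (r *\<^sub>R a) = (r *\<^sub>R a) o\<^sub>L R" if "R \<in> \<R>s" for R
        unfolding blinfun_compose_simps ra[OF that] ..
    qed
    assume b: "b \<in> {X \<in> bounded_ops. \<forall>R\<in>\<R>s. R o\<^sub>L X = X o\<^sub>L R}"
    then have rb: "R o\<^sub>L b = b o\<^sub>L R" if "R \<in> \<R>s" for R using that by blast
    have b': "b \<in> bounded_ops" using b by blast
    show "a + b \<in> {X \<in> bounded_ops. \<forall>R\<in>\<R>s. R o\<^sub>L X = X o\<^sub>L R}"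
    proof (intro CollectI conjI ballI bounded_ops_add a' b')
      show "R o\<^sub>L (a + b) = (a + b) o\<^sub>L R" if "R \<in> \<R>s" for R
        unfolding blinfun_compose_simps ra[OF that] rb[OF that] ..
    qed
    show "a o\<^sub>L b \<in> {X \<in> bounded_ops. \<forall>R\<in>\<R>s. R o\<^sub>L X = X o\<^sub>L R}"
      using bounded_ops_compose[OF a' b'] comp[OF ra rb] by (simp only: mem_Collect_eq) simp
  qed
qed

text \<open>
  The iteration \<open>S \<mapsto> (N + S\<^sup>2)/2\<close> solves \<open>(1 - S)\<^sup>2 = 1 - N\<close>; its increments are dominated by
  those of the scalar iteration for \<open>N = 1\<close>, which increases to a limit \<open>\<le> 1\<close>.
\<close>

lemma op_pos_sqrt_exists:
  assumes T: "op_pos T" and B: "closed_algebra B" and TB: "T \<in> B"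
  shows "\<exists>S\<in>B. op_pos S \<and> S o\<^sub>L S = T"
proof -
  \<comment> \<open>The added 1 keeps \<open>c\<close> positive when \<open>T = 0\<close>;
    \<open>norm T \<le> c\<close> makes \<open>N = 1 - T / c\<close> a contraction.\<close>
  define c where "c = norm T + 1"
  have c: "0 < c" "norm T \<le> c" by (auto simp: c_def add_nonneg_pos)
  define N where "N = id_blinfun - (1/c) *\<^sub>R T"
  note BD = closed_algebraD[OF B]
  have NB: "N \<in> B" unfolding N_def by (intro BD TB)
  have Nsym: "inner (blinfun_apply N v) w = inner v (blinfun_apply N w)" for v w
    by (simp add: N_def blinfun.bilinear_simps inner_diff_left inner_diff_right op_pos_sym[OF T])
  have normN: "norm N \<le> 1"
  proof (rule norm_blinfun_bound)
    fix v
    have "(norm (blinfun_apply N v))\<^sup>2 = (norm v)\<^sup>2 - 2 / c * inner v (blinfun_apply T v)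
       + 1 / c\<^sup>2 * (norm (blinfun_apply T v))\<^sup>2"
      by (simp add: N_def blinfun.bilinear_simps power2_norm_eq_inner inner_diff_left
          inner_diff_right inner_commute power2_eq_square[of c])
    moreover have "1 / c\<^sup>2 * (norm (blinfun_apply T v))\<^sup>2 \<le> 1 / c\<^sup>2 * (c * inner v (blinfun_apply T v))"
      by (intro mult_left_mono op_pos_norm_sq_le T c) simp
    moreover have "1 / c\<^sup>2 * (c * inner v (blinfun_apply T v)) = 1 / c * inner v (blinfun_apply T v)"
      using c by (simp add: power2_eq_square)
    moreover have "0 \<le> 1 / c * inner v (blinfun_apply T v)"
      using c op_pos_ge0[OF T] by simp
    moreover have "2 / c * inner v (blinfun_apply T v) = 2 * (1 / c * inner v (blinfun_apply T v))"
      by simp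
    ultimately have "(norm (blinfun_apply N v))\<^sup>2 \<le> (norm v)\<^sup>2" by linarith
    then show "norm (blinfun_apply N v) \<le> 1 * norm v" by simp
  qed simp
  define S where "S = rec_nat (0 :: 'a \<Rightarrow>\<^sub>L 'a) (\<lambda>_ X. (1/2) *\<^sub>R (N + (X o\<^sub>L X)))"
  define s where "s = rec_nat (0 :: real) (\<lambda>_ t. (1/2) * (1 + t * t))"
  have S0: "S 0 = 0" and SS: "S (Suc n) = (1/2) *\<^sub>R (N + (S n o\<^sub>L S n))" for n
    by (simp_all add: S_def)
  have s0: "s 0 = 0" and ss: "s (Suc n) = (1/2) * (1 + s n * s n)" for n
    by (simp_all add: s_def)
  have SB: "S n \<in> B" for n by (induction n) (simp_all add: S0 SS BD NB)
  have comm: "R o\<^sub>L S n = S n o\<^sub>L R" if "R o\<^sub>L N = N o\<^sub>L R" for n R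
    by (induction n) (simp_all add: S0 SS blinfun_compose_simps that, metis blinfun_compose_assoc)
  have SN: "S n o\<^sub>L N = N o\<^sub>L S n" for n using comm[of N n] by simp
  have SSc: "S m o\<^sub>L S n = S n o\<^sub>L S m" for m n by (rule comm) (rule SN)
  have Ssym: "inner (blinfun_apply (S n) v) w = inner v (blinfun_apply (S n) w)" for n v w
    by (induction n arbitrary: v w)
      (simp_all add: S0 SS blinfun.bilinear_simps inner_add_left inner_add_right Nsym)
  have s01: "0 \<le> s n \<and> s n \<le> 1" for n
  proof (induction n)
    case (Suc n)
    then have "s n * s n \<le> 1" by (simp add: mult_le_one)
    then show ?case by (simp add: ss)
  qed (simp add: s0)
  have normS: "norm (S n) \<le> s n" for n
  proof (induction n)
    case (Suc n)
    have "norm (S n o\<^sub>L S n) \<le> s n * s n"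
      by (rule order_trans[OF norm_blinfun_compose mult_mono]) (use Suc s01 in auto)
    then have "norm (N + (S n o\<^sub>L S n)) \<le> 1 + s n * s n"
      using normN norm_triangle_ineq[of N "S n o\<^sub>L S n"] by linarith
    then show ?case by (simp add: SS ss)
  qed (simp add: s0 S0)
  have incr: "norm (S (Suc n) - S n) \<le> s (Suc n) - s n" for n
  proof (induction n)
    case 0 then show ?case using normN by (simp add: S0 SS s0 ss)
  next
    case (Suc n)
    have "S (Suc (Suc n)) - S (Suc n)
        = (1/2) *\<^sub>R ((N + (S (Suc n) o\<^sub>L S (Suc n))) - (N + (S n o\<^sub>L S n)))"
      by (subst (1) SS, subst (3) SS) (simp only: scaleR_diff_right)
    \<comment> \<open>The iterates commute, so the difference of squares factorises as for
      scalars.\<close>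
    also have "(N + (S (Suc n) o\<^sub>L S (Suc n))) - (N + (S n o\<^sub>L S n))
        = (S (Suc n) + S n) o\<^sub>L (S (Suc n) - S n)"
      using SSc[of n "Suc n"] by (simp add: blinfun_compose_simps)
    finally have eq: "S (Suc (Suc n)) - S (Suc n)
        = (1/2) *\<^sub>R ((S (Suc n) + S n) o\<^sub>L (S (Suc n) - S n))" .
    have "norm ((S (Suc n) + S n) o\<^sub>L (S (Suc n) - S n))
        \<le> (s (Suc n) + s n) * (s (Suc n) - s n)"
      by (rule order_trans[OF norm_blinfun_compose mult_mono])
        (use normS Suc s01[of n] s01[of "Suc n"] in
          \<open>auto intro: order_trans[OF norm_triangle_ineq add_mono]\<close>)
    then have "norm (S (Suc (Suc n)) - S (Suc n)) \<le> (1/2) * ((s (Suc n) + s n) * (s (Suc n) - s n))"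
      by (simp add: eq)
    also have "\<dots> = s (Suc (Suc n)) - s (Suc n)"
      by (subst (3) ss, subst (4) ss) (simp add: algebra_simps)
    finally show ?case .
  qed
  have "s n \<le> s (Suc n)" for n using incr[of n] norm_ge_zero[of "S (Suc n) - S n"] by linarith
  then have "incseq s" by (rule incseq_SucI)
  then have "convergent s"
    by (rule Bseq_monoseq_convergent[OF _ incseq_imp_monoseq, rotated])
      (use s01 in \<open>auto intro!: BseqI'[of _ 1]\<close>)
  then obtain t where t: "s \<longlonglongrightarrow> t" by (auto simp: convergent_def)
  have "summable (\<lambda>n. S (Suc n) - S n)"
    by (rule summable_comparison_test'[OF telescope_summable[OF t], of 0]) (rule incr)
  then have "convergent (\<lambda>n. \<Sum>k<n. S (Suc k) - S k)"
    by (simp add: summable_iff_convergent)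
  then have "convergent S" by (simp add: sum_lessThan_telescope S0)
  then obtain L where L: "S \<longlonglongrightarrow> L" by (auto simp: convergent_def)
  have LB: "L \<in> B" using BD(1) SB L by (rule closed_sequentially)
  have L_eq: "L = (1/2) *\<^sub>R (N + (L o\<^sub>L L))"
  proof (rule LIMSEQ_unique)
    show "(\<lambda>n. S (Suc n)) \<longlonglongrightarrow> L" using L by (rule LIMSEQ_Suc)
    show "(\<lambda>n. S (Suc n)) \<longlonglongrightarrow> (1/2) *\<^sub>R (N + (L o\<^sub>L L))"
      unfolding SS
      by (intro tendsto_intros L bounded_bilinear.tendsto[OF bounded_bilinear_blinfun_compose])
  qed
  have normL: "norm L \<le> 1"
    by (rule LIMSEQ_le_const2[OF tendsto_norm[OF L]])
      (use normS s01 order_trans in blast)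
  have Lsym: "inner (blinfun_apply L v) w = inner v (blinfun_apply L w)" for v w
  proof (rule LIMSEQ_unique)
    have Lv: "(\<lambda>n. blinfun_apply (S n) v) \<longlonglongrightarrow> blinfun_apply L v" for v
      by (intro tendsto_intros L)
    show "(\<lambda>n. inner (blinfun_apply (S n) v) w) \<longlonglongrightarrow> inner (blinfun_apply L v) w"
      by (intro tendsto_intros Lv)
    show "(\<lambda>n. inner (blinfun_apply (S n) v) w) \<longlonglongrightarrow> inner v (blinfun_apply L w)"
      unfolding Ssym by (intro tendsto_intros Lv)
  qed
  \<comment> \<open>The limit satisfies \<open>(1 - L)^2 = 1 - N = T / c\<close>, and
    \<open>1 - L\<close> is positive because \<open>norm L \<le> 1\<close>.\<close>
  define Q where "Q = sqrt c *\<^sub>R (id_blinfun - L)"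
  have QB: "Q \<in> B" unfolding Q_def by (intro BD LB)
  have "op_pos Q"
  proof (rule op_posI)
    show "Q \<in> bounded_ops" by (rule BD(2)[OF QB])
    show "inner (blinfun_apply Q v) w = inner v (blinfun_apply Q w)" for v w
      by (simp add: Q_def blinfun.bilinear_simps inner_diff_left inner_diff_right Lsym)
    show "0 \<le> inner v (blinfun_apply Q v)" for v
    proof -
      have "inner v (blinfun_apply L v) \<le> norm v * (1 * norm v)"
        by (rule order_trans[OF norm_cauchy_schwarz
              mult_left_mono[OF order_trans[OF norm_blinfun mult_right_mono[OF normL]]]]) simp_all
      then show ?thesis using c
        by (simp add: Q_def blinfun.bilinear_simps inner_diff_right power2_norm_eq_inner[symmetric]
            power2_eq_square)
    qed
  qed
  moreover have "Q o\<^sub>L Q = T"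
  proof -
    have LL: "L o\<^sub>L L = 2 *\<^sub>R L - N" by (subst (3) L_eq) simp
    have "Q o\<^sub>L Q = c *\<^sub>R (id_blinfun - 2 *\<^sub>R L + (L o\<^sub>L L))"
      using c by (simp add: Q_def blinfun_compose_simps algebra_simps scaleR_2)
    also have "\<dots> = c *\<^sub>R (id_blinfun - N)" by (simp add: LL)
    also have "\<dots> = T" using c by (simp add: N_def)
    finally show ?thesis .
  qed
  ultimately show ?thesis using QB by blast
qed

section \<open>Uniqueness of positive square roots\<close>

lemma op_pos_sandwich:
  "op_pos P \<Longrightarrow> a \<in> bounded_ops \<Longrightarrow> op_pos (adj a o\<^sub>L P o\<^sub>L a)"
  by (rule op_posI)
    (simp_all add: adj_inner adj_inner_right op_pos_sym op_pos_bounded op_pos_ge0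
      bounded_ops_compose adj_bounded_ops)

lemma selfadjoint_cube_eq_0:
  assumes D: "D \<in> bounded_ops" "adj D = D" and "D o\<^sub>L (D o\<^sub>L D) = 0"
  shows "D = 0"
proof -
  have 1: "blinfun_apply D (blinfun_apply D (blinfun_apply D v)) = 0" for v
    using arg_cong[OF assms(3), of "\<lambda>f. blinfun_apply f v"] by simp
  have "inner (blinfun_apply D v) w = inner v (blinfun_apply D w)" for v w
    using adj_inner[OF D(1), of v w] D(2) by simp
  then have "inner (blinfun_apply D (blinfun_apply D v)) (blinfun_apply D (blinfun_apply D v)) = 0" for v
    using 1 by simp
  then have 2: "blinfun_apply D (blinfun_apply D v) = 0" for v by simp
  have "inner (blinfun_apply D v) (blinfun_apply D v) = 0" for v
    using adj_inner[OF D(1), of v "blinfun_apply D v"] D(2) 2 by simp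
  then show ?thesis by (intro blinfun_eqI) simp
qed

lemma op_pos_eq_0:
  assumes "op_pos P" "\<And>v. inner v (blinfun_apply P v) = 0" shows "P = 0"
proof (rule blinfun_eqI)
  show "blinfun_apply P v = blinfun_apply 0 v" for v
    using op_pos_norm_sq_le[OF assms(1) order_refl, of v] assms(2)[of v] by simp
qed

text \<open>For commuting roots put \<open>D = P - R\<close>: then \<open>(P + R) D = 0\<close>, so
  \<open>D P D\<close> and \<open>D R D\<close> are positive with sum zero, both vanish, and
  \<open>D^3 = 0\<close>. Arbitrary roots are compared with one root \<open>P\<close> that commutes
  with everything commuting with \<open>T\<close>, in particular with both of them.\<close>

lemma op_pos_sqrt_unique:
  assumes S: "op_pos S" "S o\<^sub>L S = T" and R: "op_pos R" "R o\<^sub>L R = T"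
  shows "S = R"
proof -
  have unique: "P = R" if P: "op_pos P" "P o\<^sub>L P = T" and R: "op_pos R" "R o\<^sub>L R = T"
    and comm: "P o\<^sub>L R = R o\<^sub>L P" for P R
  proof -
    let ?D = "P - R"
    have bP: "P \<in> bounded_ops" "R \<in> bounded_ops" using P R op_pos_bounded by blast+
    then have D: "?D \<in> bounded_ops" by auto
    have aD: "adj ?D = ?D" using P R by (simp add: adj_diff bP op_pos_adj)
    have 0: "(P + R) o\<^sub>L ?D = 0" using P R comm by (simp add: blinfun_compose_simps)
    have P1: "op_pos (adj ?D o\<^sub>L P o\<^sub>L ?D)" "op_pos (adj ?D o\<^sub>L R o\<^sub>L ?D)"
      by (intro op_pos_sandwich P R D)+
    have "(adj ?D o\<^sub>L P o\<^sub>L ?D) + (adj ?D o\<^sub>L R o\<^sub>L ?D) = ?D o\<^sub>L ((P + R) o\<^sub>L ?D)"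
      unfolding aD blinfun_compose_assoc blinfun_compose_simps(1)[of P R ?D]
        blinfun_compose_simps(2)[of ?D "P o\<^sub>L ?D"] ..
    then have sum0: "(adj ?D o\<^sub>L P o\<^sub>L ?D) + (adj ?D o\<^sub>L R o\<^sub>L ?D) = 0" unfolding 0 by simp
    have "inner v (blinfun_apply (adj ?D o\<^sub>L P o\<^sub>L ?D) v) = 0" for v
    proof -
      have "inner v (blinfun_apply ((adj ?D o\<^sub>L P o\<^sub>L ?D) + (adj ?D o\<^sub>L R o\<^sub>L ?D)) v) = 0"
        unfolding sum0 by simp
      then show ?thesis
        unfolding blinfun.add_left inner_add_right
        using op_pos_ge0[OF P1(1), of v] op_pos_ge0[OF P1(2), of v] by linarith
    qed
    then have P0: "adj ?D o\<^sub>L P o\<^sub>L ?D = 0" by (rule op_pos_eq_0[OF P1(1)])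
    with sum0 have "adj ?D o\<^sub>L R o\<^sub>L ?D = 0" by simp
    with P0 have "?D o\<^sub>L (?D o\<^sub>L ?D) = 0"
      unfolding aD blinfun_compose_assoc
      unfolding blinfun_compose_simps(3)[of P R ?D] blinfun_compose_simps(4)[of ?D "P o\<^sub>L ?D"]
      by simp
    then have "?D = 0" by (rule selfadjoint_cube_eq_0[OF D aD])
    then show ?thesis by simp
  qed
  let ?B = "{X \<in> bounded_ops. \<forall>R\<in>{R. R o\<^sub>L T = T o\<^sub>L R}. R o\<^sub>L X = X o\<^sub>L R}"
  have T: "op_pos T" using op_pos_adj_compose[OF op_pos_bounded[OF S(1)]] S by (simp add: op_pos_adj)
  then have TB: "T \<in> ?B" using op_pos_bounded by blast
  obtain P where P: "P \<in> ?B" "op_pos P" "P o\<^sub>L P = T"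
    by (rule bexE[OF op_pos_sqrt_exists[OF T closed_algebra_commutant TB]]) (elim conjE)
  have comm: "P o\<^sub>L X = X o\<^sub>L P" if "X o\<^sub>L X = T" for X
  proof -
    have "X o\<^sub>L T = T o\<^sub>L X" unfolding that[symmetric] by (rule blinfun_compose_assoc[symmetric])
    then have "X o\<^sub>L P = P o\<^sub>L X" using P(1) by blast
    then show ?thesis ..
  qed
  show ?thesis using unique[OF P(2,3) S comm[OF S(2)]] unique[OF P(2,3) R comm[OF R(2)]] by simp
qed

text \<open>\<open>op_sqrt\<close> describes a root among all operators; uniqueness identifies it
  with the root constructed inside \<open>B\<close>, which is how membership in \<open>B\<close> is
  obtained.\<close>

lemma op_sqrt_works:
  assumes T: "op_pos T" and B: "closed_algebra B" "T \<in> B"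
  shows "op_sqrt T \<in> B" "op_pos (op_sqrt T)" "op_sqrt T o\<^sub>L op_sqrt T = T"
proof -
  obtain S where S: "S \<in> B" "op_pos S" "S o\<^sub>L S = T"
    using op_pos_sqrt_exists[OF T B] by blast
  have "op_sqrt T = S"
    unfolding op_sqrt_def using S op_pos_sqrt_unique by (intro the_equality) blast+
  with S show "op_sqrt T \<in> B" "op_pos (op_sqrt T)" "op_sqrt T o\<^sub>L op_sqrt T = T" by auto
qed

text \<open>A fixed point of \<open>X = 1 + R X\<close> is a right inverse and one of
  \<open>X = 1 + X R\<close> a left inverse. Both maps contract the complete set \<open>B\<close>,
  and associativity identifies the two inverses.\<close>

lemma inverse_id_minus:
  assumes B: "closed_algebra B" and R: "R \<in> B" "norm R < 1"
  shows "\<exists>X\<in>B. X o\<^sub>L (id_blinfun - R) = id_blinfun \<and> (id_blinfun - R) o\<^sub>L X = id_blinfun"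
proof -
  note BD = closed_algebraD[OF B]
  have cB: "complete B" using BD(1) by (simp add: complete_eq_closed)
  have "\<exists>!X. X \<in> B \<and> id_blinfun + (R o\<^sub>L X) = X"
  proof (rule Banach_fix[OF cB _ norm_ge_zero R(2)])
    show "B \<noteq> {}" using R by blast
    show "(\<lambda>X. id_blinfun + (R o\<^sub>L X)) ` B \<subseteq> B" using BD R by auto
    show "dist (id_blinfun + (R o\<^sub>L X)) (id_blinfun + (R o\<^sub>L Y)) \<le> norm R * dist X Y" for X Y
      using norm_blinfun_compose[of R "X - Y"] by (simp add: dist_norm blinfun_compose_simps)
  qed
  then obtain X where X: "X \<in> B" "id_blinfun + (R o\<^sub>L X) = X" by blast
  have "\<exists>!X. X \<in> B \<and> id_blinfun + (X o\<^sub>L R) = X"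
  proof (rule Banach_fix[OF cB _ norm_ge_zero R(2)])
    show "B \<noteq> {}" using R by blast
    show "(\<lambda>X. id_blinfun + (X o\<^sub>L R)) ` B \<subseteq> B" using BD R by auto
    show "dist (id_blinfun + (X o\<^sub>L R)) (id_blinfun + (Y o\<^sub>L R)) \<le> norm R * dist X Y" for X Y
      using norm_blinfun_compose[of "X - Y" R]
      by (simp add: dist_norm blinfun_compose_simps mult.commute)
  qed
  then obtain Y where Y: "Y \<in> B" "id_blinfun + (Y o\<^sub>L R) = Y" by blast
  have 1: "(id_blinfun - R) o\<^sub>L X = id_blinfun"
    using X(2) by (simp add: blinfun_compose_simps diff_eq_eq)
  have 2: "Y o\<^sub>L (id_blinfun - R) = id_blinfun"
    using Y(2) by (simp add: blinfun_compose_simps diff_eq_eq)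
  have "Y = Y o\<^sub>L ((id_blinfun - R) o\<^sub>L X)" unfolding 1 by simp
  also have "\<dots> = X" unfolding blinfun_compose_assoc[symmetric] 2 by simp
  finally show ?thesis using 1 2 X(1) by blast
qed

text \<open>Divided by \<open>c = norm p + e\<close>, the operator \<open>p + e\<close> becomes
  \<open>1 - R\<close> with \<open>c R = norm p - p\<close>. By \<open>op_pos_norm_sq_le\<close> the
  latter has norm at most \<open>norm p\<close>, whence
  \<open>norm R \<le> norm p / c < 1\<close>.\<close>

lemma resolvent_exists:
  assumes p: "op_pos p" and B: "closed_algebra B" "p \<in> B" and e: "0 < (e::real)"
  shows "\<exists>q\<in>B. op_pos q \<and> q o\<^sub>L (p + e *\<^sub>R id_blinfun) = id_blinfun \<and>
           (p + e *\<^sub>R id_blinfun) o\<^sub>L q = id_blinfun"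
proof -
  note BD = closed_algebraD[OF B(1)]
  define c where "c = norm p + e"
  have c: "0 < c" using e by (simp add: c_def add_nonneg_pos)
  define R where "R = id_blinfun - (1/c) *\<^sub>R (p + e *\<^sub>R id_blinfun)"
  have RB: "R \<in> B" unfolding R_def by (intro BD B)
  have "norm R \<le> norm p / c"
  proof (rule norm_blinfun_bound)
    fix v
    have "c *\<^sub>R blinfun_apply R v = norm p *\<^sub>R v - blinfun_apply p v"
      using c by (simp add: R_def blinfun.bilinear_simps scaleR_diff_right)
        (simp add: c_def algebra_simps)
    then have "(norm (c *\<^sub>R blinfun_apply R v))\<^sup>2
        = (norm p * norm v)\<^sup>2 - 2 * norm p * inner v (blinfun_apply p v) + (norm (blinfun_apply p v))\<^sup>2"
      by (simp add: power2_norm_eq_inner inner_diff_left inner_diff_right inner_commute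
          power_mult_distrib power2_eq_square[of "norm p"])
    also have "\<dots> \<le> (norm p * norm v)\<^sup>2"
    proof -
      have "0 \<le> norm p * inner v (blinfun_apply p v)" using op_pos_ge0[OF p] by simp
      then show ?thesis using op_pos_norm_sq_le[OF p order_refl, of v] by linarith
    qed
    finally have "norm (c *\<^sub>R blinfun_apply R v) \<le> norm p * norm v"
      by (rule power2_le_imp_le) simp
    then show "norm (blinfun_apply R v) \<le> norm p / c * norm v"
      using c by (simp add: field_simps)
  qed (use c in simp)
  also have "\<dots> < 1" using c e by (simp add: c_def)
  finally obtain X where X: "X \<in> B" "X o\<^sub>L (id_blinfun - R) = id_blinfun"
    "(id_blinfun - R) o\<^sub>L X = id_blinfun"
    using inverse_id_minus[OF B(1) RB] by blast
  have idR: "id_blinfun - R = (1/c) *\<^sub>R (p + e *\<^sub>R id_blinfun)" by (simp add: R_def)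
  define q where "q = (1/c) *\<^sub>R X"
  have q: "q o\<^sub>L (p + e *\<^sub>R id_blinfun) = id_blinfun" "(p + e *\<^sub>R id_blinfun) o\<^sub>L q = id_blinfun"
    using X(2,3) unfolding idR q_def blinfun_compose_simps(7,8) by simp_all
  have qB: "q \<in> B" unfolding q_def by (intro BD(6) X)
  have u: "blinfun_apply p (blinfun_apply q v) + e *\<^sub>R blinfun_apply q v = v" for v
    using arg_cong[OF q(2), of "\<lambda>f. blinfun_apply f v"] by (simp add: blinfun.bilinear_simps)
  have "op_pos q"
  proof (rule op_posI)
    show "q \<in> bounded_ops" by (rule BD(2)[OF qB])
    show "inner (blinfun_apply q v) w = inner v (blinfun_apply q w)" for v w
    proof -
      have "inner (blinfun_apply q v) w
          = inner (blinfun_apply q v) (blinfun_apply p (blinfun_apply q w) + e *\<^sub>R blinfun_apply q w)"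
        by (simp only: u)
      also have "\<dots> = inner (blinfun_apply p (blinfun_apply q v) + e *\<^sub>R blinfun_apply q v)
          (blinfun_apply q w)"
        by (simp add: inner_add_left inner_add_right op_pos_sym[OF p])
      finally show ?thesis by (simp only: u)
    qed
    show "0 \<le> inner v (blinfun_apply q v)" for v
    proof -
      have "inner v (blinfun_apply q v)
          = inner (blinfun_apply p (blinfun_apply q v) + e *\<^sub>R blinfun_apply q v) (blinfun_apply q v)"
        by (simp only: u)
      also have "\<dots> \<ge> 0"
        using e op_pos_ge0[OF p, of "blinfun_apply q v"]
        by (simp add: inner_add_left op_pos_sym[OF p])
      finally show ?thesis .
    qed
  qed
  with q qB show ?thesis by blast
qed

section \<open>Trace inequalities\<close>

text \<open>The family is read as a column, and the condition is
  \<open>\<Sum>k adj (U k) U k \<le> 1\<close>. A one-point index set gives ordinary contractions,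
  so one duality serves both the coefficient norm and the \<open>L1\<close> norm.\<close>

definition contractive :: "'k set \<Rightarrow> ('k \<Rightarrow> ('a::real_normed_vector \<Rightarrow>\<^sub>L 'a)) \<Rightarrow> bool" where
  "contractive K U \<longleftrightarrow> (\<forall>v. (\<Sum>k\<in>K. (norm (blinfun_apply (U k) v))\<^sup>2) \<le> (norm v)\<^sup>2)"

lemma contractive_singleton:
  assumes "norm U \<le> 1" shows "contractive {k} (\<lambda>_. U)"
  unfolding contractive_def
proof
  fix v
  have "norm (blinfun_apply U v) \<le> 1 * norm v"
    by (rule order_trans[OF norm_blinfun mult_right_mono[OF assms]]) simp
  then show "(\<Sum>k\<in>{k}. (norm (blinfun_apply U v))\<^sup>2) \<le> (norm v)\<^sup>2" by (simp add: power_mono)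
qed

text \<open>With \<open>S = adj y y\<close>, the inequality \<open>4 c S \<le> (S + c)^2\<close> is
  applied twice: at \<open>q v\<close> for the norm of the cut-off, and at \<open>S q v\<close> for
  the remainder, which equals \<open>y S q\<close>.\<close>

lemma cutoff_bounds:
  fixes y q :: "'a::complex_hilbert_space \<Rightarrow>\<^sub>L 'a" and c :: real
  assumes y: "y \<in> bounded_ops" and c: "0 < c"
    and q: "((adj y o\<^sub>L y) + c *\<^sub>R id_blinfun) o\<^sub>L q = id_blinfun"
  shows "norm (c *\<^sub>R (y o\<^sub>L q)) \<le> sqrt c / 2"
    and "(norm (blinfun_apply (y - c *\<^sub>R (y o\<^sub>L q)) v))\<^sup>2
           \<le> (norm (blinfun_apply (adj y o\<^sub>L y) v))\<^sup>2 / (4 * c)"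
proof -
  define S where "S = adj y o\<^sub>L y"
  have pos: "op_pos S" unfolding S_def by (rule op_pos_adj_compose[OF y])
  have yy: "(norm (blinfun_apply y v))\<^sup>2 = inner v (blinfun_apply S v)" for v
    by (simp add: S_def adj_inner_right[OF y] power2_norm_eq_inner)
  have split: "v = blinfun_apply S (blinfun_apply q v) + c *\<^sub>R blinfun_apply q v" for v
    using arg_cong[OF q, of "\<lambda>f. blinfun_apply f v"] by (simp add: S_def blinfun.bilinear_simps)
  have key: "4 * c * (norm (blinfun_apply y u))\<^sup>2 \<le> (norm (blinfun_apply S u + c *\<^sub>R u))\<^sup>2" for u
  proof -
    have "0 \<le> (norm (blinfun_apply S u - c *\<^sub>R u))\<^sup>2" by simp
    also have "\<dots> = (norm (blinfun_apply S u + c *\<^sub>R u))\<^sup>2 - 4 * c * inner u (blinfun_apply S u)"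
      unfolding power2_norm_eq_inner
      by (simp add: inner_add_left inner_add_right inner_diff_left inner_diff_right inner_commute)
    finally show ?thesis by (simp add: yy)
  qed
  show "norm (c *\<^sub>R (y o\<^sub>L q)) \<le> sqrt c / 2"
  proof (rule norm_blinfun_bound)
    fix v
    have "(norm (blinfun_apply (c *\<^sub>R (y o\<^sub>L q)) v))\<^sup>2
        = c / 4 * (4 * c * (norm (blinfun_apply y (blinfun_apply q v)))\<^sup>2)"
      using c by (simp add: blinfun.bilinear_simps power_mult_distrib power2_eq_square)
    also have "\<dots> \<le> c / 4 * (norm v)\<^sup>2"
      using key[of "blinfun_apply q v"] c by (subst (2) split) (intro mult_left_mono, simp_all)
    also have "\<dots> = (sqrt c / 2 * norm v)\<^sup>2" using c by (simp add: power_mult_distrib power_divide)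
    finally show "norm (blinfun_apply (c *\<^sub>R (y o\<^sub>L q)) v) \<le> sqrt c / 2 * norm v"
      by (rule power2_le_imp_le) (use c in simp)
  qed (use c in simp)
  have "blinfun_apply (y - c *\<^sub>R (y o\<^sub>L q)) v = blinfun_apply y (v - c *\<^sub>R blinfun_apply q v)"
    by (simp add: blinfun.bilinear_simps)
  also have "v - c *\<^sub>R blinfun_apply q v = blinfun_apply S (blinfun_apply q v)"
    by (subst (1) split) simp
  finally have "4 * c * (norm (blinfun_apply (y - c *\<^sub>R (y o\<^sub>L q)) v))\<^sup>2
      \<le> (norm (blinfun_apply S (blinfun_apply S (blinfun_apply q v)) + c *\<^sub>R blinfun_apply S (blinfun_apply q v)))\<^sup>2"
    using key[of "blinfun_apply S (blinfun_apply q v)"] by simp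
  also have "blinfun_apply S (blinfun_apply S (blinfun_apply q v)) + c *\<^sub>R blinfun_apply S (blinfun_apply q v)
      = blinfun_apply S (blinfun_apply S (blinfun_apply q v) + c *\<^sub>R blinfun_apply q v)"
    by (simp add: blinfun.bilinear_simps)
  also have "\<dots> = blinfun_apply S v" by (simp only: split[symmetric])
  finally show "(norm (blinfun_apply (y - c *\<^sub>R (y o\<^sub>L q)) v))\<^sup>2
      \<le> (norm (blinfun_apply (adj y o\<^sub>L y) v))\<^sup>2 / (4 * c)"
    using c unfolding S_def by (simp add: field_simps)
qed

text \<open>The functional \<open>\<rho>\<close> plays the role of the real part of a positive trace.\<close>

locale tracial_algebra =
  fixes A :: "('a::complex_hilbert_space \<Rightarrow>\<^sub>L 'a) set" and \<rho> :: "('a \<Rightarrow>\<^sub>L 'a) \<Rightarrow> real"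
  assumes closed_algebra: "closed_algebra A"
    and adj_mem: "a \<in> A \<Longrightarrow> adj a \<in> A"
    and rho_add: "a \<in> A \<Longrightarrow> b \<in> A \<Longrightarrow> \<rho> (a + b) = \<rho> a + \<rho> b"
    and rho_scaleR: "a \<in> A \<Longrightarrow> \<rho> (r *\<^sub>R a) = r * \<rho> a"
    and rho_comm: "a \<in> A \<Longrightarrow> b \<in> A \<Longrightarrow> \<rho> (a o\<^sub>L b) = \<rho> (b o\<^sub>L a)"
    and rho_adj: "a \<in> A \<Longrightarrow> \<rho> (adj a) = \<rho> a"
    and rho_square: "a \<in> A \<Longrightarrow> 0 \<le> \<rho> (adj a o\<^sub>L a)"
begin

lemmas mem = closed_algebraD(3-8)[OF closed_algebra] adj_mem closed_algebra_sum[OF closed_algebra]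

lemma bounded [simp]: "a \<in> A \<Longrightarrow> a \<in> bounded_ops"
  by (rule closed_algebraD(2)[OF closed_algebra])

lemma rho_diff: "a \<in> A \<Longrightarrow> b \<in> A \<Longrightarrow> \<rho> (a - b) = \<rho> a - \<rho> b"
  using rho_add[of a "-1 *\<^sub>R b"] rho_scaleR[of b "-1"] mem(4)[of b "-1"] by simp

lemma rho_zero [simp]: "\<rho> 0 = 0"
  using rho_scaleR[OF mem(1), of 0] by simp

lemma rho_sum: "(\<And>k. k \<in> K \<Longrightarrow> f k \<in> A) \<Longrightarrow> \<rho> (sum f K) = (\<Sum>k\<in>K. \<rho> (f k))"
  by (induction K rule: infinite_finite_induct) (auto simp: rho_add mem)

text \<open>The locale assumes positivity only on elements \<open>adj a a\<close>; a positive
  element has this form because its square root lies in the algebra.\<close>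

lemma rho_op_pos:
  assumes "op_pos p" "p \<in> A" shows "0 \<le> \<rho> p"
proof -
  note s = op_sqrt_works[OF assms(1) closed_algebra assms(2)]
  show ?thesis using rho_square[OF s(1)] op_pos_adj[OF s(2)] s(3) by simp
qed

lemma rho_sum_square_mono:
  assumes a: "\<And>k. k \<in> K \<Longrightarrow> a k \<in> A" and b: "b \<in> A"
    and le: "\<And>v. (\<Sum>k\<in>K. (norm (blinfun_apply (a k) v))\<^sup>2) \<le> (norm (blinfun_apply b v))\<^sup>2"
  shows "(\<Sum>k\<in>K. \<rho> (adj (a k) o\<^sub>L a k)) \<le> \<rho> (adj b o\<^sub>L b)"
proof -
  let ?D = "(adj b o\<^sub>L b) - (\<Sum>k\<in>K. adj (a k) o\<^sub>L a k)"
  have DA: "?D \<in> A" by (intro mem a b)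
  have sq: "inner v (blinfun_apply (adj a o\<^sub>L a) w) = inner (blinfun_apply a v) (blinfun_apply a w)"
    "inner (blinfun_apply (adj a o\<^sub>L a) v) w = inner (blinfun_apply a v) (blinfun_apply a w)"
    if "a \<in> A" for a v w
    using that by (simp_all add: adj_inner adj_inner_right)
  note expand = blinfun.diff_left blinfun.sum_left inner_diff_left inner_diff_right
    inner_sum_left inner_sum_right
  have "op_pos ?D"
  proof (rule op_posI)
    show "?D \<in> bounded_ops" using DA by simp
    show "inner (blinfun_apply ?D v) w = inner v (blinfun_apply ?D w)" for v w
      by (simp only: expand sq a b cong: sum.cong)
    show "0 \<le> inner v (blinfun_apply ?D v)" for v
      using le[of v] by (simp only: expand sq a b power2_norm_eq_inner diff_ge_0_iff_ge cong: sum.cong)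
  qed
  then have "0 \<le> \<rho> ?D" using DA by (rule rho_op_pos)
  then show ?thesis by (simp add: rho_diff rho_sum a b mem)
qed

lemma rho_square_mono:
  assumes "a \<in> A" "b \<in> A"
    and "\<And>v. (norm (blinfun_apply a v))\<^sup>2 \<le> (norm (blinfun_apply b v))\<^sup>2"
  shows "\<rho> (adj a o\<^sub>L a) \<le> \<rho> (adj b o\<^sub>L b)"
  using rho_sum_square_mono[of "{()}" "\<lambda>_. a" b] assms by simp

text \<open>Expansion of the square of \<open>a - b\<close>; this form serves in place of a
  Cauchy--Schwarz inequality for \<open>\<rho>\<close>.\<close>

lemma rho_pairing_le_squares:
  assumes a: "a \<in> A" and b: "b \<in> A"
  shows "2 * \<rho> (adj b o\<^sub>L a) \<le> \<rho> (adj a o\<^sub>L a) + \<rho> (adj b o\<^sub>L b)"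
proof -
  have "\<rho> (adj a o\<^sub>L b) = \<rho> (adj b o\<^sub>L a)"
    using rho_adj[of "adj b o\<^sub>L a"] a b by (simp add: adj_compose mem)
  moreover have "0 \<le> \<rho> (adj (a - b) o\<^sub>L (a - b))" by (rule rho_square) (intro mem a b)
  moreover have "adj (a - b) o\<^sub>L (a - b) = ((adj a o\<^sub>L a) - (adj b o\<^sub>L a)) - ((adj a o\<^sub>L b) - (adj b o\<^sub>L b))"
    using a b by (simp only: adj_diff bounded blinfun_compose_simps)
  moreover have "\<rho> (((adj a o\<^sub>L a) - (adj b o\<^sub>L a)) - ((adj a o\<^sub>L b) - (adj b o\<^sub>L b)))
      = \<rho> (adj a o\<^sub>L a) - \<rho> (adj b o\<^sub>L a) - (\<rho> (adj a o\<^sub>L b) - \<rho> (adj b o\<^sub>L b))"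
    by (simp only: rho_diff mem a b)
  ultimately show ?thesis by simp
qed

lemma resolvent_identities:
  assumes "(p + e *\<^sub>R id_blinfun) o\<^sub>L q = id_blinfun" "q o\<^sub>L (p + e *\<^sub>R id_blinfun) = id_blinfun"
  shows "p o\<^sub>L q = id_blinfun - e *\<^sub>R q" "q o\<^sub>L p = id_blinfun - e *\<^sub>R q"
  using assms by (simp_all add: blinfun_compose_simps eq_diff_eq)

text \<open>
  With \<open>b = p + e\<close> and \<open>q\<close> its inverse, positivity of \<open>\<Sum>k |X\<^sub>k q\<^sup>1\<^sup>/\<^sup>2 - U\<^sub>k b\<^sup>1\<^sup>/\<^sup>2|\<^sup>2\<close> gives
  \<open>2 \<Sum>k \<rho> (U\<^sub>k\<^sup>* X\<^sub>k) \<le> \<rho> (\<Sum>k X\<^sub>k\<^sup>* X\<^sub>k q) + \<rho> b \<le> 2 \<rho> b\<close>.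
\<close>

lemma pairing_le:
  assumes K: "finite K"
    and X: "\<And>k. k \<in> K \<Longrightarrow> X k \<in> A" and U: "\<And>k. k \<in> K \<Longrightarrow> U k \<in> A"
    and p: "p \<in> A" "op_pos p" and contr: "contractive K U"
    and le: "\<And>e q. 0 < e \<Longrightarrow> q \<in> A \<Longrightarrow> (p + e *\<^sub>R id_blinfun) o\<^sub>L q = id_blinfun \<Longrightarrow>
       (\<Sum>k\<in>K. \<rho> ((adj (X k) o\<^sub>L X k) o\<^sub>L q)) \<le> \<rho> ((p o\<^sub>L p) o\<^sub>L q)"
  shows "(\<Sum>k\<in>K. \<rho> (adj (U k) o\<^sub>L X k)) \<le> \<rho> p"
proof -
  let ?l = "\<Sum>k\<in>K. \<rho> (adj (U k) o\<^sub>L X k)"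
  have main: "2 * ?l \<le> 2 * \<rho> p + e * \<rho> id_blinfun" if e: "0 < e" for e
  proof -
    define b where "b = p + e *\<^sub>R id_blinfun"
    obtain q where q: "q \<in> A" "op_pos q" "q o\<^sub>L b = id_blinfun" "b o\<^sub>L q = id_blinfun"
      using resolvent_exists[OF p(2) closed_algebra p(1) e] unfolding b_def by blast
    have bA: "b \<in> A" unfolding b_def by (simp add: mem p)
    have b: "op_pos b"
      by (rule op_posI) (use bA e p(2) in \<open>simp_all add: b_def blinfun.bilinear_simps
          inner_add_left inner_add_right op_pos_sym op_pos_ge0\<close>)
    define s where "s = op_sqrt b"
    have s: "s \<in> A" "op_pos s" "s o\<^sub>L s = b"
      unfolding s_def by (rule op_sqrt_works[OF b closed_algebra bA])+
    have sb: "s o\<^sub>L b = b o\<^sub>L s" unfolding s(3)[symmetric] by (simp add: blinfun_compose_assoc)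
    have sq: "s o\<^sub>L q = q o\<^sub>L s"
    proof -
      have "q o\<^sub>L s = q o\<^sub>L ((s o\<^sub>L b) o\<^sub>L q)" by (simp add: blinfun_compose_assoc q)
      also have "\<dots> = (q o\<^sub>L b) o\<^sub>L (s o\<^sub>L q)" by (simp only: sb blinfun_compose_assoc)
      also have "\<dots> = s o\<^sub>L q" by (simp add: q)
      finally show ?thesis by simp
    qed
    have ssq: "s o\<^sub>L (s o\<^sub>L q) = id_blinfun" and sqs: "s o\<^sub>L (q o\<^sub>L s) = id_blinfun"
      using q(4) unfolding s(3)[symmetric] sq by (simp_all add: blinfun_compose_assoc sq)
    have step: "0 \<le> \<rho> ((adj (X k) o\<^sub>L X k) o\<^sub>L q) - 2 * \<rho> (adj (U k) o\<^sub>L X k)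
        + \<rho> (adj (U k o\<^sub>L s) o\<^sub>L (U k o\<^sub>L s))" if k: "k \<in> K" for k
    proof -
      \<comment> \<open>\<open>s q\<close> acts as the square root of \<open>q\<close>:
        \<open>s\<close> commutes with \<open>q\<close>, and \<open>s s q = 1\<close>.\<close>
      define Y where "Y = X k o\<^sub>L (s o\<^sub>L q)"
      define V where "V = U k o\<^sub>L s"
      have YA: "Y \<in> A" and VA: "V \<in> A" unfolding Y_def V_def by (simp_all add: mem X U k s q)
      have 1: "\<rho> (adj Y o\<^sub>L Y) = \<rho> ((adj (X k) o\<^sub>L X k) o\<^sub>L q)"
      proof -
        have aY: "adj Y = (q o\<^sub>L s) o\<^sub>L adj (X k)"
          unfolding Y_def using q s X[OF k] by (simp add: adj_compose mem op_pos_adj)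
        have "\<rho> (adj Y o\<^sub>L Y) = \<rho> ((q o\<^sub>L s) o\<^sub>L (adj (X k) o\<^sub>L Y))"
          unfolding aY blinfun_compose_assoc ..
        also have "\<dots> = \<rho> ((adj (X k) o\<^sub>L Y) o\<^sub>L (q o\<^sub>L s))"
          by (rule rho_comm) (simp_all add: mem q s YA X k)
        also have "(adj (X k) o\<^sub>L Y) o\<^sub>L (q o\<^sub>L s) = (adj (X k) o\<^sub>L X k) o\<^sub>L ((s o\<^sub>L q) o\<^sub>L (q o\<^sub>L s))"
          unfolding Y_def by (simp only: blinfun_compose_assoc)
        also have "(s o\<^sub>L q) o\<^sub>L (q o\<^sub>L s) = q o\<^sub>L (s o\<^sub>L (q o\<^sub>L s))"
          by (simp only: sq blinfun_compose_assoc)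
        finally show ?thesis unfolding sqs by simp
      qed
      have 2: "\<rho> (adj V o\<^sub>L Y) = \<rho> (adj (U k) o\<^sub>L X k)"
      proof -
        have aV: "adj V = s o\<^sub>L adj (U k)"
          unfolding V_def using s U[OF k] by (simp add: adj_compose op_pos_adj)
        have "\<rho> (adj V o\<^sub>L Y) = \<rho> (s o\<^sub>L (adj (U k) o\<^sub>L Y))"
          unfolding aV blinfun_compose_assoc ..
        also have "\<dots> = \<rho> ((adj (U k) o\<^sub>L Y) o\<^sub>L s)"
          by (rule rho_comm) (simp_all add: mem s YA U k)
        also have "(adj (U k) o\<^sub>L Y) o\<^sub>L s = (adj (U k) o\<^sub>L X k) o\<^sub>L (s o\<^sub>L (q o\<^sub>L s))"
          unfolding Y_def by (simp only: blinfun_compose_assoc)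
        finally show ?thesis unfolding sqs by simp
      qed
      show ?thesis
        using rho_pairing_le_squares[OF YA VA] unfolding 1 2 V_def[symmetric] by simp
    qed
    have "(\<Sum>k\<in>K. \<rho> (adj (U k o\<^sub>L s) o\<^sub>L (U k o\<^sub>L s))) \<le> \<rho> (adj s o\<^sub>L s)"
      by (rule rho_sum_square_mono)
        (use contr in \<open>simp_all add: contractive_def mem U s\<close>)
    then have "(\<Sum>k\<in>K. \<rho> (adj (U k o\<^sub>L s) o\<^sub>L (U k o\<^sub>L s))) \<le> \<rho> b"
      by (simp add: op_pos_adj s)
    \<comment> \<open>\<open>p p q = p - e p q\<close>, and \<open>p q = (p q)^2 + e q p q\<close>
      is a sum of two terms of nonnegative trace.\<close>
    moreover have "\<rho> ((p o\<^sub>L p) o\<^sub>L q) \<le> \<rho> p"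
    proof -
      note res = resolvent_identities[OF q(4,3)[unfolded b_def]]
      have pq: "adj (p o\<^sub>L q) = p o\<^sub>L q"
        using p q by (simp add: res adj_diff adj_scaleR op_pos_adj bounded_ops_scaleR)
      have "op_pos (adj q o\<^sub>L p o\<^sub>L q)" by (rule op_pos_sandwich) (use p q in simp_all)
      then have "0 \<le> \<rho> (adj q o\<^sub>L p o\<^sub>L q)" by (rule rho_op_pos) (simp add: mem p q)
      moreover have "0 \<le> \<rho> (adj (p o\<^sub>L q) o\<^sub>L (p o\<^sub>L q))"
        by (rule rho_square) (simp add: mem p q)
      moreover have "p o\<^sub>L q = (adj (p o\<^sub>L q) o\<^sub>L (p o\<^sub>L q)) + e *\<^sub>R (adj q o\<^sub>L p o\<^sub>L q)"
      proof -
        have "p o\<^sub>L q = (p o\<^sub>L q) o\<^sub>L (b o\<^sub>L q)" by (simp add: q)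
        also have "\<dots> = ((p o\<^sub>L q) o\<^sub>L (p o\<^sub>L q)) + e *\<^sub>R ((p o\<^sub>L q) o\<^sub>L q)"
          by (simp only: b_def blinfun_compose_simps blinfun_compose_id)
        also have "(p o\<^sub>L q) o\<^sub>L q = adj q o\<^sub>L p o\<^sub>L q"
          using q(2) by (simp add: op_pos_adj res)
        finally show ?thesis unfolding pq .
      qed
      ultimately have "0 \<le> \<rho> (p o\<^sub>L q)"
        using e rho_add[of "adj (p o\<^sub>L q) o\<^sub>L (p o\<^sub>L q)" "e *\<^sub>R (adj q o\<^sub>L p o\<^sub>L q)"]
        by (simp add: mem p q rho_scaleR)
      moreover have "(p o\<^sub>L p) o\<^sub>L q = p - e *\<^sub>R (p o\<^sub>L q)"
        by (simp add: blinfun_compose_assoc res(1) blinfun_compose_simps)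
      ultimately show ?thesis using e by (simp add: rho_diff rho_scaleR mem p q)
    qed
    moreover have "\<rho> b = \<rho> p + e * \<rho> id_blinfun"
      unfolding b_def by (simp add: rho_add rho_scaleR mem p)
    moreover have "0 \<le> (\<Sum>k\<in>K. \<rho> ((adj (X k) o\<^sub>L X k) o\<^sub>L q) - 2 * \<rho> (adj (U k) o\<^sub>L X k)
        + \<rho> (adj (U k o\<^sub>L s) o\<^sub>L (U k o\<^sub>L s)))"
      by (rule sum_nonneg) (rule step)
    ultimately show ?thesis
      using le[OF e q(1) q(4)[unfolded b_def]]
      by (simp add: sum.distrib sum_subtractf sum_distrib_left[symmetric])
  qed
  \<comment> \<open>The unit is not normalised in this locale, so \<open>\<rho> id_blinfun\<close>
    may vanish and cannot be divided by without a case distinction.\<close>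
  have "2 * ?l \<le> 2 * \<rho> p + d" if d: "0 < d" for d
  proof -
    have i: "0 \<le> \<rho> id_blinfun" using rho_square[OF mem(1)] by simp
    show ?thesis
    proof (cases "\<rho> id_blinfun = 0")
      case True then show ?thesis using main[of 1] d by simp
    next
      case False then show ?thesis using main[of "d / \<rho> id_blinfun"] d i by simp
    qed
  qed
  then have "2 * ?l \<le> 2 * \<rho> p" by (rule field_le_epsilon)
  then show ?thesis by simp
qed

text \<open>The polar part \<open>X k p^-1\<close> need not exist;
  \<open>U k = X k (p + e)^-1\<close> replaces it. It is contractive since
  \<open>(p + e)^2 \<ge> p^2\<close>, and because
  \<open>(p + e)^-1 p^2 = p - e + e^2 (p + e)^-1\<close> the loss is at most
  \<open>e * \<rho> id_blinfun\<close>.\<close>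

lemma pairing_attained:
  assumes K: "finite K" and X: "\<And>k. k \<in> K \<Longrightarrow> X k \<in> A"
    and p: "p \<in> A" "op_pos p" "p o\<^sub>L p = (\<Sum>k\<in>K. adj (X k) o\<^sub>L X k)" and d: "0 < d"
  shows "\<exists>U. (\<forall>k\<in>K. U k \<in> A) \<and> contractive K U \<and>
           \<rho> p \<le> (\<Sum>k\<in>K. \<rho> (adj (U k) o\<^sub>L X k)) + d"
proof -
  have i: "0 \<le> \<rho> id_blinfun" using rho_square[OF mem(1)] by simp
  define e where "e = d / (\<rho> id_blinfun + 1)"
  have e: "0 < e" using d i by (simp add: e_def)
  have ed: "e * \<rho> id_blinfun \<le> d" using d i by (simp add: e_def field_simps)
  obtain q where q: "q \<in> A" "op_pos q" "q o\<^sub>L (p + e *\<^sub>R id_blinfun) = id_blinfun"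
    "(p + e *\<^sub>R id_blinfun) o\<^sub>L q = id_blinfun"
    using resolvent_exists[OF p(2) closed_algebra p(1) e] by blast
  note res = resolvent_identities[OF q(4,3)]
  define U where "U k = X k o\<^sub>L q" for k
  have UA: "U k \<in> A" if "k \<in> K" for k unfolding U_def by (simp add: mem X that q)
  have "contractive K U"
    unfolding contractive_def
  proof
    fix v
    define w where "w = blinfun_apply q v"
    have v: "v = blinfun_apply p w + e *\<^sub>R w"
      using arg_cong[OF q(4), of "\<lambda>f. blinfun_apply f v"]
      by (simp add: w_def blinfun.bilinear_simps)
    have "(\<Sum>k\<in>K. (norm (blinfun_apply (U k) v))\<^sup>2)
        = (\<Sum>k\<in>K. inner w (blinfun_apply (adj (X k) o\<^sub>L X k) w))"
      by (rule sum.cong) (simp_all add: U_def w_def power2_norm_eq_inner adj_inner_right X)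
    also have "\<dots> = inner w (blinfun_apply (p o\<^sub>L p) w)"
      unfolding p(3) by (simp only: blinfun.sum_left inner_sum_right)
    also have "\<dots> = (norm (blinfun_apply p w))\<^sup>2"
      by (simp add: op_pos_sym[OF p(2), symmetric] power2_norm_eq_inner)
    also have "\<dots> \<le> (norm v)\<^sup>2"
    proof -
      have "(norm v)\<^sup>2 = (norm (blinfun_apply p w))\<^sup>2 + 2 * e * inner w (blinfun_apply p w)
          + e\<^sup>2 * (norm w)\<^sup>2"
        unfolding v power2_norm_eq_inner
        by (simp add: inner_add_left inner_add_right inner_commute power2_eq_square)
      moreover have "0 \<le> 2 * e * inner w (blinfun_apply p w)" using e op_pos_ge0[OF p(2)] by simp
      moreover have "0 \<le> e\<^sup>2 * (norm w)\<^sup>2" by simp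
      ultimately show ?thesis by linarith
    qed
    finally show "(\<Sum>k\<in>K. (norm (blinfun_apply (U k) v))\<^sup>2) \<le> (norm v)\<^sup>2" .
  qed
  moreover have "\<rho> p \<le> (\<Sum>k\<in>K. \<rho> (adj (U k) o\<^sub>L X k)) + d"
  proof -
    have "(\<Sum>k\<in>K. \<rho> (adj (U k) o\<^sub>L X k)) = (\<Sum>k\<in>K. \<rho> (q o\<^sub>L (adj (X k) o\<^sub>L X k)))"
      by (rule sum.cong) (simp_all add: U_def adj_compose X q op_pos_adj blinfun_compose_assoc)
    also have "\<dots> = \<rho> (q o\<^sub>L (p o\<^sub>L p))"
      unfolding p(3) blinfun_compose_simps by (rule rho_sum[symmetric]) (simp add: mem X q)
    also have "q o\<^sub>L (p o\<^sub>L p) = p - e *\<^sub>R id_blinfun + (e * e) *\<^sub>R q"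
      unfolding blinfun_compose_assoc[symmetric] res(2)
      by (simp add: blinfun_compose_simps res scaleR_diff_right)
    also have "\<rho> \<dots> = \<rho> p - e * \<rho> id_blinfun + e * e * \<rho> q"
      by (simp add: rho_add rho_diff rho_scaleR mem p q)
    finally show ?thesis using ed mult_nonneg_nonneg[OF _ rho_op_pos[OF q(2,1)], of "e * e"] by simp
  qed
  ultimately show ?thesis using UA by blast
qed

text \<open>One \<open>z\<close> must serve both \<open>y\<close> and \<open>adj y\<close>. With
  \<open>q'\<close> the resolvent of \<open>y adj y\<close>, the relation
  \<open>q adj y = adj y q'\<close> shows that \<open>adj z\<close> is the cut-off of
  \<open>adj y\<close>, so \<open>cutoff_bounds\<close> applies a second time.\<close>

lemma cutoff_exists:
  assumes y: "y \<in> A" and c: "0 < c"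
  shows "\<exists>z\<in>A. norm z \<le> sqrt c / 2 \<and>
    (\<forall>v. (norm (blinfun_apply (y - z) v))\<^sup>2 \<le> (norm (blinfun_apply (adj y o\<^sub>L y) v))\<^sup>2 / (4 * c)) \<and>
    (\<forall>v. (norm (blinfun_apply (adj (y - z)) v))\<^sup>2
       \<le> (norm (blinfun_apply (y o\<^sub>L adj y) v))\<^sup>2 / (4 * c))"
proof -
  have y': "adj y \<in> A" and yb: "y \<in> bounded_ops" "adj y \<in> bounded_ops" using y by (simp_all add: mem)
  define S where "S = adj y o\<^sub>L y"
  define S' where "S' = y o\<^sub>L adj y"
  have S: "op_pos S" "S \<in> A" unfolding S_def using y y' by (simp_all add: op_pos_adj_compose mem)
  have S': "op_pos S'" "S' \<in> A"
    unfolding S'_def using op_pos_adj_compose[OF yb(2)] y y' by (simp_all add: mem)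
  obtain q where q: "q \<in> A" "op_pos q" "q o\<^sub>L (S + c *\<^sub>R id_blinfun) = id_blinfun"
    "(S + c *\<^sub>R id_blinfun) o\<^sub>L q = id_blinfun"
    using resolvent_exists[OF S(1) closed_algebra S(2) c] by blast
  obtain q' where q': "q' \<in> A" "op_pos q'" "q' o\<^sub>L (S' + c *\<^sub>R id_blinfun) = id_blinfun"
    "(S' + c *\<^sub>R id_blinfun) o\<^sub>L q' = id_blinfun"
    using resolvent_exists[OF S'(1) closed_algebra S'(2) c] by blast
  have comm: "q o\<^sub>L adj y = adj y o\<^sub>L q'"
  proof -
    have "(S + c *\<^sub>R id_blinfun) o\<^sub>L adj y = adj y o\<^sub>L (S' + c *\<^sub>R id_blinfun)"
      by (simp add: S_def S'_def blinfun_compose_algebra)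
    then have "q o\<^sub>L ((S + c *\<^sub>R id_blinfun) o\<^sub>L adj y) o\<^sub>L q' = q o\<^sub>L (adj y o\<^sub>L (S' + c *\<^sub>R id_blinfun)) o\<^sub>L q'"
      by simp
    then have "(q o\<^sub>L (S + c *\<^sub>R id_blinfun)) o\<^sub>L (adj y o\<^sub>L q') = (q o\<^sub>L adj y) o\<^sub>L ((S' + c *\<^sub>R id_blinfun) o\<^sub>L q')"
      by (simp only: blinfun_compose_assoc)
    then show ?thesis by (simp add: q q')
  qed
  define z where "z = c *\<^sub>R (y o\<^sub>L q)"
  have zA: "z \<in> A" unfolding z_def by (simp add: mem y q)
  have "adj (y - z) = adj y - c *\<^sub>R (adj y o\<^sub>L q')"
    using y q zA by (simp add: adj_diff) (simp add: z_def adj_scaleR adj_compose mem op_pos_adj comm)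
  moreover have "(norm (blinfun_apply (adj y - c *\<^sub>R (adj y o\<^sub>L q')) v))\<^sup>2
      \<le> (norm (blinfun_apply (y o\<^sub>L adj y) v))\<^sup>2 / (4 * c)" for v
    using cutoff_bounds(2)[OF yb(2) c, of q' v] q'(4) yb unfolding S'_def by simp
  moreover note cutoff_bounds[OF yb(1) c q(4)[unfolded S_def]]
  ultimately show ?thesis using zA unfolding z_def by (intro bexI[of _ z]) (simp_all add: z_def)
qed

end

section \<open>Norming functionals on finite families\<close>

text \<open>Only an inequality is required for scaling; applied to the factor \<open>1 / t\<close>
  it yields equality for positive \<open>t\<close>.\<close>

definition sublinear :: "(('k \<Rightarrow> 'm::real_vector) \<Rightarrow> real) \<Rightarrow> bool" where
  "sublinear p \<longleftrightarrow> (\<forall>x y. p (\<lambda>k. x k + y k) \<le> p x + p y) \<and>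
     (\<forall>t x. 0 \<le> t \<longrightarrow> p (\<lambda>k. t *\<^sub>R x k) \<le> t * p x)"

lemma sublinear_add: "sublinear p \<Longrightarrow> p (\<lambda>k. x k + y k) \<le> p x + p y"
  and sublinear_scale: "sublinear p \<Longrightarrow> 0 \<le> t \<Longrightarrow> p (\<lambda>k. t *\<^sub>R x k) \<le> t * p x"
  by (auto simp: sublinear_def)

lemma sublinear_zero: "sublinear p \<Longrightarrow> p (\<lambda>k. 0) = 0"
  using sublinear_add[of p "\<lambda>k. 0" "\<lambda>k. 0"] sublinear_scale[of p 0 "\<lambda>k. 0"] by simp

lemma sublinear_minus: "sublinear p \<Longrightarrow> - p (\<lambda>k. - x k) \<le> p x"
  using sublinear_add[of p x "\<lambda>k. - x k"] sublinear_zero[of p] by simp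

text \<open>One Hahn--Banach step: \<open>r x\<close> is the infimum over \<open>t \<ge> 0\<close>
  of \<open>p (x + t y) - t p y\<close>. Taking \<open>t = 0\<close> gives \<open>r \<le> p\<close>,
  and \<open>t = 1\<close> at \<open>- y\<close> gives the last bound, which makes \<open>r\<close>
  odd along \<open>y\<close> and keeps the value \<open>p y\<close> there.\<close>

lemma sublinear_improve:
  fixes p :: "('k \<Rightarrow> 'm::real_vector) \<Rightarrow> real"
  assumes p: "sublinear p"
  shows "\<exists>r. sublinear r \<and> (\<forall>x. r x \<le> p x) \<and> r (\<lambda>k. - y k) \<le> - p y"
proof -
  define S where "S x = (\<lambda>t. p (\<lambda>k. x k + t *\<^sub>R y k) - t * p y) ` {0..}" for x
  define r where "r x = Inf (S x)" for x
  have lower: "- p (\<lambda>k. - x k) \<le> a" if a: "a \<in> S x" for x a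
  proof -
    obtain t where t: "0 \<le> t" "a = p (\<lambda>k. x k + t *\<^sub>R y k) - t * p y"
      using a by (auto simp: S_def)
    \<comment> \<open>Scaling back by \<open>1 / t\<close> gives the inequality opposite to the
      assumed one; it keeps the infimum finite.\<close>
    have "t * p y \<le> p (\<lambda>k. t *\<^sub>R y k)"
    proof (cases "t = 0")
      case False
      then show ?thesis
        using sublinear_scale[OF p, of "1 / t" "\<lambda>k. t *\<^sub>R y k"] t(1) by (simp add: field_simps)
    qed (simp add: sublinear_zero[OF p])
    also have "\<dots> \<le> p (\<lambda>k. x k + t *\<^sub>R y k) + p (\<lambda>k. - x k)"
      using sublinear_add[OF p, of "\<lambda>k. x k + t *\<^sub>R y k" "\<lambda>k. - x k"] by simp
    finally show ?thesis by (simp add: t)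
  qed
  have bdd: "bdd_below (S x)" for x using lower by (rule bdd_belowI)
  have ne: "S x \<noteq> {}" for x by (simp add: S_def)
  have rle: "r x \<le> p (\<lambda>k. x k + t *\<^sub>R y k) - t * p y" if "0 \<le> t" for x t
    unfolding r_def by (rule cInf_lower[OF _ bdd]) (use that in \<open>simp add: S_def\<close>)
  have rle0: "r x \<le> p x" for x using rle[of 0 x] by simp
  have "r (\<lambda>k. x k + x' k) \<le> r x + r x'" for x x'
  proof -
    have *: "r (\<lambda>k. x k + x' k) \<le> a + b" if ab: "a \<in> S x" "b \<in> S x'" for a b
    proof -
      obtain t t' where t: "0 \<le> t" "a = p (\<lambda>k. x k + t *\<^sub>R y k) - t * p y"
        "0 \<le> t'" "b = p (\<lambda>k. x' k + t' *\<^sub>R y k) - t' * p y"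
        using ab by (auto simp: S_def)
      have "r (\<lambda>k. x k + x' k) \<le> p (\<lambda>k. x k + x' k + (t + t') *\<^sub>R y k) - (t + t') * p y"
        using rle[of "t + t'"] t by simp
      also have "(\<lambda>k. x k + x' k + (t + t') *\<^sub>R y k) = (\<lambda>k. (x k + t *\<^sub>R y k) + (x' k + t' *\<^sub>R y k))"
        by (simp add: scaleR_add_left algebra_simps)
      also have "p \<dots> \<le> p (\<lambda>k. x k + t *\<^sub>R y k) + p (\<lambda>k. x' k + t' *\<^sub>R y k)"
        by (rule sublinear_add[OF p])
      finally show ?thesis by (simp add: t algebra_simps)
    qed
    have "r (\<lambda>k. x k + x' k) - b \<le> r x" if "b \<in> S x'" for b
      unfolding r_def[of x] by (rule cInf_greatest[OF ne]) (use *[OF _ that] in \<open>simp add: algebra_simps\<close>)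
    then have "r (\<lambda>k. x k + x' k) - r x \<le> b" if "b \<in> S x'" for b using that by (simp add: algebra_simps)
    then have "r (\<lambda>k. x k + x' k) - r x \<le> r x'"
      unfolding r_def[of x'] by (rule cInf_greatest[OF ne])
    then show ?thesis by simp
  qed
  moreover have "r (\<lambda>k. s *\<^sub>R x k) \<le> s * r x" if s: "0 \<le> s" for s x
  proof (cases "s = 0")
    case True
    then show ?thesis using rle0[of "\<lambda>k. 0"] sublinear_zero[OF p] by simp
  next
    case False
    with s have s: "0 < s" by simp
    have "r (\<lambda>k. s *\<^sub>R x k) / s \<le> r x"
      unfolding r_def[of x]
    proof (rule cInf_greatest[OF ne])
      fix a assume "a \<in> S x"
      then obtain t where t: "0 \<le> t" "a = p (\<lambda>k. x k + t *\<^sub>R y k) - t * p y"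
        by (auto simp: S_def)
      have "r (\<lambda>k. s *\<^sub>R x k) \<le> p (\<lambda>k. s *\<^sub>R x k + (s * t) *\<^sub>R y k) - (s * t) * p y"
        using rle[of "s * t"] s t by simp
      also have "(\<lambda>k. s *\<^sub>R x k + (s * t) *\<^sub>R y k) = (\<lambda>k. s *\<^sub>R (x k + t *\<^sub>R y k))"
        by (simp add: scaleR_add_right)
      also have "p \<dots> \<le> s * p (\<lambda>k. x k + t *\<^sub>R y k)"
        using s by (intro sublinear_scale[OF p]) simp
      finally show "r (\<lambda>k. s *\<^sub>R x k) / s \<le> a" using s by (simp add: t field_simps)
    qed
    then show ?thesis using s by (simp add: field_simps)
  qed
  ultimately have "sublinear r" by (simp add: sublinear_def)
  moreover have "r (\<lambda>k. - y k) \<le> - p y" using rle[of 1 "\<lambda>k. - y k"] sublinear_zero[OF p] by simp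
  ultimately show ?thesis using rle0 by blast
qed

text \<open>For finitely many directions an induction replaces Zorn's lemma. Oddness survives a
  further decrease from \<open>r\<close> to \<open>s\<close>:
  \<open>s (- z) \<le> r (- z) \<le> - r z \<le> - s z\<close>.\<close>

lemma sublinear_odd_on:
  fixes p :: "('k \<Rightarrow> 'm::real_vector) \<Rightarrow> real"
  assumes "finite Y" and "sublinear p"
  shows "\<exists>r. sublinear r \<and> (\<forall>x. r x \<le> p x) \<and> (\<forall>y\<in>Y. r (\<lambda>k. - y k) \<le> - r y)"
  using assms
proof (induction Y)
  case (insert y Y)
  then obtain r where r: "sublinear r" "\<And>x. r x \<le> p x" "\<And>y. y \<in> Y \<Longrightarrow> r (\<lambda>k. - y k) \<le> - r y"
    by blast
  obtain s where s: "sublinear s" "\<And>x. s x \<le> r x" "s (\<lambda>k. - y k) \<le> - r y"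
    using sublinear_improve[OF r(1), of y] by blast
  have "s (\<lambda>k. - z k) \<le> - s z" if "r (\<lambda>k. - z k) \<le> - r z \<or> z = y" for z
    using that s(2)[of "\<lambda>k. - z k"] s(2)[of z] s(3) by auto
  then show ?case using s(1,2) r(2,3) by (intro exI[of _ s]) (auto intro: order_trans)
qed auto

text \<open>The value at \<open>C\<close> is fixed first, then the functional is made odd on the
  unit families. Sublinear and odd on a basis means linear, and \<open>B\<close> is read off from
  the values there. The index type may be infinite, so \<open>R\<close> erases the coordinates
  outside \<open>K\<close>, which \<open>local\<close> permits.\<close>

lemma norming_functional_exists:
  fixes p :: "('k \<Rightarrow> 'm::euclidean_space) \<Rightarrow> real"
  assumes K: "finite K" and p: "sublinear p"
    and local: "\<And>x y. (\<And>k. k \<in> K \<Longrightarrow> x k = y k) \<Longrightarrow> p x = p y"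
  shows "\<exists>B. (\<forall>X. (\<Sum>k\<in>K. inner (B k) (X k)) \<le> p X) \<and> p C \<le> (\<Sum>k\<in>K. inner (B k) (C k))"
proof -
  define E where "E = (\<lambda>(k :: 'k, b) k'. if k' = k then (b :: 'm) else 0)"
  define R where "R X k = (if k \<in> K then X k else 0)" for X :: "'k \<Rightarrow> 'm" and k
  have Rp: "p (R X) = p X" for X by (rule local) (simp add: R_def)
  obtain p' where p': "sublinear p'" "\<And>x. p' x \<le> p x" "p' (\<lambda>k. - R C k) \<le> - p C"
    using sublinear_improve[OF p, of "R C"] unfolding Rp by blast
  obtain q where q: "sublinear q" "\<And>x. q x \<le> p' x"
    "\<And>kb. kb \<in> K \<times> Basis \<Longrightarrow> q (\<lambda>k. - E kb k) \<le> - q (E kb)"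
    using sublinear_odd_on[of "E ` (K \<times> Basis)" p'] K p'(1) by auto
  have qp: "q x \<le> p x" for x using q(2) p'(2) order_trans by blast
  have hom: "q (\<lambda>k. c *\<^sub>R E kb k) \<le> c * q (E kb)" if "kb \<in> K \<times> Basis" for c kb
  proof (cases "0 \<le> c")
    case True then show ?thesis by (rule sublinear_scale[OF q(1)])
  next
    case False
    have "q (\<lambda>k. (- c) *\<^sub>R (- E kb k)) \<le> (- c) * q (\<lambda>k. - E kb k)"
      by (rule sublinear_scale[OF q(1)]) (use False in simp)
    also have "\<dots> \<le> (- c) * (- q (E kb))"
      by (rule mult_left_mono[OF q(3)[OF that]]) (use False in simp)
    finally show ?thesis by simp
  qed
  have upper: "q (\<lambda>k. \<Sum>kb\<in>F. c kb *\<^sub>R E kb k) \<le> (\<Sum>kb\<in>F. c kb * q (E kb))"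
    if "F \<subseteq> K \<times> Basis" for F c
    using finite_subset[OF that finite_cartesian_product[OF K finite_Basis]] that
  proof (induction F)
    case empty then show ?case by (simp add: sublinear_zero[OF q(1)])
  next
    case (insert kb F)
    have "q (\<lambda>k. \<Sum>kb\<in>insert kb F. c kb *\<^sub>R E kb k)
        = q (\<lambda>k. c kb *\<^sub>R E kb k + (\<Sum>kb\<in>F. c kb *\<^sub>R E kb k))"
      using insert by simp
    also have "\<dots> \<le> q (\<lambda>k. c kb *\<^sub>R E kb k) + q (\<lambda>k. \<Sum>kb\<in>F. c kb *\<^sub>R E kb k)"
      by (rule sublinear_add[OF q(1)])
    also have "\<dots> \<le> c kb * q (E kb) + (\<Sum>kb\<in>F. c kb * q (E kb))"
      using insert by (intro add_mono hom insert.IH) auto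
    finally show ?case using insert by simp
  qed
  define B where "B k = (\<Sum>b\<in>Basis. q (E (k, b)) *\<^sub>R b)" for k
  have pair: "(\<Sum>k\<in>K. inner (B k) (X k)) = (\<Sum>kb\<in>K \<times> Basis. inner (X (fst kb)) (snd kb) * q (E kb))" for X
    unfolding B_def inner_sum_left sum.cartesian_product
    by (rule sum.cong) (auto simp: inner_commute)
  have expand: "(\<Sum>kb\<in>K \<times> Basis. inner (X (fst kb)) (snd kb) *\<^sub>R E kb k) = X k" if "k \<in> K" for X k
  proof -
    have "(\<Sum>kb\<in>K \<times> Basis. inner (X (fst kb)) (snd kb) *\<^sub>R E kb k)
        = (\<Sum>k'\<in>K. \<Sum>b\<in>Basis. inner (X k') b *\<^sub>R (if k = k' then b else 0))"
      by (simp add: sum.cartesian_product E_def split_def)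
    also have "\<dots> = (\<Sum>k'\<in>K. if k = k' then X k' else 0)"
      by (rule sum.cong) (auto simp: euclidean_representation)
    also have "\<dots> = X k" using K that by simp
    finally show ?thesis .
  qed
  have upperX: "q (R X) \<le> (\<Sum>k\<in>K. inner (B k) (X k))" for X
  proof -
    have "(\<lambda>k. \<Sum>kb\<in>K \<times> Basis. inner (X (fst kb)) (snd kb) *\<^sub>R E kb k) = R X"
    proof
      fix k show "(\<Sum>kb\<in>K \<times> Basis. inner (X (fst kb)) (snd kb) *\<^sub>R E kb k) = R X k"
      proof (cases "k \<in> K")
        case True then show ?thesis by (simp add: expand R_def)
      next
        case False
        then have "E kb k = 0" if "kb \<in> K \<times> Basis" for kb using that by (auto simp: E_def)
        then show ?thesis using False by (simp add: R_def)
      qed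
    qed
    then show ?thesis using upper[OF order_refl, of "\<lambda>kb. inner (X (fst kb)) (snd kb)"]
      by (simp add: pair)
  qed
  have R_minus: "(\<lambda>k. - R X k) = R (\<lambda>k. - X k)" for X by (auto simp: R_def)
  have "(\<Sum>k\<in>K. inner (B k) (X k)) \<le> p X" for X
  proof -
    have "(\<Sum>k\<in>K. inner (B k) (X k)) = - (\<Sum>k\<in>K. inner (B k) (- X k))" by (simp add: sum_negf)
    also have "\<dots> \<le> - q (\<lambda>k. - R X k)" using upperX[of "\<lambda>k. - X k"] by (simp add: R_minus)
    also have "\<dots> \<le> q (R X)" by (rule sublinear_minus[OF q(1)])
    also have "\<dots> \<le> p X" using qp[of "R X"] by (simp add: Rp)
    finally show ?thesis .
  qed
  \<comment> \<open>Passing from \<open>p'\<close> to the smaller \<open>q\<close> preserves the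
    bound at \<open>- R C\<close>, and \<open>q (R C)\<close> is at least minus the value of
    \<open>q\<close> there.\<close>
  moreover have "p C \<le> (\<Sum>k\<in>K. inner (B k) (C k))"
    using q(2)[of "\<lambda>k. - R C k"] p'(3) sublinear_minus[OF q(1), of "R C"] upperX[of C] by simp
  ultimately show ?thesis by blast
qed

section \<open>Operator matrices\<close>

lemma op_scale_apply [simp]: "blinfun_apply (op_scale c S) v = c *\<^sub>C blinfun_apply S v"
  by (simp add: op_scale.rep_eq)

lemma scaleC_zero_left [simp]: "0 *\<^sub>C v = (0 :: 'a::complex_hilbert_space)"
  using scaleR_eq_scaleC[of 0 v] by simp

lemma scaleC_one [simp]: "1 *\<^sub>C v = (v :: 'a::complex_hilbert_space)"
  using scaleR_eq_scaleC[of 1 v] by simp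

lemma op_scale_zero [simp]: "op_scale 0 S = 0" "op_scale c 0 = 0"
  and op_scale_one [simp]: "op_scale 1 S = S"
  and op_scale_op_scale: "op_scale c (op_scale d S) = op_scale (c * d) S"
  and op_scale_add_left: "op_scale (c + d) S = op_scale c S + op_scale d S"
  and op_scale_diff_right: "op_scale c (S - R) = op_scale c S - op_scale c R"
  and scaleR_eq_op_scale: "r *\<^sub>R S = op_scale (complex_of_real r) S"
  and op_scale_compose_left: "op_scale c S o\<^sub>L R = op_scale c (S o\<^sub>L R)"
  by (rule blinfun_eqI; simp add: blinfun.bilinear_simps scaleC_scaleC scaleC_add_left
      scaleC_add_right scaleC_diff_right scaleR_eq_scaleC)+

lemma op_scale_sum_left: "op_scale (\<Sum>k\<in>K. c k) S = (\<Sum>k\<in>K. op_scale (c k) S)"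
  by (induction K rule: infinite_finite_induct) (simp_all add: op_scale_add_left)

lemma op_scale_compose_right: "S \<in> bounded_ops \<Longrightarrow> S o\<^sub>L op_scale c R = op_scale c (S o\<^sub>L R)"
  by (rule blinfun_eqI) (simp add: bounded_opsD)

lemma op_entry_apply [simp]:
  "blinfun_apply (op_entry T i j) v = blinfun_apply T (axis j v) $ i"
  by (simp add: op_entry.rep_eq)

lemma scaleC_vec_nth [simp]: "(c *\<^sub>C v) $ i = c *\<^sub>C (v $ i)"
  by (simp add: scaleC_vec_def)

lemma scaleC_axis: "c *\<^sub>C axis j v = axis j (c *\<^sub>C (v :: 'a::complex_hilbert_space))"
  by (simp add: vec_eq_iff axis_def)

lemma inner_axis_left: "inner (axis i v) w = inner v (w $ i)"
proof -
  have "inner (axis i v) w = (\<Sum>k\<in>UNIV. if k = i then inner v (w $ i) else 0)"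
    unfolding inner_vec_def by (rule sum.cong) (auto simp: axis_def)
  then show ?thesis by simp
qed

lemma inner_axis_right: "inner w (axis i v) = inner (w $ i) v"
  by (metis inner_axis_left inner_commute)

lemma op_apply_entries: "blinfun_apply T v $ i = (\<Sum>j\<in>UNIV. blinfun_apply (op_entry T i j) (v $ j))"
proof -
  have "v = (\<Sum>j\<in>UNIV. axis j (v $ j))" using vec_eq_sum_axis[of "\<lambda>j. v $ j"] by simp
  then have "blinfun_apply T v = (\<Sum>j\<in>UNIV. blinfun_apply T (axis j (v $ j)))"
    by (metis blinfun.sum_right)
  then show ?thesis by simp
qed

lemma op_entry_eqI: "(\<And>i j. op_entry f i j = op_entry g i j) \<Longrightarrow> f = g"
  by (rule blinfun_eqI) (simp only: vec_eq_iff op_apply_entries simp_thms)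

lemma op_entry_add: "op_entry (f + g) i j = op_entry f i j + op_entry g i j"
  and op_entry_diff: "op_entry (f - g) i j = op_entry f i j - op_entry g i j"
  and op_entry_scaleR: "op_entry (r *\<^sub>R f) i j = r *\<^sub>R op_entry f i j"
  and op_entry_zero [simp]: "op_entry 0 i j = 0"
  by (rule blinfun_eqI; simp add: blinfun.bilinear_simps)+

lemma op_entry_sum: "op_entry (sum f K) i j = (\<Sum>k\<in>K. op_entry (f k) i j)"
  by (induction K rule: infinite_finite_induct) (simp_all add: op_entry_add)

lemma op_entry_id: "op_entry id_blinfun i j = (if i = j then id_blinfun else 0)"
  by (rule blinfun_eqI) (simp add: axis_def)

lemma op_entry_compose: "op_entry (f o\<^sub>L g) i j = (\<Sum>k\<in>UNIV. op_entry f i k o\<^sub>L op_entry g k j)"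
proof (rule blinfun_eqI)
  fix v
  show "blinfun_apply (op_entry (f o\<^sub>L g) i j) v
      = blinfun_apply (\<Sum>k\<in>UNIV. op_entry f i k o\<^sub>L op_entry g k j) v"
    using op_apply_entries[of f "blinfun_apply g (axis j v)" i] by (simp add: blinfun.sum_left)
qed

lemma op_entry_bounded_ops [intro]: "f \<in> bounded_ops \<Longrightarrow> op_entry f i j \<in> bounded_ops"
  by (simp add: bounded_ops_def scaleC_axis[symmetric])

lemma bounded_ops_entries:
  assumes "\<And>i j. op_entry f i j \<in> bounded_ops" shows "f \<in> bounded_ops"
  unfolding bounded_ops_def
proof (intro CollectI allI)
  show "blinfun_apply f (c *\<^sub>C v) = c *\<^sub>C blinfun_apply f v" for c v
    by (simp only: vec_eq_iff scaleC_vec_nth op_apply_entries[of f] scaleC_sum_right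
        bounded_opsD[OF assms] simp_thms)
qed

lemma op_entry_adj: "f \<in> bounded_ops \<Longrightarrow> op_entry (adj f) i j = adj (op_entry f j i)"
  by (rule adj_unique[symmetric])
    (auto simp: inner_axis_left[symmetric] inner_axis_right[symmetric] adj_inner)

lemma norm_axis [simp]: "norm (axis i v :: 'a::complex_hilbert_space ^ 'd) = norm v"
  by (simp add: norm_eq_sqrt_inner inner_axis_left)

text \<open>Continuity of the entries makes the matrices over a norm closed set norm closed.\<close>

lemma bounded_linear_op_entry: "bounded_linear (\<lambda>f :: ('a::complex_hilbert_space ^ 'd) \<Rightarrow>\<^sub>L ('a ^ 'd). op_entry f i j)"
proof (rule bounded_linear_intro)
  show "norm (op_entry f i j) \<le> norm f * 1" for f :: "('a ^ 'd) \<Rightarrow>\<^sub>L ('a ^ 'd)"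
  proof (rule norm_blinfun_bound)
    show "norm (blinfun_apply (op_entry f i j) v) \<le> norm f * 1 * norm v" for v
      using order_trans[OF Finite_Cartesian_Product.norm_nth_le norm_blinfun, of f "axis j v" i] by simp
  qed simp
qed (simp_all add: op_entry_add op_entry_scaleR)

lemma op_entry_tensor [simp]: "op_entry (C \<otimes> S) i j = op_scale (C $ i $ j) S"
proof (rule blinfun_eqI)
  fix v
  have "blinfun_apply (op_entry (C \<otimes> S) i j) v
      = (\<Sum>k\<in>UNIV. if k = j then (C $ i $ j) *\<^sub>C blinfun_apply S v else 0)"
    unfolding op_entry_apply mat_tensor.rep_eq vec_lambda_beta
    by (rule sum.cong) (auto simp: axis_def)
  then show "blinfun_apply (op_entry (C \<otimes> S) i j) v = blinfun_apply (op_scale (C $ i $ j) S) v"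
    by simp
qed

lemma tensor_bounded_ops [intro]: "S \<in> bounded_ops \<Longrightarrow> C \<otimes> S \<in> bounded_ops"
  by (rule bounded_ops_entries) auto

lemma tensor_compose:
  "S \<in> bounded_ops \<Longrightarrow> (C \<otimes> S) o\<^sub>L (D \<otimes> R) = (C ** D) \<otimes> (S o\<^sub>L R)"
  by (rule op_entry_eqI)
    (simp add: op_entry_compose matrix_matrix_mult_def op_scale_sum_left op_scale_compose_left
      op_scale_compose_right op_scale_op_scale)

lemma adj_tensor: "S \<in> bounded_ops \<Longrightarrow> adj (C \<otimes> S) = mat_adj C \<otimes> adj S"
  by (rule op_entry_eqI) (simp add: op_entry_adj tensor_bounded_ops mat_adj_def adj_op_scale)

lemma tensor_add_left: "(C + D) \<otimes> S = C \<otimes> S + D \<otimes> S"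
  and tensor_diff_right: "C \<otimes> (S - R) = C \<otimes> S - C \<otimes> R"
  and tensor_zero [simp]: "0 \<otimes> S = 0" "C \<otimes> 0 = 0"
  and tensor_one: "mat 1 \<otimes> id_blinfun = id_blinfun"
  by (rule op_entry_eqI; simp add: op_entry_add op_entry_diff op_scale_add_left
      op_scale_diff_right op_entry_id mat_def)+

lemma tensor_sum_left: "(\<Sum>k\<in>K. C k) \<otimes> S = (\<Sum>k\<in>K. C k \<otimes> S)"
  by (induction K rule: infinite_finite_induct) (simp_all add: tensor_add_left)

lemma tensor_scaleR_left: "(r *\<^sub>R C) \<otimes> S = r *\<^sub>R (C \<otimes> S)"
  by (rule op_entry_eqI)
    (simp add: op_entry_scaleR scaleR_eq_op_scale[of r "op_scale _ S"] op_scale_op_scale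
      scaleR_conv_of_real[of r "_ :: complex"])

section \<open>Complex matrices\<close>

lemma mat_adj_mat_adj [simp]: "mat_adj (mat_adj A) = A"
  by (simp add: mat_adj_def vec_eq_iff)

lemma mat_adj_mult: "mat_adj (A ** B) = mat_adj B ** mat_adj A"
  by (simp add: mat_adj_def vec_eq_iff matrix_matrix_mult_def mult.commute)

lemma mat_adj_add: "mat_adj (A + B) = mat_adj A + mat_adj B"
  and mat_adj_scaleR: "mat_adj (r *\<^sub>R A) = r *\<^sub>R mat_adj A"
  and mat_adj_zero [simp]: "mat_adj 0 = 0"
  by (simp_all add: mat_adj_def vec_eq_iff)

lemma matrix_mult_sum_left: "(\<Sum>k\<in>K. A k) ** B = (\<Sum>k\<in>K. A k ** (B :: complex ^ 'd ^ 'd))"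
  for A :: "'k \<Rightarrow> complex ^ 'd ^ 'd"
  by (simp add: vec_eq_iff matrix_matrix_mult_def sum_distrib_right sum.swap[of _ K])

lemma scaleR_matrix_mult: "(r *\<^sub>R A) ** B = r *\<^sub>R (A ** (B :: complex ^ 'd ^ 'd))"
  for A :: "complex ^ 'd ^ 'd"
  by (simp add: vec_eq_iff matrix_matrix_mult_def scaleR_sum_right)

lemma trace_sum: "trace (\<Sum>k\<in>K. A k) = (\<Sum>k\<in>K. trace (A k))"
  for A :: "'k \<Rightarrow> complex ^ 'd ^ 'd"
  by (simp add: trace_def sum.swap[of _ K])

text \<open>The Euclidean inner product of nested vectors is the real Hilbert--Schmidt pairing, so
  the functionals given by \<open>norming_functional_exists\<close> are families of matrices paired
  through the trace.\<close>

lemma inner_matrix: "inner A B = Re (trace (mat_adj A ** B))"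
proof -
  have "inner A B = (\<Sum>i\<in>UNIV. \<Sum>j\<in>UNIV. Re (cnj (A $ i $ j) * (B $ i $ j)))"
    by (simp add: inner_vec_def inner_complex_def)
  also have "\<dots> = (\<Sum>j\<in>UNIV. \<Sum>i\<in>UNIV. Re (cnj (A $ i $ j) * (B $ i $ j)))" by (rule sum.swap)
  finally show ?thesis by (simp add: trace_def mat_adj_def matrix_matrix_mult_def)
qed

lemma inner_mat_adj: "inner (mat_adj A) (mat_adj B) = inner A (B :: complex ^ 'd ^ 'd)"
  unfolding inner_vec_def by (subst sum.swap) (simp add: mat_adj_def inner_complex_def)

lemma norm_mat_adj [simp]: "norm (mat_adj A) = norm A"
  by (simp add: norm_eq_sqrt_inner inner_mat_adj)

lemma inner_matrix_mult_left: "inner (A ** B) C = inner B (mat_adj A ** (C :: complex ^ 'd ^ 'd))"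
  for A B :: "complex ^ 'd ^ 'd"
  by (simp add: inner_matrix mat_adj_mult matrix_mul_assoc)

lemma op_pos_zero: "op_pos 0"
  by (rule op_posI) auto

lemma op_pos_add: "op_pos S \<Longrightarrow> op_pos T \<Longrightarrow> op_pos (S + T)"
  by (rule op_posI) (simp_all add: bounded_ops_add op_pos_bounded blinfun.add_left inner_add_left
      inner_add_right op_pos_sym op_pos_ge0)

lemma op_pos_sum: "(\<And>k. k \<in> K \<Longrightarrow> op_pos (f k)) \<Longrightarrow> op_pos (sum f K)"
  by (induction K rule: infinite_finite_induct) (auto simp: op_pos_zero op_pos_add)

text \<open>Scalar matrices are the operator matrices over the Hilbert space \<open>complex\<close>;
  square roots and resolvents of matrices are pulled back along this identification.\<close>

abbreviation mat_op :: "complex ^ 'd ^ 'd \<Rightarrow> (complex ^ 'd) \<Rightarrow>\<^sub>L (complex ^ 'd)" where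
  "mat_op A \<equiv> A \<otimes> id_blinfun"

lemma mat_op_apply: "blinfun_apply (mat_op A) v = A *v v"
  by (simp add: mat_tensor.rep_eq matrix_vector_mult_def scaleC_complex_def)

lemma mat_op_inject: "mat_op A = mat_op B \<longleftrightarrow> A = B"
proof
  assume "mat_op A = mat_op B"
  then have "op_entry (mat_op A) i j = op_entry (mat_op B) i j" for i j by simp
  then have "blinfun_apply (op_entry (mat_op A) i j) 1 = blinfun_apply (op_entry (mat_op B) i j) 1" for i j
    by simp
  then show "A = B"
    unfolding op_entry_tensor by (simp add: scaleC_complex_def vec_eq_iff)
qed simp

lemma mat_op_surj:
  assumes "S \<in> bounded_ops" shows "\<exists>B. S = mat_op B"
proof
  let ?B = "\<chi> i j. blinfun_apply (op_entry S i j) 1"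
  show "S = mat_op ?B"
  proof (rule op_entry_eqI, rule blinfun_eqI)
    fix i j and z :: complex
    show "blinfun_apply (op_entry S i j) z = blinfun_apply (op_entry (mat_op ?B) i j) z"
      using bounded_opsD[OF op_entry_bounded_ops[OF assms], of i j z 1]
      unfolding op_entry_tensor by (simp add: scaleC_complex_def mult.commute)
  qed
qed

lemma op_pos_mat_op: "op_pos (mat_op A) \<longleftrightarrow> mat_pos A"
  by (simp add: op_pos_def mat_pos_def mat_op_apply tensor_bounded_ops)

lemma closed_algebra_bounded_ops: "closed_algebra bounded_ops"
  using closed_algebra_commutant[of "{}"] by simp

lemma mat_sqrt_works:
  assumes "mat_pos A"
  shows "mat_pos (mat_sqrt A)" "mat_sqrt A ** mat_sqrt A = A"
proof -
  have A: "op_pos (mat_op A)" using assms by (simp add: op_pos_mat_op)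
  obtain S where S: "op_pos S" "S o\<^sub>L S = mat_op A"
    using op_pos_sqrt_exists[OF A closed_algebra_bounded_ops op_pos_bounded[OF A]] by blast
  obtain B where B: "S = mat_op B" using mat_op_surj[OF op_pos_bounded[OF S(1)]] by blast
  have "mat_op (B ** B) = mat_op A" using S(2) unfolding B by (simp add: tensor_compose)
  then have BB: "B ** B = A" by (simp only: mat_op_inject)
  have posB: "mat_pos B" using S(1) by (simp add: B op_pos_mat_op)
  have "mat_sqrt A = B"
    unfolding mat_sqrt_def
  proof (rule the_equality)
    fix B' assume B': "mat_pos B' \<and> B' ** B' = A"
    have "mat_op B' = mat_op B"
      by (rule op_pos_sqrt_unique[of _ "mat_op A"])
        (use B' BB posB in \<open>simp_all add: op_pos_mat_op tensor_compose\<close>)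
    then show "B' = B" by (simp only: mat_op_inject)
  qed (use BB posB in simp)
  with BB posB show "mat_pos (mat_sqrt A)" "mat_sqrt A ** mat_sqrt A = A" by simp_all
qed

lemma mat_pos_mat_adj: "mat_pos A \<Longrightarrow> mat_adj A = A"
  using op_pos_adj[of "mat_op A"] by (simp add: op_pos_mat_op adj_tensor mat_op_inject)

text \<open>Writing \<open>B\<close> as the square of its root \<open>b\<close> turns
  \<open>B \<otimes> 1\<close> into \<open>adj (b \<otimes> 1)\<close> times
  \<open>b \<otimes> 1\<close>.\<close>

lemma op_pos_tensor_id: "mat_pos B \<Longrightarrow> op_pos (B \<otimes> id_blinfun)"
  using op_pos_adj_compose[of "mat_sqrt B \<otimes> id_blinfun"] mat_sqrt_works[of B]
    mat_pos_mat_adj[of "mat_sqrt B"]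
  by (simp add: adj_tensor tensor_compose tensor_bounded_ops)

lemma mat_pos_gram: "mat_pos (\<Sum>k\<in>K. mat_adj (X k) ** X k)"
proof -
  have "op_pos (\<Sum>k\<in>K. adj (mat_op (X k)) o\<^sub>L mat_op (X k))"
    by (intro op_pos_sum op_pos_adj_compose tensor_bounded_ops bounded_ops_id)
  then show ?thesis
    by (simp add: adj_tensor tensor_compose tensor_sum_left[symmetric] op_pos_mat_op)
qed

text \<open>It serves to show that the resolvent of \<open>b \<otimes> 1\<close> over the algebra is
  again a scalar matrix tensored with the unit.\<close>

lemma mat_resolvent_exists:
  assumes b: "mat_pos b" and e: "0 < e"
  shows "\<exists>b'. b' ** (b + e *\<^sub>R mat 1) = mat 1"
proof -
  have "mat_op b \<in> bounded_ops" "op_pos (mat_op b)" using b by (simp_all add: op_pos_mat_op tensor_bounded_ops)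
  then obtain q where q: "q \<in> bounded_ops" "q o\<^sub>L (mat_op b + e *\<^sub>R id_blinfun) = id_blinfun"
    using resolvent_exists[OF _ closed_algebra_bounded_ops _ e] by blast
  obtain b' where b': "q = mat_op b'" using mat_op_surj[OF q(1)] by blast
  have "mat_op (b' ** (b + e *\<^sub>R mat 1)) = mat_op (mat 1)"
    using q(2) by (simp add: b' tensor_one[symmetric] tensor_scaleR_left[symmetric]
        tensor_add_left[symmetric] tensor_compose)
  then show ?thesis unfolding mat_op_inject by blast
qed

text \<open>The column half of the coefficient norm. The row half is the same functional at the
  adjoint family, so it suffices to study columns.\<close>

definition col_norm :: "'k set \<Rightarrow> ('k \<Rightarrow> complex ^ 'd ^ 'd) \<Rightarrow> real" where
  "col_norm K X = Re (trace (mat_sqrt (\<Sum>k\<in>K. mat_adj (X k) ** X k)))"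

lemma S1_l2_norm_eq:
  "S1_l2_norm K C = Inf {col_norm K X + col_norm K (\<lambda>k. mat_adj (Y k)) | X Y.
     \<forall>k\<in>K. C k = X k + Y k}"
  unfolding S1_l2_norm_def col_norm_def by simp

section \<open>Matrices over a tracial von Neumann algebra\<close>

definition mat_alg ::
  "('h::complex_hilbert_space \<Rightarrow>\<^sub>L 'h) set \<Rightarrow> (('h ^ 'd) \<Rightarrow>\<^sub>L ('h ^ 'd)) set" where
  "mat_alg M = {f. \<forall>i j. op_entry f i j \<in> M}"

locale vn_trace =
  fixes M :: "('h::complex_hilbert_space \<Rightarrow>\<^sub>L 'h) set" and \<tau> :: "('h \<Rightarrow>\<^sub>L 'h) \<Rightarrow> complex"
  assumes vn: "von_neumann_algebra M" and state: "state_on M \<tau>" and tracial: "tracial_on M \<tau>"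
begin

text \<open>The bicommutant identity presents \<open>M\<close> as a commutant; this is the source of
  its norm closedness and algebraic closure.\<close>

lemma M_eq: "M = {T \<in> bounded_ops. \<forall>s\<in>commutant M. s o\<^sub>L T = T o\<^sub>L s}"
proof -
  have "M = commutant (commutant M)" using vn by (simp add: von_neumann_algebra_def)
  then show ?thesis unfolding commutant_def[of "commutant M"] by (simp only: eq_commute)
qed

lemma closed_algebra_M: "closed_algebra M"
  by (subst M_eq) (rule closed_algebra_commutant)

lemmas M_mem = closed_algebraD(3-8)[OF closed_algebra_M] closed_algebra_sum[OF closed_algebra_M]

lemma M_bounded [simp]: "a \<in> M \<Longrightarrow> a \<in> bounded_ops"
  by (rule closed_algebraD(2)[OF closed_algebra_M])

lemma M_adj: "a \<in> M \<Longrightarrow> adj a \<in> M"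
  using vn by (simp add: von_neumann_algebra_def)

lemma M_op_scale: assumes "a \<in> M" shows "op_scale c a \<in> M"
proof (subst M_eq, intro CollectI conjI ballI)
  show "op_scale c a \<in> bounded_ops" using assms by (simp add: bounded_ops_op_scale)
  fix s assume s: "s \<in> commutant M"
  have "s o\<^sub>L a = a o\<^sub>L s" using assms s by (subst (asm) M_eq) blast
  moreover have "s \<in> bounded_ops" using s by (simp add: commutant_def)
  ultimately show "s o\<^sub>L op_scale c a = op_scale c a o\<^sub>L s"
    by (simp add: op_scale_compose_left op_scale_compose_right)
qed

lemma tau_add: "a \<in> M \<Longrightarrow> b \<in> M \<Longrightarrow> \<tau> (a + b) = \<tau> a + \<tau> b"
  and tau_scale: "a \<in> M \<Longrightarrow> \<tau> (op_scale c a) = c * \<tau> a"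
  and tau_id: "\<tau> id_blinfun = 1"
  and tau_square: "a \<in> M \<Longrightarrow> \<tau> (adj a o\<^sub>L a) \<in> nonneg_Reals"
  using state by (simp_all add: state_on_def)

lemma tau_comm: "a \<in> M \<Longrightarrow> b \<in> M \<Longrightarrow> \<tau> (a o\<^sub>L b) = \<tau> (b o\<^sub>L a)"
  using tracial by (simp add: tracial_on_def)

lemma tau_zero [simp]: "\<tau> 0 = 0"
  using tau_scale[OF M_mem(1), of 0] by simp

lemma tau_diff: "a \<in> M \<Longrightarrow> b \<in> M \<Longrightarrow> \<tau> (a - b) = \<tau> a - \<tau> b"
  using tau_add[of "a - b" b] M_mem(5)[of a b] by simp

lemma tau_sum: "(\<And>k. k \<in> K \<Longrightarrow> f k \<in> M) \<Longrightarrow> \<tau> (sum f K) = (\<Sum>k\<in>K. \<tau> (f k))"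
  by (induction K rule: infinite_finite_induct) (auto simp: tau_add M_mem)

text \<open>Positivity of \<open>adj b b\<close> for \<open>b = a + c\<close> forces
  \<open>c \<tau> (adj a) + cnj c \<tau> a\<close> to be real; \<open>c = 1\<close> and
  \<open>c = \<i>\<close> then determine \<open>\<tau> (adj a)\<close>.\<close>

lemma tau_adj: assumes a: "a \<in> M" shows "\<tau> (adj a) = cnj (\<tau> a)"
proof -
  have *: "Im (c * \<tau> (adj a) + cnj c * \<tau> a) = 0" for c
  proof -
    let ?b = "a + op_scale c id_blinfun"
    have b: "?b \<in> M" by (simp add: M_mem M_op_scale a)
    have "adj ?b o\<^sub>L ?b
        = ((adj a o\<^sub>L a) + op_scale c (adj a)) + (op_scale (cnj c) a + op_scale (cnj c * c) id_blinfun)"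
      using a by (simp add: adj_add bounded_ops_op_scale adj_op_scale blinfun_compose_simps
          op_scale_compose_left op_scale_compose_right adj_bounded_ops op_scale_op_scale)
    then have "\<tau> (adj ?b o\<^sub>L ?b) = (\<tau> (adj a o\<^sub>L a) + c * \<tau> (adj a)) + (cnj c * \<tau> a + cnj c * c)"
      using a by (simp add: tau_add tau_scale M_mem M_adj M_op_scale tau_id)
    moreover have "Im (\<tau> (adj ?b o\<^sub>L ?b)) = 0" "Im (\<tau> (adj a o\<^sub>L a)) = 0"
      using tau_square[OF b] tau_square[OF a] by (simp_all add: complex_nonneg_Reals_iff)
    ultimately show ?thesis by simp
  qed
  show ?thesis using *[of 1] *[of \<i>] by (simp add: complex_eq_iff)
qed

lemma norm2_sq_nonneg: "a \<in> M \<Longrightarrow> 0 \<le> norm2_sq \<tau> a"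
  using tau_square[of a] by (simp add: norm2_sq_def complex_nonneg_Reals_iff)

end

locale vn_matrix = vn_trace M \<tau>
  for M :: "('h::complex_hilbert_space \<Rightarrow>\<^sub>L 'h) set" and \<tau> :: "('h \<Rightarrow>\<^sub>L 'h) \<Rightarrow> complex" +
  fixes dim :: "'d::finite itself"
begin

abbreviation \<A> :: "(('h ^ 'd) \<Rightarrow>\<^sub>L ('h ^ 'd)) set" where "\<A> \<equiv> mat_alg M"

abbreviation \<rho> :: "(('h ^ 'd) \<Rightarrow>\<^sub>L ('h ^ 'd)) \<Rightarrow> real" where "\<rho> f \<equiv> Re (tr_tensor \<tau> f)"

lemma op_entry_mem: "f \<in> \<A> \<Longrightarrow> op_entry f i j \<in> M"
  by (simp add: mat_alg_def)

text \<open>This gives positivity of the trace on matrices, and later lets the scalar second order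
  constant act on matrix coefficients entry by entry.\<close>

lemma rho_square_entries:
  assumes "f \<in> \<A>"
  shows "\<rho> (adj f o\<^sub>L f) = (\<Sum>i\<in>UNIV. \<Sum>j\<in>UNIV. norm2_sq \<tau> (op_entry f j i))"
proof -
  have f: "f \<in> bounded_ops" by (rule bounded_ops_entries) (simp add: op_entry_mem[OF assms])
  show ?thesis
    using assms
    by (simp add: tr_tensor_def op_entry_compose op_entry_adj[OF f] tau_sum M_mem M_adj op_entry_mem
        norm2_sq_def)
qed

sublocale tracial_algebra \<A> \<rho>
proof
  have bounded: "f \<in> bounded_ops" if "f \<in> \<A>" for f
    by (rule bounded_ops_entries) (simp add: op_entry_mem[OF that])
  have "closed \<A>"
  proof -
    have "closed ((\<lambda>f. op_entry f i j) -` M)" for i j :: 'd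
      by (rule continuous_closed_vimage[OF closed_algebraD(1)[OF closed_algebra_M]])
        (intro linear_continuous_at bounded_linear_op_entry)
    then have "closed (\<Inter>i. \<Inter>j. (\<lambda>f :: ('h ^ 'd) \<Rightarrow>\<^sub>L ('h ^ 'd). op_entry f i j) -` M)" by auto
    also have "(\<Inter>i. \<Inter>j. (\<lambda>f. op_entry f i j) -` M) = \<A>" by (auto simp: mat_alg_def)
    finally show ?thesis .
  qed
  then show "closed_algebra \<A>"
    unfolding closed_algebra_def using bounded
    by (auto simp: mat_alg_def op_entry_id op_entry_add op_entry_scaleR op_entry_compose M_mem)
  show "adj a \<in> \<A>" if "a \<in> \<A>" for a
    using that by (simp add: mat_alg_def op_entry_adj[OF bounded[OF that]] M_adj)
  show "\<rho> (a + b) = \<rho> a + \<rho> b" if "a \<in> \<A>" "b \<in> \<A>" for a b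
    using that by (simp add: tr_tensor_def op_entry_add tau_add op_entry_mem sum.distrib)
  show "\<rho> (r *\<^sub>R a) = r * \<rho> a" if "a \<in> \<A>" for a r
    using that by (simp add: tr_tensor_def op_entry_scaleR scaleR_eq_op_scale[of r "op_entry a _ _"]
        tau_scale op_entry_mem sum_distrib_left)
  show "\<rho> (a o\<^sub>L b) = \<rho> (b o\<^sub>L a)" if "a \<in> \<A>" "b \<in> \<A>" for a b
  proof -
    have "tr_tensor \<tau> (a o\<^sub>L b) = (\<Sum>i\<in>UNIV. \<Sum>k\<in>UNIV. \<tau> (op_entry a i k o\<^sub>L op_entry b k i))"
      using that by (simp add: tr_tensor_def op_entry_compose tau_sum M_mem op_entry_mem)
    also have "\<dots> = (\<Sum>k\<in>UNIV. \<Sum>i\<in>UNIV. \<tau> (op_entry b k i o\<^sub>L op_entry a i k))"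
      using that by (subst sum.swap) (simp add: tau_comm[OF op_entry_mem op_entry_mem])
    also have "\<dots> = tr_tensor \<tau> (b o\<^sub>L a)"
      using that by (simp add: tr_tensor_def op_entry_compose tau_sum M_mem op_entry_mem)
    finally show ?thesis by simp
  qed
  show "\<rho> (adj a) = \<rho> a" if "a \<in> \<A>" for a
    using that by (simp add: tr_tensor_def op_entry_adj[OF bounded[OF that]] tau_adj op_entry_mem)
  show "0 \<le> \<rho> (adj a o\<^sub>L a)" if "a \<in> \<A>" for a
    unfolding rho_square_entries[OF that] by (intro sum_nonneg norm2_sq_nonneg op_entry_mem that)
qed

section \<open>Trace pairings and the column norm\<close>

lemma tensor_mem: "S \<in> M \<Longrightarrow> C \<otimes> S \<in> \<A>"
  by (simp add: mat_alg_def M_op_scale)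

lemma tr_tensor_tensor: "S \<in> M \<Longrightarrow> tr_tensor \<tau> ((C :: complex ^ 'd ^ 'd) \<otimes> S) = trace C * \<tau> S"
  by (simp add: tr_tensor_def tau_scale trace_def sum_distrib_right)

lemma rho_tensor_pair:
  "s \<in> M \<Longrightarrow> r \<in> M \<Longrightarrow> \<rho> (adj (C \<otimes> s) o\<^sub>L (D \<otimes> r)) = Re (trace (mat_adj C ** D) * \<tau> (adj s o\<^sub>L r))"
  by (simp add: adj_tensor tensor_compose tr_tensor_tensor M_mem M_adj adj_bounded_ops)

text \<open>These are the facts needed to feed coefficient families into \<open>pairing_le\<close>
  and \<open>pairing_attained\<close>: the matrix root, tensored with the unit, is a positive
  operator root of the Gram sum.\<close>

lemma gram_root:
  fixes X :: "'k \<Rightarrow> complex ^ 'd ^ 'd" and K :: "'k set"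
  defines "p \<equiv> mat_sqrt (\<Sum>k\<in>K. mat_adj (X k) ** X k) \<otimes> (id_blinfun :: 'h \<Rightarrow>\<^sub>L 'h)"
  shows "p \<in> \<A>" "op_pos p" "\<rho> p = col_norm K X"
    "p o\<^sub>L p = (\<Sum>k\<in>K. adj (X k \<otimes> id_blinfun) o\<^sub>L (X k \<otimes> id_blinfun))"
  using mat_sqrt_works[OF mat_pos_gram[of X K]]
  by (simp_all add: p_def tensor_mem M_mem op_pos_tensor_id col_norm_def tr_tensor_tensor tau_id
      tensor_compose adj_tensor tensor_sum_left)

text \<open>Together with \<open>col_norm_attained\<close> this exhibits \<open>col_norm\<close> as
  a supremum of linear functionals, from which its seminorm properties follow.\<close>

lemma col_norm_ge_pairing:
  assumes K: "finite K" and U: "\<And>k. k \<in> K \<Longrightarrow> U k \<in> \<A>" "contractive K U"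
  shows "(\<Sum>k\<in>K. \<rho> (adj (U k) o\<^sub>L (X k \<otimes> id_blinfun))) \<le> col_norm K X"
proof -
  note p = gram_root[where X = X and K = K]
  show ?thesis
    unfolding p(3)[symmetric]
  proof (rule pairing_le[OF K _ U(1) p(1,2) U(2)])
    show "X k \<otimes> id_blinfun \<in> \<A>" for k by (simp add: tensor_mem M_mem)
    fix q assume "q \<in> \<A>"
    then show "(\<Sum>k\<in>K. \<rho> ((adj (X k \<otimes> id_blinfun) o\<^sub>L (X k \<otimes> id_blinfun)) o\<^sub>L q))
        \<le> \<rho> ((mat_sqrt (\<Sum>k\<in>K. mat_adj (X k) ** X k) \<otimes> id_blinfun
              o\<^sub>L mat_sqrt (\<Sum>k\<in>K. mat_adj (X k) ** X k) \<otimes> id_blinfun) o\<^sub>L q)"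
      unfolding p(4) by (simp add: blinfun_compose_simps rho_sum mem tensor_mem M_mem)
  qed auto
qed

lemma col_norm_attained:
  fixes X :: "'k \<Rightarrow> complex ^ 'd ^ 'd"
  assumes "finite K" and "0 < e"
  shows "\<exists>U. (\<forall>k\<in>K. U k \<in> \<A>) \<and> contractive K U \<and>
    col_norm K X \<le> (\<Sum>k\<in>K. \<rho> (adj (U k) o\<^sub>L (X k \<otimes> id_blinfun))) + e"
  unfolding gram_root(3)[where X = X and K = K, symmetric]
  by (rule pairing_attained[OF assms(1) _ gram_root(1,2,4) assms(2)]) (simp add: tensor_mem M_mem)

lemma col_norm_nonneg: "0 \<le> col_norm K (X :: 'k \<Rightarrow> complex ^ 'd ^ 'd)"
  unfolding gram_root(3)[where X = X and K = K, symmetric] by (rule rho_op_pos[OF gram_root(2,1)])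

lemma col_norm_add:
  fixes X Y :: "'k \<Rightarrow> complex ^ 'd ^ 'd"
  assumes K: "finite K"
  shows "col_norm K (\<lambda>k. X k + Y k) \<le> col_norm K X + col_norm K Y"
proof (rule field_le_epsilon)
  fix e :: real assume "0 < e"
  then obtain U where U: "\<And>k. k \<in> K \<Longrightarrow> U k \<in> \<A>" "contractive K U"
    "col_norm K (\<lambda>k. X k + Y k) \<le> (\<Sum>k\<in>K. \<rho> (adj (U k) o\<^sub>L ((X k + Y k) \<otimes> id_blinfun))) + e"
    using col_norm_attained[OF K, of e "\<lambda>k. X k + Y k"] by blast
  have "(\<Sum>k\<in>K. \<rho> (adj (U k) o\<^sub>L ((X k + Y k) \<otimes> id_blinfun)))
      = (\<Sum>k\<in>K. \<rho> (adj (U k) o\<^sub>L (X k \<otimes> id_blinfun))) + (\<Sum>k\<in>K. \<rho> (adj (U k) o\<^sub>L (Y k \<otimes> id_blinfun)))"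
    unfolding sum.distrib[symmetric]
    by (rule sum.cong) (simp_all add: tensor_add_left blinfun_compose_simps rho_add mem tensor_mem M_mem U)
  then show "col_norm K (\<lambda>k. X k + Y k) \<le> col_norm K X + col_norm K Y + e"
    using U(3) col_norm_ge_pairing[OF K U(1,2), of X] col_norm_ge_pairing[OF K U(1,2), of Y] by simp
qed

lemma col_norm_scale:
  fixes X :: "'k \<Rightarrow> complex ^ 'd ^ 'd"
  assumes K: "finite K" and t: "0 \<le> t"
  shows "col_norm K (\<lambda>k. t *\<^sub>R X k) \<le> t * col_norm K X"
proof (rule field_le_epsilon)
  fix e :: real assume "0 < e"
  then obtain U where U: "\<And>k. k \<in> K \<Longrightarrow> U k \<in> \<A>" "contractive K U"
    "col_norm K (\<lambda>k. t *\<^sub>R X k) \<le> (\<Sum>k\<in>K. \<rho> (adj (U k) o\<^sub>L ((t *\<^sub>R X k) \<otimes> id_blinfun))) + e"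
    using col_norm_attained[OF K, of e "\<lambda>k. t *\<^sub>R X k"] by blast
  have "(\<Sum>k\<in>K. \<rho> (adj (U k) o\<^sub>L ((t *\<^sub>R X k) \<otimes> id_blinfun)))
      = t * (\<Sum>k\<in>K. \<rho> (adj (U k) o\<^sub>L (X k \<otimes> id_blinfun)))"
    unfolding sum_distrib_left
    by (rule sum.cong) (simp_all add: tensor_scaleR_left blinfun_compose_simps rho_scaleR mem
        tensor_mem M_mem U)
  then show "col_norm K (\<lambda>k. t *\<^sub>R X k) \<le> t * col_norm K X + e"
    using U(3) mult_left_mono[OF col_norm_ge_pairing[OF K U(1,2), of X] t] by simp
qed

section \<open>Sums over an orthonormal system, duality for the \<open>L1\<close> norm, and the
  first inequality\<close>

lemma rho_orthonormal_sum:
  assumes K: "finite K" and t: "orthonormal_system M \<tau> K t"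
  shows "\<rho> (adj (\<Sum>k\<in>K. X k \<otimes> t k) o\<^sub>L (\<Sum>k\<in>K. Y k \<otimes> t k)) = (\<Sum>k\<in>K. inner (X k) (Y k))"
proof -
  have tM: "t k \<in> M" if "k \<in> K" for k using t that by (simp add: orthonormal_system_def)
  have "\<rho> (adj (\<Sum>k\<in>K. X k \<otimes> t k) o\<^sub>L (\<Sum>k\<in>K. Y k \<otimes> t k))
      = (\<Sum>k\<in>K. \<Sum>l\<in>K. \<rho> (adj (X l \<otimes> t l) o\<^sub>L (Y k \<otimes> t k)))"
    by (simp add: adj_sum tensor_bounded_ops tM blinfun_compose_simps rho_sum mem tensor_mem)
  also have "\<dots> = (\<Sum>k\<in>K. \<Sum>l\<in>K. if l = k then inner (X k) (Y k) else 0)"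
  proof (intro sum.cong refl)
    fix k l assume kl: "k \<in> K" "l \<in> K"
    then have "\<tau> (adj (t l) o\<^sub>L t k) = (if l = k then 1 else 0)"
      using t by (simp add: orthonormal_system_def)
    then show "\<rho> (adj (X l \<otimes> t l) o\<^sub>L (Y k \<otimes> t k)) = (if l = k then inner (X k) (Y k) else 0)"
      using kl by (simp add: rho_tensor_pair tM inner_matrix)
  qed
  also have "\<dots> = (\<Sum>k\<in>K. inner (X k) (Y k))" using K by simp
  finally show ?thesis .
qed

text \<open>\<open>adj g g\<close> need not be dominated by \<open>p p\<close> as an operator; the
  two agree only after \<open>id \<otimes> \<tau>\<close>. This is why \<open>pairing_le\<close>
  compares traces against resolvents of \<open>p\<close> only: since
  \<open>p = b \<otimes> 1\<close>, these are matrices \<open>b' \<otimes> 1\<close>, and against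
  them the traces coincide.\<close>

lemma rho_contraction_le_col_norm:
  assumes K: "finite K" and t: "orthonormal_system M \<tau> K t"
    and U: "U \<in> \<A>" "norm U \<le> 1"
  shows "\<rho> (adj U o\<^sub>L (\<Sum>k\<in>K. X k \<otimes> t k)) \<le> col_norm K X"
proof -
  have tM: "t k \<in> M" if "k \<in> K" for k using t that by (simp add: orthonormal_system_def)
  define g where "g = (\<Sum>k\<in>K. X k \<otimes> t k)"
  have g: "g \<in> \<A>" unfolding g_def by (intro mem tensor_mem tM)
  define b where "b = mat_sqrt (\<Sum>k\<in>K. mat_adj (X k) ** X k)"
  note p = gram_root[where X = X and K = K, folded b_def]
  have bpos: "mat_pos b" and bb: "b ** b = (\<Sum>k\<in>K. mat_adj (X k) ** X k)"
    unfolding b_def by (rule mat_sqrt_works[OF mat_pos_gram])+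
  have "(\<Sum>k\<in>{()}. \<rho> (adj U o\<^sub>L g)) \<le> \<rho> (b \<otimes> id_blinfun)"
  proof (rule pairing_le[OF _ _ _ p(1,2)])
    show "contractive {()} (\<lambda>_. U)" by (rule contractive_singleton[OF U(2)])
  next
    fix e q assume e: "0 < (e :: real)" and q: "q \<in> \<A>"
      "(b \<otimes> id_blinfun + e *\<^sub>R id_blinfun) o\<^sub>L q = id_blinfun"
    obtain b' where b': "b' ** (b + e *\<^sub>R mat 1) = mat 1" using mat_resolvent_exists[OF bpos e] by blast
    have "(b' \<otimes> id_blinfun) o\<^sub>L (b \<otimes> id_blinfun + e *\<^sub>R id_blinfun) = (id_blinfun :: ('h ^ 'd) \<Rightarrow>\<^sub>L ('h ^ 'd))"
      by (simp add: tensor_one[symmetric] tensor_scaleR_left[symmetric] tensor_add_left[symmetric]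
          tensor_compose b')
    \<comment> \<open>A left inverse and a right inverse of the same element agree.\<close>
    then have qb': "q = b' \<otimes> id_blinfun"
      using blinfun_compose_assoc[of "b' \<otimes> id_blinfun" "b \<otimes> id_blinfun + e *\<^sub>R id_blinfun" q]
      by (simp add: q(2))
    have "adj g o\<^sub>L (g o\<^sub>L q) = adj g o\<^sub>L (\<Sum>k\<in>K. (X k ** b') \<otimes> t k)"
      by (simp add: g_def qb' blinfun_compose_simps tensor_compose tM)
    then have "\<rho> ((adj g o\<^sub>L g) o\<^sub>L q) = (\<Sum>k\<in>K. inner (X k) (X k ** b'))"
      using rho_orthonormal_sum[OF K t, of X "\<lambda>k. X k ** b'"]
      by (simp add: blinfun_compose_assoc g_def)
    also have "\<dots> = Re (trace ((\<Sum>k\<in>K. mat_adj (X k) ** X k) ** b'))"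
    proof -
      have "(\<Sum>k\<in>K. mat_adj (X k) ** X k) ** b' = (\<Sum>k\<in>K. mat_adj (X k) ** (X k ** b'))"
        by (simp add: matrix_mult_sum_left matrix_mul_assoc)
      then show ?thesis by (simp add: inner_matrix trace_sum)
    qed
    also have "\<dots> = \<rho> (((b \<otimes> id_blinfun) o\<^sub>L (b \<otimes> id_blinfun)) o\<^sub>L q)"
      by (simp add: qb' tensor_compose tr_tensor_tensor M_mem tau_id bb)
    finally show "(\<Sum>k\<in>{()}. \<rho> ((adj g o\<^sub>L g) o\<^sub>L q))
        \<le> \<rho> (((b \<otimes> id_blinfun) o\<^sub>L (b \<otimes> id_blinfun)) o\<^sub>L q)" by simp
  qed (use g U in simp_all)
  then show ?thesis using p(3) by (simp add: g_def)
qed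

lemma op_abs_works:
  assumes "f \<in> \<A>"
  shows "op_abs f \<in> \<A>" "op_pos (op_abs f)" "op_abs f o\<^sub>L op_abs f = adj f o\<^sub>L f"
  unfolding op_abs_def
  by (rule op_sqrt_works[OF op_pos_adj_compose closed_algebra]; use assms in \<open>simp add: mem\<close>)+

lemma L1_norm_attained:
  assumes f: "f \<in> \<A>" and e: "0 < e"
  shows "\<exists>U\<in>\<A>. norm U \<le> 1 \<and> L1_norm \<tau> f \<le> \<rho> (adj U o\<^sub>L f) + e"
proof -
  obtain U where U: "U () \<in> \<A>" "contractive {()} U" "\<rho> (op_abs f) \<le> \<rho> (adj (U ()) o\<^sub>L f) + e"
    using pairing_attained[of "{()}" "\<lambda>_. f" "op_abs f" e] op_abs_works[OF f] f e by auto
  have "norm (U ()) \<le> 1"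
    by (rule norm_blinfun_bound) (use U(2) in \<open>simp_all add: contractive_def\<close>)
  with U show ?thesis by (auto simp: L1_norm_def)
qed

lemma L1_norm_ge_pairing:
  assumes f: "f \<in> \<A>" and U: "U \<in> \<A>" "norm U \<le> 1"
  shows "\<rho> (adj U o\<^sub>L f) \<le> L1_norm \<tau> f"
proof -
  have "(\<Sum>k\<in>{()}. \<rho> (adj U o\<^sub>L f)) \<le> \<rho> (op_abs f)"
  proof (rule pairing_le[OF _ _ _ op_abs_works(1,2)[OF f]])
    show "contractive {()} (\<lambda>_. U)" by (rule contractive_singleton[OF U(2)])
  qed (use f U op_abs_works(3)[OF f] in simp_all)
  then show ?thesis by (simp add: L1_norm_def)
qed

text \<open>By traciality. Row statements thereby become column statements for the adjoint
  system.\<close>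

lemma orthonormal_system_adj:
  assumes "orthonormal_system M \<tau> K t" shows "orthonormal_system M \<tau> K (\<lambda>k. adj (t k))"
  unfolding orthonormal_system_def
proof (intro conjI ballI)
  show "adj (t k) \<in> M" if "k \<in> K" for k using assms that by (simp add: orthonormal_system_def M_adj)
  show "\<tau> (adj (adj (t k)) o\<^sub>L adj (t l)) = (if k = l then 1 else 0)" if "k \<in> K" "l \<in> K" for k l
  proof -
    have t: "t k \<in> M" "t l \<in> M" using assms that by (simp_all add: orthonormal_system_def)
    have "\<tau> (adj (adj (t k)) o\<^sub>L adj (t l)) = \<tau> (adj (t l) o\<^sub>L t k)"
      using t by (simp add: tau_comm M_adj)
    then show ?thesis using assms that by (simp add: orthonormal_system_def)
  qed
qed

lemma S1_l2_norm_le: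
  fixes X Y C :: "'k \<Rightarrow> complex ^ 'd ^ 'd"
  assumes "\<And>k. k \<in> K \<Longrightarrow> C k = X k + Y k"
  shows "S1_l2_norm K C \<le> col_norm K X + col_norm K (\<lambda>k. mat_adj (Y k))"
  unfolding S1_l2_norm_eq
proof (rule cInf_lower)
  show "bdd_below {col_norm K X + col_norm K (\<lambda>k. mat_adj (Y k)) | X Y. \<forall>k\<in>K. C k = X k + Y k}"
    by (rule bdd_belowI[of _ 0]) (auto intro: add_nonneg_nonneg col_norm_nonneg)
qed (use assms in blast)

lemma S1_l2_norm_greatest:
  fixes C :: "'k \<Rightarrow> complex ^ 'd ^ 'd"
  assumes "\<And>X Y. (\<And>k. k \<in> K \<Longrightarrow> C k = X k + Y k) \<Longrightarrow> m \<le> col_norm K X + col_norm K (\<lambda>k. mat_adj (Y k))"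
  shows "m \<le> S1_l2_norm K C"
  unfolding S1_l2_norm_eq
proof (rule cInf_greatest)
  show "{col_norm K X + col_norm K (\<lambda>k. mat_adj (Y k)) | X Y. \<forall>k\<in>K. C k = X k + Y k} \<noteq> {}"
    using exI[of "\<lambda>X. \<exists>Y. \<forall>k\<in>K. C k = X k + Y k" C, OF exI[of _ "\<lambda>k. 0"]] by simp
qed (use assms in blast)

lemma L1_norm_le_S1_l2_norm:
  fixes C :: "'k \<Rightarrow> complex ^ 'd ^ 'd"
  assumes K: "finite K" and t: "orthonormal_system M \<tau> K t"
  shows "L1_norm \<tau> (\<Sum>k\<in>K. C k \<otimes> t k) \<le> S1_l2_norm K C"
proof (rule S1_l2_norm_greatest)
  fix X Y :: "'k \<Rightarrow> complex ^ 'd ^ 'd"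
  assume C: "\<And>k. k \<in> K \<Longrightarrow> C k = X k + Y k"
  have tM: "t k \<in> M" if "k \<in> K" for k using t that by (simp add: orthonormal_system_def)
  define g where "g = (\<Sum>k\<in>K. X k \<otimes> t k)"
  define h where "h = (\<Sum>k\<in>K. Y k \<otimes> t k)"
  have gA: "g \<in> \<A>" and hA: "h \<in> \<A>" unfolding g_def h_def by (intro mem tensor_mem tM; assumption)+
  have f: "(\<Sum>k\<in>K. C k \<otimes> t k) = g + h"
    unfolding g_def h_def sum.distrib[symmetric] by (rule sum.cong) (simp_all add: C tensor_add_left)
  show "L1_norm \<tau> (\<Sum>k\<in>K. C k \<otimes> t k) \<le> col_norm K X + col_norm K (\<lambda>k. mat_adj (Y k))"
    unfolding f
  proof (rule field_le_epsilon)
    fix e :: real assume e: "0 < e"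
    obtain U where U: "U \<in> \<A>" "norm U \<le> 1" "L1_norm \<tau> (g + h) \<le> \<rho> (adj U o\<^sub>L (g + h)) + e"
      using L1_norm_attained[OF mem(2)[OF gA hA] e] by blast
    have "\<rho> (adj U o\<^sub>L (g + h)) = \<rho> (adj U o\<^sub>L g) + \<rho> (adj U o\<^sub>L h)"
      by (simp add: blinfun_compose_simps rho_add mem gA hA U)
    moreover have "\<rho> (adj U o\<^sub>L g) \<le> col_norm K X"
      unfolding g_def by (rule rho_contraction_le_col_norm[OF K t U(1,2)])
    \<comment> \<open>The row part becomes a column part after taking adjoints: \<open>adj h\<close>
      has coefficients \<open>mat_adj (Y k)\<close> over the orthonormal system
      \<open>adj (t k)\<close>.\<close>
    moreover have "\<rho> (adj U o\<^sub>L h) \<le> col_norm K (\<lambda>k. mat_adj (Y k))"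
    proof -
      have "\<rho> (adj U o\<^sub>L h) = \<rho> (adj (adj U o\<^sub>L h))" by (simp add: rho_adj mem hA U)
      also have "adj (adj U o\<^sub>L h) = adj h o\<^sub>L adj (adj U)"
        using U hA by (simp add: adj_compose mem)
      also have "\<rho> \<dots> = \<rho> (adj (adj U) o\<^sub>L adj h)" by (rule rho_comm) (simp_all add: mem hA U)
      also have "adj h = (\<Sum>k\<in>K. mat_adj (Y k) \<otimes> adj (t k))"
        unfolding h_def by (simp add: adj_sum adj_tensor tM tensor_bounded_ops)
      also have "\<rho> (adj (adj U) o\<^sub>L \<dots>) \<le> col_norm K (\<lambda>k. mat_adj (Y k))"
        by (rule rho_contraction_le_col_norm[OF K orthonormal_system_adj[OF t]])
          (use U norm_adj_le[of U] in \<open>simp_all add: mem\<close>)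
      finally show ?thesis .
    qed
    ultimately show "L1_norm \<tau> (g + h) \<le> col_norm K X + col_norm K (\<lambda>k. mat_adj (Y k)) + e"
      using U(3) by simp
  qed
qed

end

section \<open>Second order estimates and the reverse inequality\<close>

lemma norm_matrix_sq: "(norm (D :: complex ^ 'd ^ 'd))\<^sup>2 = (\<Sum>i\<in>UNIV. \<Sum>j\<in>UNIV. (cmod (D $ j $ i))\<^sup>2)"
  unfolding power2_norm_eq_inner inner_vec_def by (subst sum.swap) simp

text \<open>
  \<open>\<Sum>k B\<^sub>k\<^sup>* B\<^sub>k \<le> 1\<close>, tested on Hilbert--Schmidt vectors.
\<close>

definition mat_contractive :: "'k set \<Rightarrow> ('k \<Rightarrow> complex ^ 'd ^ 'd) \<Rightarrow> bool" where
  "mat_contractive K B \<longleftrightarrow> (\<forall>P :: complex ^ 'd ^ 'd. (\<Sum>k\<in>K. (norm (B k ** P))\<^sup>2) \<le> (norm P)\<^sup>2)"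

text \<open>With \<open>T\<close> the column of the \<open>B k\<close> and
  \<open>Q = adj T T P\<close>, the square of \<open>norm Q\<close> is the pairing of
  \<open>T Q\<close> with \<open>T P\<close>; contractivity at both \<open>Q\<close> and
  \<open>P\<close> bounds twice this by \<open>(norm Q)^2 + (norm P)^2\<close>.\<close>

lemma mat_contractive_gram:
  fixes B :: "'k \<Rightarrow> complex ^ 'd ^ 'd" and P :: "complex ^ 'd ^ 'd"
  assumes B: "mat_contractive K B"
  shows "norm (\<Sum>k\<in>K. mat_adj (B k) ** (B k ** P)) \<le> norm P"
proof -
  define Q where "Q = (\<Sum>k\<in>K. mat_adj (B k) ** (B k ** P))"
  have "2 * (norm Q)\<^sup>2 = (\<Sum>k\<in>K. 2 * inner (B k ** Q) (B k ** P))"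
    by (simp only: power2_norm_eq_inner inner_matrix_mult_left sum_distrib_left[symmetric]
        inner_sum_right[symmetric] Q_def[symmetric])
  also have "\<dots> \<le> (\<Sum>k\<in>K. (norm (B k ** Q))\<^sup>2 + (norm (B k ** P))\<^sup>2)"
  proof (rule sum_mono)
    fix k
    have "0 \<le> (norm (B k ** Q - B k ** P))\<^sup>2" by simp
    then show "2 * inner (B k ** Q) (B k ** P) \<le> (norm (B k ** Q))\<^sup>2 + (norm (B k ** P))\<^sup>2"
      unfolding power2_norm_eq_inner by (simp add: inner_diff_left inner_diff_right inner_commute)
  qed
  also have "\<dots> \<le> (norm Q)\<^sup>2 + (norm P)\<^sup>2"
    using B by (simp add: sum.distrib mat_contractive_def add_mono)
  finally have "(norm Q)\<^sup>2 \<le> (norm P)\<^sup>2" by simp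
  then show ?thesis unfolding Q_def by simp
qed

text \<open>The infimum of the admissible constants is itself admissible for each array: were the
  bound violated, some admissible constant would lie below \<open>n / s\<close>. The injection
  \<open>h\<close> relabels a finite family by pairs of indices of the system.\<close>

lemma best_const_bound:
  fixes a :: "'p \<Rightarrow> complex" and h :: "'p \<Rightarrow> 'i \<times> 'i"
  assumes fin: "best_const \<tau> I z < \<infinity>" and L: "finite L" "inj_on h L" "h ` L \<subseteq> I \<times> I"
    and zero: "\<tau> 0 = 0"
  shows "norm2_sq \<tau> (\<Sum>p\<in>L. op_scale (a p) (z (h p)))
    \<le> enn2real (best_const \<tau> I z) * (\<Sum>p\<in>L. (cmod (a p))\<^sup>2)"
proof -
  \<comment> \<open>The array is extended by zero off the image of \<open>L\<close>; vanishing
    coefficients drop out of the support without changing either sum.\<close>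
  define a' where "a' q = (if q \<in> h ` L then a (the_inv_into L h q) else 0)" for q
  have a': "a' (h p) = a p" if "p \<in> L" for p using that L by (simp add: a'_def the_inv_into_f_f)
  have supp: "{q. a' q \<noteq> 0} \<subseteq> h ` L" by (auto simp: a'_def)
  have sum_a': "(\<Sum>q | a' q \<noteq> 0. f q) = (\<Sum>p\<in>L. f (h p))" if "\<And>q. a' q = 0 \<Longrightarrow> f q = 0"
    for f :: "'i \<times> 'i \<Rightarrow> 'z::comm_monoid_add"
  proof -
    have "(\<Sum>q | a' q \<noteq> 0. f q) = (\<Sum>q\<in>h ` L. f q)"
      using supp L that by (intro sum.mono_neutral_left) auto
    then show ?thesis using L by (simp add: sum.reindex)
  qed
  define n where "n = norm2_sq \<tau> (\<Sum>p\<in>L. op_scale (a p) (z (h p)))"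
  define s where "s = (\<Sum>p\<in>L. (cmod (a p))\<^sup>2)"
  have n: "norm2_sq \<tau> (\<Sum>q | a' q \<noteq> 0. op_scale (a' q) (z q)) = n"
    unfolding n_def by (subst sum_a') (simp_all add: a' cong: sum.cong)
  have s: "(\<Sum>q | a' q \<noteq> 0. (cmod (a' q))\<^sup>2) = s"
    unfolding s_def by (subst sum_a') (simp_all add: a' cong: sum.cong)
  define r where "r = enn2real (best_const \<tau> I z)"
  have r: "best_const \<tau> I z = ennreal r" using fin by (simp add: r_def less_top)
  have s0: "0 \<le> s" by (simp add: s_def sum_nonneg)
  have adm: "ennreal n \<le> Z * ennreal s" if "Z \<in> {Z. \<forall>a :: 'i \<times> 'i \<Rightarrow> complex.
     finite {p. a p \<noteq> 0} \<and> {p. a p \<noteq> 0} \<subseteq> I \<times> I \<longrightarrow>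
     ennreal (norm2_sq \<tau> (\<Sum>p | a p \<noteq> 0. op_scale (a p) (z p)))
       \<le> Z * ennreal (\<Sum>p | a p \<noteq> 0. (cmod (a p))\<^sup>2)}" for Z
    using that[unfolded mem_Collect_eq, rule_format, of a'] finite_subset[OF supp] supp L
    unfolding n s by auto
  have "n \<le> r * s"
  proof (cases "s = 0")
    case True
    then have "a p = 0" if "p \<in> L" for p using L that by (auto simp: s_def sum_nonneg_eq_0_iff)
    then have "n = 0" unfolding n_def by (simp add: norm2_sq_def zero cong: sum.cong)
    with True show ?thesis by simp
  next
    case False
    with s0 have s0: "0 < s" by simp
    show ?thesis
    proof (rule ccontr)
      assume "\<not> n \<le> r * s"
      then have ns: "r < n / s" using s0 by (simp add: field_simps)
      have r0: "0 \<le> r" by (simp add: r_def)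
      have "best_const \<tau> I z < ennreal (n / s)" unfolding r using ns r0 by (simp add: ennreal_lessI)
      then obtain Z where Z: "ennreal n \<le> Z * ennreal s" "Z < ennreal (n / s)"
        unfolding best_const_def Inf_less_iff using adm by blast
      then obtain z where z: "Z = ennreal z" "0 \<le> z" by (cases Z) auto
      have "z < n / s" using Z(2) z by (simp add: ennreal_less_iff)
      moreover have "n \<le> z * s"
        using Z(1) z s0 by (simp add: ennreal_mult[symmetric] ennreal_le_iff)
      ultimately show False using s0 by (simp add: field_simps)
    qed
  qed
  then show ?thesis by (simp add: n_def s_def r_def)
qed

context vn_matrix
begin

text \<open>The Fourier coefficient of \<open>g\<close> along \<open>s\<close>, that is,
  \<open>id \<otimes> \<tau>\<close> applied to \<open>(1 \<otimes> adj s) g\<close>.\<close>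

definition coef :: "('h \<Rightarrow>\<^sub>L 'h) \<Rightarrow> (('h ^ 'd) \<Rightarrow>\<^sub>L ('h ^ 'd)) \<Rightarrow> complex ^ 'd ^ 'd" where
  "coef s g = (\<chi> i j. \<tau> (adj s o\<^sub>L op_entry g i j))"

lemma coef_mult_right:
  assumes "s \<in> M" "g \<in> \<A>" shows "coef s (g o\<^sub>L (P \<otimes> id_blinfun)) = coef s g ** P"
  using assms
  by (simp add: coef_def vec_eq_iff matrix_matrix_mult_def op_entry_compose blinfun_compose_simps
      op_scale_compose_right adj_bounded_ops op_entry_bounded_ops op_entry_mem tau_sum tau_scale
      M_mem M_adj M_op_scale mult.commute)

lemma coef_mult_left:
  assumes "s \<in> M" "g \<in> \<A>" shows "coef s ((P \<otimes> id_blinfun) o\<^sub>L g) = P ** coef s g"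
  using assms
  by (simp add: coef_def vec_eq_iff matrix_matrix_mult_def op_entry_compose blinfun_compose_simps
      op_scale_compose_left op_scale_compose_right adj_bounded_ops op_entry_mem tau_sum tau_scale
      M_mem M_adj M_op_scale)

lemma rho_coef:
  assumes "s \<in> M" "g \<in> \<A>" shows "\<rho> (adj (D \<otimes> s) o\<^sub>L g) = inner D (coef s g)"
proof -
  have "tr_tensor \<tau> (adj (D \<otimes> s) o\<^sub>L g)
      = (\<Sum>i\<in>UNIV. \<Sum>k\<in>UNIV. cnj (D $ k $ i) * \<tau> (adj s o\<^sub>L op_entry g k i))"
    using assms
    by (simp add: tr_tensor_def adj_tensor op_entry_compose op_scale_compose_left mat_adj_def
        tau_sum tau_scale M_mem M_adj M_op_scale op_entry_mem)
  also have "\<dots> = (\<Sum>k\<in>UNIV. \<Sum>i\<in>UNIV. cnj (D $ k $ i) * \<tau> (adj s o\<^sub>L op_entry g k i))"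
    by (rule sum.swap)
  finally show ?thesis by (simp add: inner_vec_def coef_def inner_complex_def)
qed

text \<open>\<open>h\<close> is the projection of \<open>a\<close> onto the span of the system with
  matrix coefficients, so \<open>\<rho> (adj h h) = \<rho> (adj h a)\<close>, and the square of
  \<open>a - h\<close> has nonnegative trace.\<close>

lemma Bessel:
  assumes K: "finite K" and t: "orthonormal_system M \<tau> K t" and a: "a \<in> \<A>"
  shows "(\<Sum>k\<in>K. (norm (coef (t k) a))\<^sup>2) \<le> \<rho> (adj a o\<^sub>L a)"
proof -
  have tM: "t k \<in> M" if "k \<in> K" for k using t that by (simp add: orthonormal_system_def)
  define h where "h = (\<Sum>k\<in>K. coef (t k) a \<otimes> t k)"
  have h: "h \<in> \<A>" unfolding h_def by (intro mem tensor_mem tM)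
  let ?S = "\<Sum>k\<in>K. inner (coef (t k) a) (coef (t k) a)"
  have hh: "\<rho> (adj h o\<^sub>L h) = ?S" unfolding h_def by (rule rho_orthonormal_sum[OF K t])
  have ha: "\<rho> (adj h o\<^sub>L a) = ?S"
    unfolding h_def
    by (simp add: adj_sum tensor_bounded_ops tM blinfun_compose_simps rho_sum mem tensor_mem a rho_coef)
  show ?thesis using rho_pairing_le_squares[OF a h] by (simp add: hh ha power2_norm_eq_inner)
qed

text \<open>
  The square \<open>y\<^sup>* y\<close> splits into its conditional expectation on the matrices, a contraction, and a
  centred part, which is controlled by the second order constant.
\<close>

lemma rho_gram_square_le:
  fixes B :: "'k \<Rightarrow> complex ^ 'd ^ 'd" and K :: "'k set" and t :: "'k \<Rightarrow> ('h \<Rightarrow>\<^sub>L 'h)"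
  defines "w P \<equiv> (adj (\<Sum>k\<in>K. B k \<otimes> t k) o\<^sub>L (\<Sum>k\<in>K. B k \<otimes> t k)) o\<^sub>L (P \<otimes> id_blinfun)"
  assumes K: "finite K" and t: "orthonormal_system M \<tau> K t"
    and Z: "0 \<le> Z" "\<And>a :: 'k \<times> 'k \<Rightarrow> complex. norm2_sq \<tau> (\<Sum>p\<in>K \<times> K. op_scale (a p) (zc t p))
       \<le> Z * (\<Sum>p\<in>K \<times> K. (cmod (a p))\<^sup>2)"
    and B: "mat_contractive K B" "mat_contractive K (\<lambda>k. mat_adj (B k))"
  shows "\<rho> (adj (w P) o\<^sub>L w P) \<le> (1 + Z) * (norm P)\<^sup>2"
proof -
  have tM: "t k \<in> M" if "k \<in> K" for k using t that by (simp add: orthonormal_system_def)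
  define D where "D p = mat_adj (B (fst p)) ** (B (snd p) ** P)" for p
  define S where "S = (\<Sum>k\<in>K. mat_adj (B k) ** (B k ** P))"
  define N where "N = (\<Sum>p\<in>K \<times> K. D p \<otimes> zc t p)"
  have zM: "zc t p \<in> M" if "p \<in> K \<times> K" for p
    using that by (auto simp: zc_def M_mem M_adj tM)
  \<comment> \<open>Orthonormality centres these elements; hence \<open>N\<close> is orthogonal to
    \<open>S \<otimes> 1\<close> and the mixed terms vanish.\<close>
  have tz: "\<tau> (zc t p) = 0" if "p \<in> K \<times> K" for p
    using that t by (auto simp: zc_def tau_diff M_mem M_adj tM tau_id orthonormal_system_def)
  have N: "N \<in> \<A>" unfolding N_def by (intro mem tensor_mem zM)
  have SA: "S \<otimes> id_blinfun \<in> \<A>" by (simp add: tensor_mem M_mem)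
  have "w P = (\<Sum>p\<in>K \<times> K. D p \<otimes> (adj (t (fst p)) o\<^sub>L t (snd p)))"
  proof -
    have "w P = (\<Sum>k\<in>K. \<Sum>l\<in>K. D (l, k) \<otimes> (adj (t l) o\<^sub>L t k))"
      unfolding w_def D_def
      by (simp add: adj_sum tensor_bounded_ops tM blinfun_compose_simps adj_tensor tensor_compose
          adj_bounded_ops bounded_ops_compose matrix_mul_assoc)
    then show ?thesis by (subst (asm) sum.swap) (simp add: sum.cartesian_product split_def)
  qed
  also have "\<dots> = (\<Sum>p\<in>K \<times> K. D p \<otimes> (if fst p = snd p then id_blinfun else 0)) + N"
    unfolding N_def sum.distrib[symmetric]
    by (rule sum.cong) (auto simp: zc_def tensor_diff_right split_def)
  also have "(\<Sum>p\<in>K \<times> K. D p \<otimes> (if fst p = snd p then id_blinfun else 0)) = S \<otimes> (id_blinfun :: 'h \<Rightarrow>\<^sub>L 'h)"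
  proof -
    have "(\<Sum>p\<in>K \<times> K. D p \<otimes> (if fst p = snd p then id_blinfun else 0))
        = (\<Sum>k\<in>K. \<Sum>l\<in>K. if k = l then D (k, k) \<otimes> (id_blinfun :: 'h \<Rightarrow>\<^sub>L 'h) else 0)"
      unfolding sum.cartesian_product by (rule sum.cong) auto
    also have "\<dots> = (\<Sum>k\<in>K. D (k, k) \<otimes> id_blinfun)" using K by simp
    finally show ?thesis by (simp add: S_def D_def tensor_sum_left)
  qed
  finally have w: "w P = S \<otimes> id_blinfun + N" .
  have SS: "\<rho> (adj (S \<otimes> id_blinfun) o\<^sub>L (S \<otimes> id_blinfun)) = (norm S)\<^sup>2"
    by (simp add: rho_tensor_pair M_mem tau_id inner_matrix power2_norm_eq_inner)
  have SN: "\<rho> (adj (S \<otimes> id_blinfun) o\<^sub>L N) = 0"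
    unfolding N_def
    by (simp add: blinfun_compose_simps rho_sum mem tensor_mem SA zM rho_tensor_pair M_mem tz
        cong: sum.cong)
  have NS: "\<rho> (adj N o\<^sub>L (S \<otimes> id_blinfun)) = 0"
    using rho_adj[of "adj (S \<otimes> id_blinfun) o\<^sub>L N"] by (simp add: mem SA N adj_compose SN)
  have "\<rho> (adj (w P) o\<^sub>L w P) = (norm S)\<^sup>2 + \<rho> (adj N o\<^sub>L N)"
  proof -
    have "adj (w P) o\<^sub>L w P = ((adj (S \<otimes> id_blinfun) o\<^sub>L (S \<otimes> id_blinfun)) + (adj (S \<otimes> id_blinfun) o\<^sub>L N))
        + ((adj N o\<^sub>L (S \<otimes> id_blinfun)) + (adj N o\<^sub>L N))"
      unfolding w using N SA by (simp add: adj_add blinfun_compose_simps)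
    then show ?thesis using SS SN NS by (simp add: rho_add mem SA N)
  qed
  moreover have "(norm S)\<^sup>2 \<le> (norm P)\<^sup>2"
    unfolding S_def by (intro power_mono mat_contractive_gram B norm_ge_zero)
  moreover have "\<rho> (adj N o\<^sub>L N) \<le> Z * (norm P)\<^sup>2"
  proof -
    have "\<rho> (adj N o\<^sub>L N)
        = (\<Sum>i\<in>UNIV. \<Sum>j\<in>UNIV. norm2_sq \<tau> (\<Sum>p\<in>K \<times> K. op_scale (D p $ j $ i) (zc t p)))"
      unfolding rho_square_entries[OF N] by (simp add: N_def op_entry_sum)
    \<comment> \<open>The second order constant concerns scalar arrays, so it is applied separately
      to each matrix entry of the coefficients \<open>D p\<close>.\<close>
    also have "\<dots> \<le> (\<Sum>i\<in>UNIV. \<Sum>j\<in>UNIV. Z * (\<Sum>p\<in>K \<times> K. (cmod (D p $ j $ i))\<^sup>2))"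
      by (intro sum_mono Z)
    also have "\<dots> = Z * (\<Sum>p\<in>K \<times> K. (norm (D p))\<^sup>2)"
      unfolding norm_matrix_sq sum_distrib_left[symmetric]
      by (simp add: sum.swap[of _ "K \<times> K"])
    also have "(\<Sum>p\<in>K \<times> K. (norm (D p))\<^sup>2) = (\<Sum>l\<in>K. \<Sum>k\<in>K. (norm (mat_adj (B k) ** (B l ** P)))\<^sup>2)"
      by (subst sum.swap) (simp add: sum.cartesian_product D_def split_def)
    \<comment> \<open>For fixed \<open>l\<close> the row condition absorbs the sum over
      \<open>k\<close>; the column condition then absorbs the sum over \<open>l\<close>.\<close>
    also have "\<dots> \<le> (\<Sum>l\<in>K. (norm (B l ** P))\<^sup>2)"
      by (rule sum_mono) (use B(2) in \<open>simp add: mat_contractive_def\<close>)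
    also have "\<dots> \<le> (norm P)\<^sup>2" using B(1) by (simp add: mat_contractive_def)
    finally show ?thesis using Z(1) by (simp add: mult_left_mono)
  qed
  ultimately show ?thesis unfolding distrib_right by linarith
qed

text \<open>Here \<open>g\<close> stands for the discarded part and \<open>S\<close> for the square
  \<open>adj y y\<close> or \<open>y adj y\<close>. The factor \<open>1 / (4 c)\<close> meets the
  bound \<open>c\<close> on the fourth moment and leaves \<open>1 / 4\<close>.\<close>

lemma rho_square_cut_le:
  assumes g: "g \<in> \<A>" and S: "S \<in> \<A>" and c: "0 < c"
    and le: "\<And>v. (norm (blinfun_apply g v))\<^sup>2 \<le> (norm (blinfun_apply S v))\<^sup>2 / (4 * c)"
    and w: "\<rho> (adj (S o\<^sub>L (P \<otimes> id_blinfun)) o\<^sub>L (S o\<^sub>L (P \<otimes> id_blinfun))) \<le> c * (norm P)\<^sup>2"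
  shows "4 * \<rho> (adj (g o\<^sub>L (P \<otimes> id_blinfun)) o\<^sub>L (g o\<^sub>L (P \<otimes> id_blinfun))) \<le> (norm P)\<^sup>2"
proof -
  define T where "T = S o\<^sub>L (P \<otimes> (id_blinfun :: 'h \<Rightarrow>\<^sub>L 'h))"
  define u where "u = 1 / (2 * sqrt c)"
  have u: "u * u = 1 / (4 * c)" using c by (simp add: u_def)
  have T: "T \<in> \<A>" unfolding T_def by (simp add: mem S tensor_mem M_mem)
  have "\<rho> (adj (g o\<^sub>L (P \<otimes> id_blinfun)) o\<^sub>L (g o\<^sub>L (P \<otimes> id_blinfun))) \<le> \<rho> (adj (u *\<^sub>R T) o\<^sub>L (u *\<^sub>R T))"
  proof (rule rho_square_mono)
    show "(norm (blinfun_apply (g o\<^sub>L (P \<otimes> id_blinfun)) v))\<^sup>2 \<le> (norm (blinfun_apply (u *\<^sub>R T) v))\<^sup>2" for v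
      using le[of "blinfun_apply (P \<otimes> id_blinfun) v"]
      by (simp add: T_def blinfun.scaleR_left power_mult_distrib power2_eq_square[of u] u)
  qed (simp_all add: mem T g tensor_mem M_mem)
  also have "\<dots> = u * u * \<rho> (adj T o\<^sub>L T)"
    using T by (simp add: adj_scaleR blinfun_compose_simps rho_scaleR mem)
  also have "\<dots> \<le> 1 / (4 * c) * (c * (norm P)\<^sup>2)"
    unfolding u using w c by (intro mult_left_mono) (simp_all add: T_def)
  also have "\<dots> = (norm P)\<^sup>2 / 4" using c by simp
  finally show ?thesis by simp
qed

lemma mat_contractive_pairing_le:
  fixes C :: "'k \<Rightarrow> complex ^ 'd ^ 'd"
  assumes K: "finite K" and t: "orthonormal_system M \<tau> K t"
    and Z: "0 \<le> Z" "\<And>a :: 'k \<times> 'k \<Rightarrow> complex. norm2_sq \<tau> (\<Sum>p\<in>K \<times> K. op_scale (a p) (zc t p))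
       \<le> Z * (\<Sum>p\<in>K \<times> K. (cmod (a p))\<^sup>2)"
    "\<And>a :: 'k \<times> 'k \<Rightarrow> complex. norm2_sq \<tau> (\<Sum>p\<in>K \<times> K. op_scale (a p) (zc (\<lambda>k. adj (t k)) p))
       \<le> Z * (\<Sum>p\<in>K \<times> K. (cmod (a p))\<^sup>2)"
    and B: "mat_contractive K B" "mat_contractive K (\<lambda>k. mat_adj (B k))"
  shows "(\<Sum>k\<in>K. inner (B k) (C k)) \<le> sqrt (1 + Z) * L1_norm \<tau> (\<Sum>k\<in>K. C k \<otimes> t k)"
proof -
  have tM: "t k \<in> M" if "k \<in> K" for k using t that by (simp add: orthonormal_system_def)
  define f where "f = (\<Sum>k\<in>K. C k \<otimes> t k)"
  have f: "f \<in> \<A>" unfolding f_def by (intro mem tensor_mem tM)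
  define c where "c = 1 + Z"
  have c: "0 < c" using Z(1) by (simp add: c_def)
  define V where "V = {B :: 'k \<Rightarrow> complex ^ 'd ^ 'd.
    mat_contractive K B \<and> mat_contractive K (\<lambda>k. mat_adj (B k))}"
  define m where "m = Sup ((\<lambda>B. \<Sum>k\<in>K. inner (B k) (C k)) ` V)"
  \<comment> \<open>Finiteness of \<open>m\<close> is what permits absorbing \<open>m / 2\<close> at
    the end. Testing the column condition at the unit matrix bounds all \<open>B k\<close> at
    once.\<close>
  have bdd: "bdd_above ((\<lambda>B. \<Sum>k\<in>K. inner (B k) (C k)) ` V)"
  proof (rule bdd_aboveI2)
    fix B assume "B \<in> V"
    then have "\<forall>P :: complex ^ 'd ^ 'd. (\<Sum>k\<in>K. (norm (B k ** P))\<^sup>2) \<le> (norm P)\<^sup>2"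
      by (simp add: V_def mat_contractive_def)
    from spec[OF this, of "mat 1"]
    have 1: "(\<Sum>k\<in>K. (norm (B k))\<^sup>2) \<le> (norm (mat 1 :: complex ^ 'd ^ 'd))\<^sup>2" by simp
    have "inner (B k) (C k) \<le> (norm (B k))\<^sup>2 + (norm (C k))\<^sup>2" for k
    proof -
      have "0 \<le> (norm (B k - C k))\<^sup>2" "0 \<le> (norm (B k))\<^sup>2" "0 \<le> (norm (C k))\<^sup>2" by simp_all
      then show ?thesis
        unfolding power2_norm_eq_inner inner_diff_left inner_diff_right inner_commute[of "C k" "B k"]
        by linarith
    qed
    then have "(\<Sum>k\<in>K. inner (B k) (C k)) \<le> (\<Sum>k\<in>K. (norm (B k))\<^sup>2) + (\<Sum>k\<in>K. (norm (C k))\<^sup>2)"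
      unfolding sum.distrib[symmetric] by (rule sum_mono)
    with 1 show "(\<Sum>k\<in>K. inner (B k) (C k))
        \<le> (norm (mat 1 :: complex ^ 'd ^ 'd))\<^sup>2 + (\<Sum>k\<in>K. (norm (C k))\<^sup>2)" by linarith
  qed
  have step: "(\<Sum>k\<in>K. inner (B k) (C k)) \<le> sqrt c / 2 * L1_norm \<tau> f + m / 2" if "B \<in> V" for B
  proof -
    have B: "mat_contractive K B" "mat_contractive K (\<lambda>k. mat_adj (B k))"
      using \<open>B \<in> V\<close> by (simp_all add: V_def)
    define y where "y = (\<Sum>k\<in>K. B k \<otimes> t k)"
    have y: "y \<in> \<A>" unfolding y_def by (intro mem tensor_mem tM)
    obtain z where z: "z \<in> \<A>" "norm z \<le> sqrt c / 2"
      and col: "\<And>v. (norm (blinfun_apply (y - z) v))\<^sup>2 \<le> (norm (blinfun_apply (adj y o\<^sub>L y) v))\<^sup>2 / (4 * c)"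
      and row: "\<And>v. (norm (blinfun_apply (adj (y - z)) v))\<^sup>2
         \<le> (norm (blinfun_apply (y o\<^sub>L adj y) v))\<^sup>2 / (4 * c)"
      using cutoff_exists[OF y c] by blast
    define g where "g = y - z"
    have g: "g \<in> \<A>" unfolding g_def by (simp add: mem y z)
    have adj_y: "adj y = (\<Sum>k\<in>K. mat_adj (B k) \<otimes> adj (t k))"
      unfolding y_def by (simp add: adj_sum adj_tensor tM tensor_bounded_ops)
    \<comment> \<open>The factor 2 uses up the 4 in \<open>rho_square_cut_le\<close>:
      \<open>D\<close> is itself admissible, so its pairing with \<open>C\<close> is at most
      \<open>m\<close>.\<close>
    define D where "D k = 2 *\<^sub>R coef (t k) g" for k
    have D1: "mat_contractive K D"
      unfolding mat_contractive_def
    proof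
      fix P :: "complex ^ 'd ^ 'd"
      have "(\<Sum>k\<in>K. (norm (D k ** P))\<^sup>2) = 4 * (\<Sum>k\<in>K. (norm (coef (t k) (g o\<^sub>L (P \<otimes> id_blinfun))))\<^sup>2)"
        unfolding sum_distrib_left
        by (rule sum.cong) (simp_all add: D_def coef_mult_right tM g power_mult_distrib
            scaleR_matrix_mult)
      also have "\<dots> \<le> 4 * \<rho> (adj (g o\<^sub>L (P \<otimes> id_blinfun)) o\<^sub>L (g o\<^sub>L (P \<otimes> id_blinfun)))"
        using Bessel[OF K t, of "g o\<^sub>L (P \<otimes> id_blinfun)"] by (simp add: mem g tensor_mem M_mem)
      also have "\<dots> \<le> (norm P)\<^sup>2"
      proof (rule rho_square_cut_le[OF g _ c])
        show "\<rho> (adj ((adj y o\<^sub>L y) o\<^sub>L P \<otimes> id_blinfun) o\<^sub>L ((adj y o\<^sub>L y) o\<^sub>L P \<otimes> id_blinfun))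
            \<le> c * (norm P)\<^sup>2"
          unfolding y_def c_def by (rule rho_gram_square_le[OF K t Z(1,2) B])
      qed (use y col in \<open>simp_all add: mem g_def\<close>)
      finally show "(\<Sum>k\<in>K. (norm (D k ** P))\<^sup>2) \<le> (norm P)\<^sup>2" .
    qed
    have D2: "mat_contractive K (\<lambda>k. mat_adj (D k))"
      unfolding mat_contractive_def
    proof
      fix P :: "complex ^ 'd ^ 'd"
      \<comment> \<open>The row condition tests coefficients from the left, hence left
        multiplication of \<open>g\<close>. Traciality then exchanges \<open>?a\<close> for its
        adjoint \<open>?b\<close>, to which the bound \<open>row\<close> applies.\<close>
      let ?a = "(mat_adj P \<otimes> id_blinfun) o\<^sub>L g"
      let ?b = "adj g o\<^sub>L (P \<otimes> id_blinfun)"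
      have a: "?a \<in> \<A>" and b: "?b \<in> \<A>" by (simp_all add: mem g tensor_mem M_mem)
      have ba: "adj ?b = ?a" using g by (simp add: adj_compose adj_tensor tensor_bounded_ops mem)
      then have ab: "adj ?a = ?b" using b by (metis adj_adj bounded)
      have "norm (mat_adj (coef (t k) g) ** P) = norm (coef (t k) ?a)" if "k \<in> K" for k
        using norm_mat_adj[of "mat_adj P ** coef (t k) g"] that
        by (simp add: mat_adj_mult coef_mult_left tM g)
      then have "(\<Sum>k\<in>K. (norm (mat_adj (D k) ** P))\<^sup>2) = 4 * (\<Sum>k\<in>K. (norm (coef (t k) ?a))\<^sup>2)"
        unfolding sum_distrib_left
        by (intro sum.cong) (simp_all add: D_def mat_adj_scaleR power_mult_distrib
            scaleR_matrix_mult)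
      also have "\<dots> \<le> 4 * \<rho> (adj ?a o\<^sub>L ?a)" using Bessel[OF K t a] by simp
      also have "\<rho> (adj ?a o\<^sub>L ?a) = \<rho> (adj ?b o\<^sub>L ?b)"
        unfolding ab ba by (rule rho_comm[OF b a])
      also have "4 * \<rho> (adj ?b o\<^sub>L ?b) \<le> (norm P)\<^sup>2"
      proof (rule rho_square_cut_le[OF _ _ c])
        have "y = adj (adj y)" using y by simp
        then show "\<rho> (adj ((y o\<^sub>L adj y) o\<^sub>L P \<otimes> id_blinfun) o\<^sub>L ((y o\<^sub>L adj y) o\<^sub>L P \<otimes> id_blinfun))
            \<le> c * (norm P)\<^sup>2"
          using rho_gram_square_le[OF K orthonormal_system_adj[OF t] Z(1,3), of "\<lambda>k. mat_adj (B k)" P] B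
          by (simp add: adj_y[symmetric] c_def)
      qed (use y g row in \<open>simp_all add: mem g_def\<close>)
      finally show "(\<Sum>k\<in>K. (norm (mat_adj (D k) ** P))\<^sup>2) \<le> (norm P)\<^sup>2" .
    qed
    have "(\<Sum>k\<in>K. inner (D k) (C k)) \<le> m"
      unfolding m_def by (rule cSUP_upper[OF _ bdd]) (simp add: V_def D1 D2)
    moreover have "\<rho> (adj g o\<^sub>L f) = (\<Sum>k\<in>K. inner (D k) (C k)) / 2"
    proof -
      have "\<rho> (adj g o\<^sub>L f) = \<rho> (adj f o\<^sub>L g)"
        using rho_adj[of "adj f o\<^sub>L g"] by (simp add: mem f g adj_compose)
      also have "\<dots> = (\<Sum>k\<in>K. inner (C k) (coef (t k) g))"
        unfolding f_def
        by (simp add: adj_sum tensor_bounded_ops tM blinfun_compose_simps rho_sum mem tensor_mem g rho_coef)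
      finally show ?thesis by (simp add: D_def inner_commute sum_divide_distrib)
    qed
    moreover have "\<rho> (adj z o\<^sub>L f) \<le> sqrt c / 2 * L1_norm \<tau> f"
    proof -
      let ?r = "sqrt c / 2"
      have r: "0 < ?r" using c by simp
      have "\<rho> (adj ((1 / ?r) *\<^sub>R z) o\<^sub>L f) \<le> L1_norm \<tau> f"
        by (rule L1_norm_ge_pairing[OF f]) (use z r in \<open>simp_all add: mem field_simps\<close>)
      also have "\<rho> (adj ((1 / ?r) *\<^sub>R z) o\<^sub>L f) = (1 / ?r) * \<rho> (adj z o\<^sub>L f)"
        using z f by (simp add: adj_scaleR blinfun_compose_simps rho_scaleR mem)
      finally show ?thesis using r by (simp add: field_simps)
    qed
    moreover have "\<rho> (adj y o\<^sub>L f) = (\<Sum>k\<in>K. inner (B k) (C k))"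
      unfolding y_def f_def by (rule rho_orthonormal_sum[OF K t])
    moreover have "\<rho> (adj y o\<^sub>L f) = \<rho> (adj z o\<^sub>L f) + \<rho> (adj g o\<^sub>L f)"
    proof -
      have "adj y o\<^sub>L f = (adj z o\<^sub>L f) + (adj g o\<^sub>L f)"
        using y z by (simp add: g_def adj_diff blinfun_compose_simps)
      then show ?thesis by (simp add: rho_add mem f g z)
    qed
    ultimately show ?thesis by linarith
  qed
  have BV: "B \<in> V" using B by (simp add: V_def)
  \<comment> \<open>With \<open>s\<close> the first summand this says \<open>m / 2 \<le> s\<close>,
    so that \<open>step\<close> at \<open>B\<close> yields the bound \<open>2 * s\<close>.\<close>
  have "m \<le> sqrt c / 2 * L1_norm \<tau> f + m / 2"
    unfolding m_def by (rule cSUP_least) (use BV step[unfolded m_def] in auto)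
  then show ?thesis using step[OF BV] by (simp add: f_def c_def)
qed

text \<open>Tested at \<open>X k = B k P adj P\<close>, the left side becomes \<open>N\<close>, the
  sum of the squares of \<open>norm (B k P)\<close>, while duality bounds twice
  \<open>col_norm K X\<close> by \<open>(norm P)^2 + N\<close>. Hence
  \<open>N \<le> (norm P)^2\<close>.\<close>

lemma mat_contractive_if_dominated:
  fixes B :: "'k \<Rightarrow> complex ^ 'd ^ 'd"
  assumes K: "finite K" and le: "\<And>X. (\<Sum>k\<in>K. inner (B k) (X k)) \<le> col_norm K X"
  shows "mat_contractive K B"
  unfolding mat_contractive_def
proof
  fix P :: "complex ^ 'd ^ 'd"
  let ?P = "P \<otimes> (id_blinfun :: 'h \<Rightarrow>\<^sub>L 'h)"
  define N where "N = (\<Sum>k\<in>K. (norm (B k ** P))\<^sup>2)"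
  define X where "X k = (B k ** P) ** mat_adj P" for k
  have PA: "?P \<in> \<A>" by (simp add: tensor_mem M_mem)
  have "2 * N \<le> (norm P)\<^sup>2 + N + e" if e: "0 < e" for e
  proof -
    have "N = (\<Sum>k\<in>K. inner (B k) (X k))"
      unfolding N_def X_def
    proof (rule sum.cong[OF refl])
      fix k
      have "trace (mat_adj P ** (mat_adj (B k) ** (B k ** P))) = trace (mat_adj (B k) ** (B k ** P) ** mat_adj P)"
        by (rule trace_mul_sym)
      then show "(norm (B k ** P))\<^sup>2 = inner (B k) (B k ** P ** mat_adj P)"
        by (simp add: power2_norm_eq_inner inner_matrix mat_adj_mult matrix_mul_assoc)
    qed
    also have "\<dots> \<le> col_norm K X" by (rule le)
    also obtain U where U: "\<And>k. k \<in> K \<Longrightarrow> U k \<in> \<A>" "contractive K U"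
      "col_norm K X \<le> (\<Sum>k\<in>K. \<rho> (adj (U k) o\<^sub>L (X k \<otimes> id_blinfun))) + e / 2"
      using col_norm_attained[OF K, of "e / 2" X] e by auto
    note U(3)
    finally have N1: "2 * N \<le> 2 * (\<Sum>k\<in>K. \<rho> (adj (U k) o\<^sub>L (X k \<otimes> id_blinfun))) + e" by simp
    have "2 * \<rho> (adj (U k) o\<^sub>L (X k \<otimes> id_blinfun))
        \<le> \<rho> (adj (U k o\<^sub>L ?P) o\<^sub>L (U k o\<^sub>L ?P)) + (norm (B k ** P))\<^sup>2" if k: "k \<in> K" for k
    proof -
      let ?b = "(B k ** P) \<otimes> (id_blinfun :: 'h \<Rightarrow>\<^sub>L 'h)"
      let ?a = "U k o\<^sub>L ?P"
      have b: "?b \<in> \<A>" by (simp add: tensor_mem M_mem)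
      have a: "?a \<in> \<A>" by (simp add: mem U k PA)
      have "adj (U k) o\<^sub>L (X k \<otimes> id_blinfun) = (adj (U k) o\<^sub>L ?b) o\<^sub>L adj ?P"
        unfolding X_def using U(1)[OF k]
        by (simp add: adj_tensor blinfun_compose_assoc tensor_compose)
      then have "\<rho> (adj (U k) o\<^sub>L (X k \<otimes> id_blinfun)) = \<rho> (adj ?P o\<^sub>L (adj (U k) o\<^sub>L ?b))"
        by (simp add: rho_comm mem U k PA b)
      also have "adj ?P o\<^sub>L (adj (U k) o\<^sub>L ?b) = adj ?a o\<^sub>L ?b"
        using U(1)[OF k] PA by (simp add: adj_compose blinfun_compose_assoc)
      finally have 1: "\<rho> (adj (U k) o\<^sub>L (X k \<otimes> id_blinfun)) = \<rho> (adj ?a o\<^sub>L ?b)" .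
      have "\<rho> (adj ?b o\<^sub>L ?b) = (norm (B k ** P))\<^sup>2"
        by (simp add: rho_tensor_pair M_mem tau_id inner_matrix power2_norm_eq_inner)
      then show ?thesis using rho_pairing_le_squares[OF b a] unfolding 1 by linarith
    qed
    then have "2 * (\<Sum>k\<in>K. \<rho> (adj (U k) o\<^sub>L (X k \<otimes> id_blinfun)))
        \<le> (\<Sum>k\<in>K. \<rho> (adj (U k o\<^sub>L ?P) o\<^sub>L (U k o\<^sub>L ?P))) + N"
      unfolding sum_distrib_left N_def sum.distrib[symmetric] by (rule sum_mono)
    also have "(\<Sum>k\<in>K. \<rho> (adj (U k o\<^sub>L ?P) o\<^sub>L (U k o\<^sub>L ?P))) \<le> \<rho> (adj ?P o\<^sub>L ?P)"
      by (rule rho_sum_square_mono) (use U(2) in \<open>simp_all add: contractive_def mem U PA\<close>)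
    also have "\<rho> (adj ?P o\<^sub>L ?P) = (norm P)\<^sup>2"
      by (simp add: rho_tensor_pair M_mem tau_id inner_matrix power2_norm_eq_inner)
    finally show ?thesis using N1 by linarith
  qed
  then have "2 * N \<le> (norm P)\<^sup>2 + N" by (rule field_le_epsilon)
  then show "(\<Sum>k\<in>K. (norm (B k ** P))\<^sup>2) \<le> (norm P)\<^sup>2" by (simp add: N_def)
qed

lemma sublinear_S1_l2_norm:
  assumes K: "finite K"
  shows "sublinear (S1_l2_norm K :: ('k \<Rightarrow> complex ^ 'd ^ 'd) \<Rightarrow> real)"
  unfolding sublinear_def
proof (intro conjI allI impI)
  fix C C' :: "'k \<Rightarrow> complex ^ 'd ^ 'd"
  have *: "S1_l2_norm K (\<lambda>k. C k + C' k)
      \<le> (col_norm K X + col_norm K (\<lambda>k. mat_adj (Y k))) + (col_norm K X' + col_norm K (\<lambda>k. mat_adj (Y' k)))"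
    if C: "\<And>k. k \<in> K \<Longrightarrow> C k = X k + Y k" and C': "\<And>k. k \<in> K \<Longrightarrow> C' k = X' k + Y' k" for X Y X' Y'
  proof -
    have "S1_l2_norm K (\<lambda>k. C k + C' k)
        \<le> col_norm K (\<lambda>k. X k + X' k) + col_norm K (\<lambda>k. mat_adj (Y k + Y' k))"
      by (rule S1_l2_norm_le) (simp add: C C')
    then show ?thesis
      using col_norm_add[OF K, of X X'] col_norm_add[OF K, of "\<lambda>k. mat_adj (Y k)" "\<lambda>k. mat_adj (Y' k)"]
      by (simp add: mat_adj_add)
  qed
  have "S1_l2_norm K (\<lambda>k. C k + C' k) - S1_l2_norm K C \<le> S1_l2_norm K C'"
  proof (rule S1_l2_norm_greatest)
    fix X' Y' assume C': "\<And>k. k \<in> K \<Longrightarrow> C' k = X' k + Y' k"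
    have "S1_l2_norm K (\<lambda>k. C k + C' k) - (col_norm K X' + col_norm K (\<lambda>k. mat_adj (Y' k))) \<le> S1_l2_norm K C"
      by (rule S1_l2_norm_greatest) (use *[OF _ C'] in \<open>simp add: algebra_simps\<close>)
    then show "S1_l2_norm K (\<lambda>k. C k + C' k) - S1_l2_norm K C
        \<le> col_norm K X' + col_norm K (\<lambda>k. mat_adj (Y' k))" by simp
  qed
  then show "S1_l2_norm K (\<lambda>k. C k + C' k) \<le> S1_l2_norm K C + S1_l2_norm K C'" by simp
next
  fix r :: real and C :: "'k \<Rightarrow> complex ^ 'd ^ 'd"
  assume r: "0 \<le> r"
  have *: "S1_l2_norm K (\<lambda>k. r *\<^sub>R C k) \<le> r * (col_norm K X + col_norm K (\<lambda>k. mat_adj (Y k)))"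
    if C: "\<And>k. k \<in> K \<Longrightarrow> C k = X k + Y k" for X Y
  proof -
    have "S1_l2_norm K (\<lambda>k. r *\<^sub>R C k)
        \<le> col_norm K (\<lambda>k. r *\<^sub>R X k) + col_norm K (\<lambda>k. mat_adj (r *\<^sub>R Y k))"
      by (rule S1_l2_norm_le) (simp add: C scaleR_add_right)
    then show ?thesis
      using col_norm_scale[OF K r, of X] col_norm_scale[OF K r, of "\<lambda>k. mat_adj (Y k)"]
      by (simp add: mat_adj_scaleR distrib_left)
  qed
  show "S1_l2_norm K (\<lambda>k. r *\<^sub>R C k) \<le> r * S1_l2_norm K C"
  proof (cases "r = 0")
    case True
    then show ?thesis using *[of C "\<lambda>k. 0"] by simp
  next
    case False
    have "S1_l2_norm K (\<lambda>k. r *\<^sub>R C k) / r \<le> S1_l2_norm K C"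
      by (rule S1_l2_norm_greatest) (use * r False in \<open>simp add: divide_le_eq mult.commute\<close>)
    then show ?thesis using r False by (simp add: divide_le_eq mult.commute)
  qed
qed

text \<open>The coefficient norm is an infimal convolution of the column and row norms, so
  decompositions with one part zero show that it lies below each. A norming functional is thus
  dominated by both, and \<open>mat_contractive_if_dominated\<close> makes it admissible for
  \<open>mat_contractive_pairing_le\<close>.\<close>

lemma S1_l2_norm_le_L1_norm:
  fixes C :: "'k \<Rightarrow> complex ^ 'd ^ 'd"
  assumes K: "finite K" and t: "orthonormal_system M \<tau> K t"
    and Z: "0 \<le> Z" "\<And>a :: 'k \<times> 'k \<Rightarrow> complex. norm2_sq \<tau> (\<Sum>p\<in>K \<times> K. op_scale (a p) (zc t p))
       \<le> Z * (\<Sum>p\<in>K \<times> K. (cmod (a p))\<^sup>2)"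
    "\<And>a :: 'k \<times> 'k \<Rightarrow> complex. norm2_sq \<tau> (\<Sum>p\<in>K \<times> K. op_scale (a p) (zc (\<lambda>k. adj (t k)) p))
       \<le> Z * (\<Sum>p\<in>K \<times> K. (cmod (a p))\<^sup>2)"
  shows "S1_l2_norm K C \<le> sqrt (1 + Z) * L1_norm \<tau> (\<Sum>k\<in>K. C k \<otimes> t k)"
proof -
  have "S1_l2_norm K X = S1_l2_norm K Y" if "\<And>k. k \<in> K \<Longrightarrow> X k = Y k"
    for X Y :: "'k \<Rightarrow> complex ^ 'd ^ 'd"
    unfolding S1_l2_norm_def using that by simp
  from norming_functional_exists[OF K sublinear_S1_l2_norm[OF K] this, of C]
  obtain B :: "'k \<Rightarrow> complex ^ 'd ^ 'd"
    where B: "\<And>X. (\<Sum>k\<in>K. inner (B k) (X k)) \<le> S1_l2_norm K X"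
      and C: "S1_l2_norm K C \<le> (\<Sum>k\<in>K. inner (B k) (C k))" by blast
  have col0: "col_norm K (\<lambda>k. 0 :: complex ^ 'd ^ 'd) \<le> 0"
    using col_norm_scale[OF K order_refl, of "\<lambda>k. 0"] by simp
  have "mat_contractive K B"
  proof (rule mat_contractive_if_dominated[OF K])
    fix X :: "'k \<Rightarrow> complex ^ 'd ^ 'd"
    have "S1_l2_norm K X \<le> col_norm K X + col_norm K (\<lambda>k. mat_adj (0 :: complex ^ 'd ^ 'd))"
      by (rule S1_l2_norm_le) simp
    then show "(\<Sum>k\<in>K. inner (B k) (X k)) \<le> col_norm K X" using B[of X] col0 by simp
  qed
  moreover have "mat_contractive K (\<lambda>k. mat_adj (B k))"
  proof (rule mat_contractive_if_dominated[OF K])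
    fix X :: "'k \<Rightarrow> complex ^ 'd ^ 'd"
    have "S1_l2_norm K (\<lambda>k. mat_adj (X k))
        \<le> col_norm K (\<lambda>k. 0 :: complex ^ 'd ^ 'd) + col_norm K (\<lambda>k. mat_adj (mat_adj (X k)))"
      by (rule S1_l2_norm_le) simp
    moreover have "(\<Sum>k\<in>K. inner (mat_adj (B k)) (X k)) = (\<Sum>k\<in>K. inner (B k) (mat_adj (X k)))"
      by (rule sum.cong) (metis inner_mat_adj mat_adj_mat_adj)+
    ultimately show "(\<Sum>k\<in>K. inner (mat_adj (B k)) (X k)) \<le> col_norm K X"
      using B[of "\<lambda>k. mat_adj (X k)"] col0 by simp
  qed
  ultimately show ?thesis
    using mat_contractive_pairing_le[OF K t Z, of B C] C by linarith
qed

end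

theorem theorem3p1:
  fixes M :: "('h::complex_hilbert_space \<Rightarrow>\<^sub>L 'h) set"
    and \<tau> :: "('h \<Rightarrow>\<^sub>L 'h) \<Rightarrow> complex"
    and I :: "'i set" and x :: "'i \<Rightarrow> ('h \<Rightarrow>\<^sub>L 'h)"
    and l :: nat and y :: "nat \<Rightarrow> ('h \<Rightarrow>\<^sub>L 'h)"
    and C :: "nat \<Rightarrow> complex ^ 'd ^ 'd"
  assumes "finite_von_neumann_algebra M"
    and "normal_faithful_tracial_state M \<tau>"
    and "orthonormal_system M \<tau> I x"
    and "Z2c \<tau> I x < \<infinity>" and "Z2r \<tau> I x < \<infinity>"
    and "\<forall>k\<in>{1..l}. y k \<in> x ` I" and "inj_on y {1..l}"
  shows "L1_norm \<tau> (\<Sum>k=1..l. C k \<otimes> y k) \<le> S1_l2_norm {1..l} C \<and>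
         S1_l2_norm {1..l} C
           \<le> sqrt (1 + enn2real (Z2 \<tau> I x)) * L1_norm \<tau> (\<Sum>k=1..l. C k \<otimes> y k)"
proof -
  interpret vn_matrix M \<tau> "TYPE('d)"
    by unfold_locales
      (use assms(1,2) in \<open>simp_all add: finite_von_neumann_algebra_def normal_faithful_tracial_state_def\<close>)
  let ?K = "{1..l}"
  have "\<forall>k\<in>?K. \<exists>i. i \<in> I \<and> y k = x i" using assms(6) by (simp add: image_iff Bex_def)
  \<comment> \<open>Indices are chosen for the given elements; these being distinct,
    \<open>\<sigma>\<close> is injective on \<open>?K\<close> and the subfamily is again an
    orthonormal system.\<close>
  then obtain \<sigma> where "\<forall>k\<in>?K. \<sigma> k \<in> I \<and> y k = x (\<sigma> k)" by (rule bchoice[THEN exE])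
  then have \<sigma>: "\<And>k. k \<in> ?K \<Longrightarrow> \<sigma> k \<in> I" "\<And>k. k \<in> ?K \<Longrightarrow> y k = x (\<sigma> k)" by simp_all
  have inj: "\<sigma> k = \<sigma> k' \<longleftrightarrow> k = k'" if "k \<in> ?K" "k' \<in> ?K" for k k'
    using assms(7) \<sigma>(2)[OF that(1)] \<sigma>(2)[OF that(2)] inj_onD[OF assms(7) _ that] by metis
  have y: "orthonormal_system M \<tau> ?K y"
    using assms(3) unfolding orthonormal_system_def
    by (intro conjI ballI) (simp_all only: \<sigma> inj)
  have xb: "x i \<in> bounded_ops" if "i \<in> I" for i
    using assms(3) that by (simp add: orthonormal_system_def)
  define Z where "Z = enn2real (Z2 \<tau> I x)"
  have fin: "Z2 \<tau> I x < \<infinity>" using assms(4,5) by (simp add: Z2_def)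
  \<comment> \<open>\<open>enn2real\<close> sends infinity to 0, so its monotonicity needs the
    maximum to be finite.\<close>
  have Zc: "enn2real (Z2c \<tau> I x) \<le> Z" and Zr: "enn2real (Z2r \<tau> I x) \<le> Z"
    unfolding Z_def using fin by (auto intro!: enn2real_mono simp: Z2_def)
  define h where "h = (\<lambda>(k, k'). (\<sigma> k, \<sigma> k'))"
  have h: "inj_on h (?K \<times> ?K)" "h ` (?K \<times> ?K) \<subseteq> I \<times> I"
    using inj \<sigma>(1) by (auto simp: h_def inj_on_def)
  have "norm2_sq \<tau> (\<Sum>p\<in>?K \<times> ?K. op_scale (a p) (zc y p)) \<le> Z * (\<Sum>p\<in>?K \<times> ?K. (cmod (a p))\<^sup>2)" for a
  proof -
    have "(\<Sum>p\<in>?K \<times> ?K. op_scale (a p) (zc y p)) = (\<Sum>p\<in>?K \<times> ?K. op_scale (a p) (zc x (h p)))"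
      by (rule sum.cong) (auto simp: zc_def h_def \<sigma> inj)
    then show ?thesis
      using best_const_bound[OF assms(4)[unfolded Z2c_def] _ h, of a]
        mult_right_mono[OF Zc, of "\<Sum>p\<in>?K \<times> ?K. (cmod (a p))\<^sup>2"]
      by (simp add: Z2c_def sum_nonneg)
  qed
  moreover have "norm2_sq \<tau> (\<Sum>p\<in>?K \<times> ?K. op_scale (a p) (zc (\<lambda>k. adj (y k)) p))
      \<le> Z * (\<Sum>p\<in>?K \<times> ?K. (cmod (a p))\<^sup>2)" for a
  proof -
    \<comment> \<open>The column array of the adjoint system is the row array of the original one,
      because \<open>adj (adj (x i)) = x i\<close>.\<close>
    have "(\<Sum>p\<in>?K \<times> ?K. op_scale (a p) (zc (\<lambda>k. adj (y k)) p))
        = (\<Sum>p\<in>?K \<times> ?K. op_scale (a p) (zr x (h p)))"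
      by (rule sum.cong) (auto simp: zc_def zr_def h_def \<sigma> inj xb)
    then show ?thesis
      using best_const_bound[OF assms(5)[unfolded Z2r_def] _ h, of a]
        mult_right_mono[OF Zr, of "\<Sum>p\<in>?K \<times> ?K. (cmod (a p))\<^sup>2"]
      by (simp add: Z2r_def sum_nonneg)
  qed
  moreover have "0 \<le> Z" by (simp add: Z_def)
  ultimately show ?thesis
    using L1_norm_le_S1_l2_norm[OF _ y, of C] S1_l2_norm_le_L1_norm[OF _ y, of Z C]
    unfolding Z_def by simp
qed

end
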